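(* Let $E,A\in\mathbb{R}^{m\times n}$, $B\in\mathbb{R}^{m\times l}$, $C\in\mathbb{R}^{p\times n}$, $D\in\mathbb{R}^{p\times l}$, $K\in\mathbb{R}^{r\times n}$ with $r\le n$, and consider the descriptor system $E\dot x(t)=Ax(t)+Bu(t)$, $y(t)=Cx(t)+Du(t)$, $z(t)=Kx(t)$. Put $\bar E=\begin{bmatrix}E \\ 0\end{bmatrix}$, $\bar A=\begin{bmatrix}A \\ C\end{bmatrix}\in\mathbb{R}^{(m+p)\times n}$, $\mathscr{E}=\begin{bmatrix}E&0\end{bmatrix}$, $\mathscr{A}=\begin{bmatrix}A&B\end{bmatrix}\in\mathbb{R}^{m\times(n+l)}$, $\mathcal{A}=\begin{bmatrix}0&0 \\ A&0\end{bmatrix}\in\mathbb{R}^{nm\times n^2}$ (with $A$ in the last block row and first block column), $\mathcal{A}_1=\begin{bmatrix}0 \\ A\end{bmatrix}\in\mathbb{R}^{nm\times n}$ (with $A$ in the last block row), $\mathcal{C}=\begin{bmatrix}C&0\end{bmatrix}\in\mathbb{R}^{p\times n^2}$ and $\mathcal{K}=\begin{bmatrix}K&0\end{bmatrix}\in\mathbb{R}^{r\times n^2}$. Then the following statements are equivalent: (i) $$\operatorname{rank}\begin{bmatrix}\mathcal{F}_{n,[\mathscr{E},\mathscr{A}]}&\mathcal{A} \\ 0&\mathcal{C} \\ 0&\mathcal{F}_{n,[\bar E,\bar A]} \\ 0&\mathcal{K}\end{bmatrix}=\operatorname{rank}\begin{bmatrix}\mathcal{F}_{n,[\mathscr{E},\mathscr{A}]}&\mathcal{A}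 \\ 0&\mathcal{C} \\ 0&\mathcal{F}_{n,[\bar E,\bar A]}\end{bmatrix}.$$ (ii) $\mathcal{A}^{-1}\big(\operatorname{Im}\mathcal{F}_{n,[\mathscr{E},\mathscr{A}]}\big)\cap\ker\mathcal{C}\cap\ker\mathcal{F}_{n,[\bar E,\bar A]}\subseteq\ker\mathcal{K}$. (iii) $\mathcal{A}_1^{-1}\big(\operatorname{Im}\mathcal{F}_{n,[\mathscr{E},\mathscr{A}]}\big)\cap\mathcal{W}^*_{[E,A,0,C]}\subseteq\ker K$. (iv) $A^{-1}\big(E(\mathcal{V}^{n-1}_{[E,A,B,0]})\big)\cap\mathcal{W}^*_{[E,A,0,C]}\subseteq\ker K$. (v) The completely controllable part of the system is partially impulse observable with respect to the corresponding part of $K$ according to the Kalman controllability decomposition; that is, with the decomposition and notation given in the context, $\{E_{11},A_{11},C_1\}$ is partially impulse observable with respect to $K_1$.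
   Context: For matrices $X,Y$ of equal size and $k\ge1$, $\mathcal{F}_{k,[X,Y]}$ is the block upper bidiagonal matrix with $k$ block rows and $k$ block columns having $X$ in every diagonal block, $Y$ in every block immediately above the diagonal, and zeros elsewhere. Here $n$ is the number of columns of $E$. For a matrix $X$ and a subspace $M$, $X^{-1}M$ denotes the preimage of $M$ under $X$ ($X$ need not be invertible), and $XM$ the image. Generalized Wong sequences of $\{E,A,B,C\}$: $\mathcal{V}^0_{[E,A,B,C]}=\ker C$, $\mathcal{V}^{i+1}_{[E,A,B,C]}=A^{-1}(E\mathcal{V}^i_{[E,A,B,C]}+\operatorname{Im}B)\cap\ker C$; $\mathcal{W}^0_{[E,A,B,C]}=\{0\}$, $\mathcal{W}^{i+1}_{[E,A,B,C]}=E^{-1}(A\mathcal{W}^i_{[E,A,B,C]}+\operatorname{Im}B)\cap\ker C$; limits $\mathcal{V}^*=\bigcap_i\mathcal{V}^i$, $\mathcal{W}^*=\bigcup_i\mathcal{W}^i$. A $0$ in the subscript means the corresponding matrix is replaced by a zero matrix (so $\mathcal{V}^0_{[E,A,B,0]}=\mathbb{R}^n$). Complete controllability: $\{E,A,B\}$ is completely controllable if for all $x_0,x_f\in\mathbb{R}^n$ there exist a solution $(x,u)$ of $E\dot x=Ax+Bu$ (with $x,u$ locally integrable, $Ex$ locally absolutely continuous, equation holding almost everywhere) and $t>0$ such that $x(0)=x_0$ and $x(t)=x_f$; equivalently $\mathcal{V}^*_{[E,A,B,0]}\cap\mathcal{W}^*_{[E,A,B,0]}=\mathbb{R}^n$.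 Kalman controllability decomposition: there exist nonsingular $S\in\mathbb{R}^{m\times m}$, $T\in\mathbb{R}^{n\times n}$ such that $$S(\lambda E-A)T=\begin{bmatrix}\lambda E_{11}-A_{11}&\lambda E_{12}-A_{12}&\lambda E_{13}-A_{13} \\ &\lambda E_{22}-A_{22}&\lambda E_{23}-A_{23} \\ &&\lambda E_{33}-A_{33}\end{bmatrix},\quad SB=\begin{bmatrix}B_1 \\ 0 \\ 0\end{bmatrix},\quad CT=\begin{bmatrix}C_1&C_2&C_3\end{bmatrix},$$ where (1) $E_{11},A_{11}\in\mathbb{R}^{m_1\times n_1}$, $\{E_{11},A_{11},B_1\}$ is completely controllable and $m_1=\operatorname{rank}[E_{11}\ B_1]\le n_1+l$; (2) $E_{22},A_{22}\in\mathbb{R}^{m_2\times n_2}$ with $m_2=n_2$ and $E_{22}$ invertible; (3) $E_{33},A_{33}\in\mathbb{R}^{m_3\times n_3}$, $m_3\ge n_3$, and $\operatorname{rank}(\lambda E_{33}-A_{33})=n_3$ for all $\lambda\in\mathbb{C}$. Correspondingly partition $KT=\begin{bmatrix}K_1&K_2&K_3\end{bmatrix}$. The completely controllable part of the system is $\{E_{11},A_{11},B_1,C_1,D\}$, and the corresponding part of $K$ is $K_1$. Partial impulse observability: let $\mathscr{D}'_{pw\mathscr{C}^\infty}$ be the space of piecewise smooth distributions on $\mathbb{R}$, i.e. distributions of the form $f_{\mathscr{D}}+\sum_{t\in\Theta}D_t$, with $f_{\mathscr{D}}$ induced by a piecewise smooth function $f$, $\Theta\subset\mathbb{R}$ locally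 finite and $D_t$ a finite linear combination of the Dirac impulse at $t$ and its derivatives; the impulsive part at $t$ of such a distribution is $D_t$ ($0$ if $t\notin\Theta$), written $[t]$. The restriction to an interval $I$ is $(f\mathbf{1}_I)_{\mathscr{D}}+\sum_{t\in\Theta\cap I}D_t$. For a system with matrices $E,A,C,K$ ($E,A$ having $n$ columns, $C$ having $p$ rows, $K$ having $r$ rows), let $$\mathscr{B}_{\mathscr{D}}=\{(x,y,z)\in(\mathscr{D}'_{pw\mathscr{C}^\infty})^{n+p+r}\mid E\dot x=Ax,\ y=Cx,\ z=Kx\ \text{hold on }[0,\infty)\ (\text{i.e. after restriction to }[0,\infty))\}.$$ Then $\{E,A,C\}$ is partially impulse observable with respect to $K$ if for all $(x,y,z)\in\mathscr{B}_{\mathscr{D}}$: ($y[t]=0$ for all $t\ge0$) implies ($z[t]=0$ for all $t\ge0$). *)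

theory Defs
  imports
    "HOL-Analysis.Derivative"
    "HOL-Analysis.Set_Integral"
    "HOL-Analysis.Lebesgue_Measure"
    "HOL-Computational_Algebra.Polynomial"
    "Jordan_Normal_Form.Matrix"
    "Jordan_Normal_Form.Matrix_Kernel"
    "Jordan_Normal_Form.DL_Rank"
begin

section \<open>Matrices and subspaces\<close>

abbreviation mrank :: "'a::field mat \<Rightarrow> nat" where
  "mrank X \<equiv> vec_space.rank (dim_row X) X"

definition append_cols :: "'a::zero mat \<Rightarrow> 'a mat \<Rightarrow> 'a mat" (infixr "@\<^sub>c" 66) where
  "X @\<^sub>c Y = four_block_mat X Y (0\<^sub>m 0 (dim_col X)) (0\<^sub>m 0 (dim_col Y))"

text \<open>The \<open>nr \<times> nc\<close> block of \<open>X\<close> whose upper left entry is at position \<open>(i0, j0)\<close>.\<close>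

definition block_at :: "'a mat \<Rightarrow> nat \<Rightarrow> nat \<Rightarrow> nat \<Rightarrow> nat \<Rightarrow> 'a mat" where
  "block_at X i0 j0 nr nc = mat nr nc (\<lambda>(i, j). X $$ (i0 + i, j0 + j))"

text \<open>\<open>block_bidiag k X Y\<close> is \<open>\<F>\<close> with subscript \<open>k, [X, Y]\<close>; \<open>X\<close> and \<open>Y\<close> have equal size.\<close>

definition block_bidiag :: "nat \<Rightarrow> 'a::zero mat \<Rightarrow> 'a mat \<Rightarrow> 'a mat" where
  "block_bidiag k X Y = mat (k * dim_row X) (k * dim_col X)
     (\<lambda>(i, j).
        let bi = i div dim_row X; bj = j div dim_col X;
            ri = i mod dim_row X; rj = j mod dim_col X
        in if bj = bi then X $$ (ri, rj)
           else if bj = bi + 1 then Y $$ (ri, rj)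
           else 0)"

definition mat_im :: "'a::semiring_0 mat \<Rightarrow> 'a vec set \<Rightarrow> 'a vec set" where
  "mat_im X M = (\<lambda>v. X *\<^sub>v v) ` M"

definition mat_preim :: "'a::semiring_0 mat \<Rightarrow> 'a vec set \<Rightarrow> 'a vec set" where
  "mat_preim X M = {v \<in> carrier_vec (dim_col X). X *\<^sub>v v \<in> M}"

definition mat_range :: "'a::semiring_0 mat \<Rightarrow> 'a vec set" where
  "mat_range X = mat_im X (carrier_vec (dim_col X))"

definition subspace_sum :: "'a::plus vec set \<Rightarrow> 'a vec set \<Rightarrow> 'a vec set" where
  "subspace_sum M N = {v + w | v w. v \<in> M \<and> w \<in> N}"


section \<open>Generalized Wong sequences\<close>

fun wong_V :: "real mat \<Rightarrow> real mat \<Rightarrow> real mat \<Rightarrow> real mat \<Rightarrow> nat \<Rightarrow> real vec set" where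
  "wong_V E A B C 0 = mat_kernel C"
| "wong_V E A B C (Suc i) =
     mat_preim A (subspace_sum (mat_im E (wong_V E A B C i)) (mat_range B)) \<inter> mat_kernel C"

fun wong_W :: "real mat \<Rightarrow> real mat \<Rightarrow> real mat \<Rightarrow> real mat \<Rightarrow> nat \<Rightarrow> real vec set" where
  "wong_W E A B C 0 = {0\<^sub>v (dim_col E)}"
| "wong_W E A B C (Suc i) =
     mat_preim E (subspace_sum (mat_im A (wong_W E A B C i)) (mat_range B)) \<inter> mat_kernel C"

definition wong_W_lim :: "real mat \<Rightarrow> real mat \<Rightarrow> real mat \<Rightarrow> real mat \<Rightarrow> real vec set" where
  "wong_W_lim E A B C = (\<Union>i. wong_W E A B C i)"


section \<open>Complete controllability\<close>

definition locally_integrable :: "(real \<Rightarrow> real) \<Rightarrow> bool" where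
  "locally_integrable f \<longleftrightarrow> (\<forall>a b. set_integrable lebesgue {a..b} f)"

definition abs_continuous_on_interval :: "real \<Rightarrow> real \<Rightarrow> (real \<Rightarrow> real) \<Rightarrow> bool" where
  "abs_continuous_on_interval a b f \<longleftrightarrow>
     (\<forall>\<epsilon>>0. \<exists>\<delta>>0. \<forall>(N::nat) s t.
        (\<forall>k<N. a \<le> s k \<and> s k \<le> t k \<and> t k \<le> b) \<longrightarrow>
        (\<forall>k. Suc k < N \<longrightarrow> t k \<le> s (Suc k)) \<longrightarrow>
        (\<Sum>k<N. t k - s k) < \<delta> \<longrightarrow>
        (\<Sum>k<N. \<bar>f (t k) - f (s k)\<bar>) < \<epsilon>)"

definition locally_abs_continuous :: "(real \<Rightarrow> real) \<Rightarrow> bool" where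
  "locally_abs_continuous f \<longleftrightarrow> (\<forall>a b. abs_continuous_on_interval a b f)"

text \<open>The solutions \<open>(x, u)\<close> of \<open>d/dt (E x) = A x + B u\<close> on the real line.\<close>

definition dae_solution ::
  "real mat \<Rightarrow> real mat \<Rightarrow> real mat \<Rightarrow> (real \<Rightarrow> real vec) \<Rightarrow> (real \<Rightarrow> real vec) \<Rightarrow> bool" where
  "dae_solution E A B x u \<longleftrightarrow>
     (\<forall>s. x s \<in> carrier_vec (dim_col E)) \<and>
     (\<forall>s. u s \<in> carrier_vec (dim_col B)) \<and>
     (\<forall>i<dim_col E. locally_integrable (\<lambda>s. x s $ i)) \<and>
     (\<forall>i<dim_col B. locally_integrable (\<lambda>s. u s $ i)) \<and>
     (\<forall>i<dim_row E. locally_abs_continuous (\<lambda>s. (E *\<^sub>v x s) $ i)) \<and>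
     (AE s in lebesgue. \<forall>i<dim_row E.
        ((\<lambda>s'. (E *\<^sub>v x s') $ i) has_real_derivative (A *\<^sub>v x s + B *\<^sub>v u s) $ i) (at s))"

text \<open>A locally integrable \<open>x\<close> is determined only up to a null set, so \<open>x(0) = x\<^sub>0\<close> and
  \<open>x(t) = x\<^sub>f\<close> are read as evaluations at points where \<open>x\<close> is continuous. Without the continuity
  requirement one could redefine \<open>x\<close> at two points along the kernel of \<open>E\<close>, and for instance
  \<open>0 = x\<close> would be completely controllable, contrary to the characterization by the limits of
  the Wong sequences.\<close>

definition has_value_at :: "(real \<Rightarrow> real vec) \<Rightarrow> real \<Rightarrow> real vec \<Rightarrow> bool" where
  "has_value_at x t v \<longleftrightarrow> x t = v \<and> (\<forall>i<dim_vec v. isCont (\<lambda>s. x s $ i) t)"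

definition completely_controllable :: "real mat \<Rightarrow> real mat \<Rightarrow> real mat \<Rightarrow> bool" where
  "completely_controllable E A B \<longleftrightarrow>
     (\<forall>x0 \<in> carrier_vec (dim_col E). \<forall>xf \<in> carrier_vec (dim_col E).
        \<exists>x u t. dae_solution E A B x u \<and> t > 0 \<and> has_value_at x 0 x0 \<and> has_value_at x t xf)"


section \<open>Kalman controllability decomposition\<close>

text \<open>The blocks are recovered from the transformed matrices by means of their sizes. The matrix
  \<open>C\<close> is not constrained by the decomposition, it is only partitioned conformably.\<close>

definition kalman_controllability_decomposition ::
  "real mat \<Rightarrow> real mat \<Rightarrow> real mat \<Rightarrow> real mat \<Rightarrow> real mat \<Rightarrow>
   nat \<times> nat \<times> nat \<Rightarrow> nat \<times> nat \<times> nat \<Rightarrow> bool" where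
  "kalman_controllability_decomposition E A B S T = (\<lambda>(m1, m2, m3) (n1, n2, n3).
     S \<in> carrier_mat (dim_row E) (dim_row E) \<and> invertible_mat S \<and>
     T \<in> carrier_mat (dim_col E) (dim_col E) \<and> invertible_mat T \<and>
     m1 + m2 + m3 = dim_row E \<and> n1 + n2 + n3 = dim_col E \<and>
     (let E' = S * E * T; A' = S * A * T; B' = S * B; l = dim_col B;
          E11 = block_at E' 0 0 m1 n1; A11 = block_at A' 0 0 m1 n1;
          B1 = block_at B' 0 0 m1 l;
          E22 = block_at E' m1 n1 m2 n2;
          E33 = block_at E' (m1 + m2) (n1 + n2) m3 n3;
          A33 = block_at A' (m1 + m2) (n1 + n2) m3 n3
      in
        (\<forall>X \<in> {E', A'}.
           block_at X m1 0 m2 n1 = 0\<^sub>m m2 n1 \<and>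
           block_at X (m1 + m2) 0 m3 n1 = 0\<^sub>m m3 n1 \<and>
           block_at X (m1 + m2) n1 m3 n2 = 0\<^sub>m m3 n2) \<and>
        block_at B' m1 0 m2 l = 0\<^sub>m m2 l \<and>
        block_at B' (m1 + m2) 0 m3 l = 0\<^sub>m m3 l \<and>
        completely_controllable E11 A11 B1 \<and>
        m1 = mrank (E11 @\<^sub>c B1) \<and> m1 \<le> n1 + l \<and>
        m2 = n2 \<and> invertible_mat E22 \<and>
        m3 \<ge> n3 \<and>
        (\<forall>\<mu>::complex.
           mrank (\<mu> \<cdot>\<^sub>m map_mat complex_of_real E33 - map_mat complex_of_real A33) = n3)))"


section \<open>Piecewise smooth distributions\<close>

definition smooth_fun :: "(real \<Rightarrow> real) \<Rightarrow> bool" where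
  "smooth_fun f \<longleftrightarrow> (\<forall>k s. ((deriv ^^ k) f) differentiable (at s))"

definition test_fun :: "(real \<Rightarrow> real) \<Rightarrow> bool" where
  "test_fun \<phi> \<longleftrightarrow> smooth_fun \<phi> \<and> (\<exists>a b. \<forall>s. s \<notin> {a..b} \<longrightarrow> \<phi> s = 0)"

definition locally_finite_set :: "real set \<Rightarrow> bool" where
  "locally_finite_set S \<longleftrightarrow> (\<forall>a b. finite (S \<inter> {a..b}))"

text \<open>Piecewise smooth functions: between consecutive break points \<open>f\<close> is the restriction of a
  function that is smooth on the whole real line (so all one-sided derivatives exist at the break
  points). The values at the break points are irrelevant for the induced distribution.\<close>

definition piecewise_smooth :: "(real \<Rightarrow> real) \<Rightarrow> bool" where
  "piecewise_smooth f \<longleftrightarrow>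
     (\<exists>S. locally_finite_set S \<and>
        (\<forall>a b. a < b \<longrightarrow> {a<..<b} \<inter> S = {} \<longrightarrow>
           (\<exists>g. smooth_fun g \<and> (\<forall>s\<in>{a<..<b}. f s = g s))))"

text \<open>Distributions are functionals, of which only the values on test functions matter. A finite
  linear combination of the Dirac impulse at \<open>t\<close> and its derivatives is encoded by the polynomial
  of its coefficients: \<open>c\<close> stands for the sum of the \<open>coeff c j\<close> times the \<open>j\<close>-th derivative
  of the Dirac impulse at \<open>t\<close>.\<close>

type_synonym distr = "(real \<Rightarrow> real) \<Rightarrow> real"

definition dirac_comb :: "real \<Rightarrow> real poly \<Rightarrow> distr" where
  "dirac_comb t c \<phi> =
     (\<Sum>j\<le>Polynomial.degree c. Polynomial.coeff c j * ((-1) ^ j * (deriv ^^ j) \<phi> t))"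

definition pw_distr :: "(real \<Rightarrow> real) \<Rightarrow> (real \<Rightarrow> real poly) \<Rightarrow> distr" where
  "pw_distr f D \<phi> =
     (LINT s|lborel. f s * \<phi> s) +
     (\<Sum>t | D t \<noteq> 0 \<and> t \<in> closure {s. \<phi> s \<noteq> 0}. dirac_comb t (D t) \<phi>)"

definition represents :: "(real \<Rightarrow> real) \<Rightarrow> (real \<Rightarrow> real poly) \<Rightarrow> distr \<Rightarrow> bool" where
  "represents f D U \<longleftrightarrow>
     piecewise_smooth f \<and> locally_finite_set {t. D t \<noteq> 0} \<and>
     (\<forall>\<phi>. test_fun \<phi> \<longrightarrow> U \<phi> = pw_distr f D \<phi>)"

definition is_pw_distr :: "distr \<Rightarrow> bool" where
  "is_pw_distr U \<longleftrightarrow> (\<exists>f D. represents f D U)"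

text \<open>The function part is unique almost everywhere and the impulsive part is unique, so the
  choice below affects neither the impulsive part nor the restriction (on test functions).\<close>

definition pw_rep :: "distr \<Rightarrow> (real \<Rightarrow> real) \<times> (real \<Rightarrow> real poly)" where
  "pw_rep U = (SOME (f, D). represents f D U)"

definition impulse_part :: "distr \<Rightarrow> real \<Rightarrow> real poly" where
  "impulse_part U t = snd (pw_rep U) t"

definition restrict_distr :: "real set \<Rightarrow> distr \<Rightarrow> distr" where
  "restrict_distr I U =
     pw_distr (\<lambda>s. fst (pw_rep U) s * indicator I s)
              (\<lambda>t. if t \<in> I then snd (pw_rep U) t else 0)"

text \<open>Tuples of \<open>k\<close> distributions are functionals with values in \<open>\<real>\<^sup>k\<close>, so a matrix acts on them
  by acting on the values.\<close>

type_synonym distr_vec = "(real \<Rightarrow> real) \<Rightarrow> real vec"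

definition component :: "distr_vec \<Rightarrow> nat \<Rightarrow> distr" where
  "component U i = (\<lambda>\<phi>. U \<phi> $ i)"

definition pw_distr_vec :: "nat \<Rightarrow> distr_vec set" where
  "pw_distr_vec k =
     {U. (\<forall>\<phi>. U \<phi> \<in> carrier_vec k) \<and> (\<forall>i<k. is_pw_distr (component U i))}"

definition distr_deriv :: "distr_vec \<Rightarrow> distr_vec" where
  "distr_deriv U = (\<lambda>\<phi>. - U (deriv \<phi>))"

definition mat_distr :: "real mat \<Rightarrow> distr_vec \<Rightarrow> distr_vec" where
  "mat_distr X U = (\<lambda>\<phi>. X *\<^sub>v U \<phi>)"

definition distr_eq_on :: "nat \<Rightarrow> real set \<Rightarrow> distr_vec \<Rightarrow> distr_vec \<Rightarrow> bool" where
  "distr_eq_on k I U V \<longleftrightarrow>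
     (\<forall>i<k. \<forall>\<phi>. test_fun \<phi> \<longrightarrow>
        restrict_distr I (component U i) \<phi> = restrict_distr I (component V i) \<phi>)"


section \<open>Partial impulse observability\<close>

definition distr_behaviour ::
  "real mat \<Rightarrow> real mat \<Rightarrow> real mat \<Rightarrow> real mat \<Rightarrow> (distr_vec \<times> distr_vec \<times> distr_vec) set" where
  "distr_behaviour E A C K =
     {(x, y, z). x \<in> pw_distr_vec (dim_col E) \<and>
        y \<in> pw_distr_vec (dim_row C) \<and> z \<in> pw_distr_vec (dim_row K) \<and>
        distr_eq_on (dim_row E) {0..} (mat_distr E (distr_deriv x)) (mat_distr A x) \<and>
        distr_eq_on (dim_row C) {0..} y (mat_distr C x) \<and>
        distr_eq_on (dim_row K) {0..} z (mat_distr K x)}"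

definition impulse_free_at :: "nat \<Rightarrow> distr_vec \<Rightarrow> real \<Rightarrow> bool" where
  "impulse_free_at k U t \<longleftrightarrow> (\<forall>i<k. impulse_part (component U i) t = 0)"

definition partially_impulse_observable ::
  "real mat \<Rightarrow> real mat \<Rightarrow> real mat \<Rightarrow> real mat \<Rightarrow> bool" where
  "partially_impulse_observable E A C K \<longleftrightarrow>
     (\<forall>(x, y, z) \<in> distr_behaviour E A C K.
        (\<forall>t\<ge>0. impulse_free_at (dim_row C) y t) \<longrightarrow>
        (\<forall>t\<ge>0. impulse_free_at (dim_row K) z t))"

end

theory Submission
  imports Defs "HOL-Analysis.Equivalence_Lebesgue_Henstock_Integration"
    "HOL-Computational_Algebra.Fundamental_Theorem_Algebra"
begin

text \<open>The rank equality (i) says that the kernel of the smaller block matrix is contained in that of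
  \<open>\<K>\<close>. A vector in the kernel of \<open>\<F>\<close> with subscript \<open>n, [\<E>, \<A>]\<close>, read block by block, is a
  chain \<open>E x_i = A x_(i+1)\<close>, up to signs and inputs, and such chains are exactly what the Wong
  sequences record; a chain of length \<open>n + 1\<close> for \<open>W\<close> can be shortened because its vectors are
  linearly dependent, so \<open>W_n\<close> is already the limit. This gives (i)--(iv).

  In Kalman coordinates a vector of the set in (iv) has zero third component because the chains of
  \<open>V\<close> would otherwise produce an eigenvector of the pencil \<open>(E33, A33)\<close>, and zero second component
  because \<open>E22\<close> is invertible. As \<open>[E11 B1]\<close> has full row rank, every vector supported in the first
  component belongs to \<open>V_i\<close>. So (iv) says that the vectors \<open>a\<close> in the Wong limit of
  \<open>(E11, A11, C1)\<close> with \<open>A11 a\<close> in the image of \<open>E11\<close> are killed by \<open>K1\<close>.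

  Finally, the coefficients \<open>a_j\<close> of the impulse of a solution at \<open>t\<close> satisfy
  \<open>E (x(t+) - x(t-)) = A a_0\<close> and \<open>E a_j = A a_(j+1)\<close>, and \<open>C a_j = 0\<close> if \<open>y[t] = 0\<close>; conversely
  every such sequence is the impulse at \<open>0\<close> of a solution that is constant on both sides. Hence
  partial impulse observability is the same condition.\<close>

section \<open>Rank and kernel\<close>

text \<open>The index n - 1 in (iv) is delicate. Elements of \<open>V^i\<close> have zero third
  Kalman component once i >= n3. A point x of the set in (iv) lies in \<open>V^n\<close>, which is
  always enough, but the vector v with \<open>A x = E v\<close> lies only in \<open>V^(n-1)\<close>.
  This fails to suffice only for n3 = n, and then the first component is absent. The block matrices
  yield relations with a plus sign, the Wong sequences relations without; the sign is absorbed
  because the spaces are closed under scalars. The analytic half is shaped by the fact that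
  impulsive part and restriction are defined through a chosen representation. Nothing can be
  computed before representations are known to be unique, and uniqueness needs explicit test
  functions, built from exp(-1/x). Afterwards the impulse of a solution at one time is a list of
  polynomials, and the differential equation is a comparison of their coefficients.\<close>

lemma (in vectorspace) subspace_eq_of_dim_le:
  assumes fd: "fin_dim" and U: "subspace K U V" and W: "subspace K W V" and UW: "U \<subseteq> W"
    and dim: "vectorspace.dim K (vs W) \<le> vectorspace.dim K (vs U)"
  shows "U = W"
proof -
  \<comment> \<open>Independent subsets of a subspace have at most \<open>dim\<close> elements, so a
    maximal one exists, and it generates.\<close>
  have fin: "vectorspace.fin_dim K (vs X)" if X: "subspace K X V" for X
  proof -
    interpret X: vectorspace K "vs X" by (rule subspace_is_vs[OF X])
    have sub: "submodule K X V" using X by (simp add: subspace_def)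
    have XV: "X \<subseteq> carrier V" using sub by (simp add: submodule_def)
    have bd: "finite S \<and> card S \<le> dim" if "S \<subseteq> carrier (vs X)" "X.lin_indpt S" for S
    proof -
      have "S \<subseteq> X" using that by simp
      then have "lin_indpt S" using span_li_not_depend(2)[OF _ sub] that(2) by auto
      then show ?thesis using li_le_dim[OF fd, of S] \<open>S \<subseteq> X\<close> XV by auto
    qed
    have "\<exists>A. finite A \<and> maximal A (\<lambda>S. S \<subseteq> carrier (vs X) \<and> X.lin_indpt S)"
      using maximal_exists[where N = dim and B = "{}" and P = "\<lambda>S. S \<subseteq> carrier (vs X) \<and> X.lin_indpt S"]
        bd by (auto simp: X.lin_dep_def)
    then obtain A where A: "finite A" "maximal A (\<lambda>S. S \<subseteq> carrier (vs X) \<and> X.lin_indpt S)" by blast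
    then have "X.gen_set A" by (intro X.max_li_is_gen) auto
    with A show ?thesis unfolding X.fin_dim_def maximal_def by blast
  qed
  interpret U: vectorspace K "vs U" by (rule subspace_is_vs[OF U])
  interpret W: vectorspace K "vs W" by (rule subspace_is_vs[OF W])
  have subU: "submodule K U V" and subW: "submodule K W V" using U W by (auto simp: subspace_def)
  obtain b where b: "finite b" "U.basis b" using U.finite_basis_exists[OF fin[OF U]] by blast
  have bU: "b \<subseteq> U" "U.lin_indpt b" "U.span b = U" using b(2) by (auto simp: U.basis_def)
  \<comment> \<open>A basis of \<open>U\<close> stays independent in \<open>W\<close> and has at
    least \<open>dim W\<close> elements, so it is also a basis of \<open>W\<close>.\<close>
  have "lin_indpt b" using span_li_not_depend(2)[OF bU(1) subU] bU(2) by auto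
  then have "W.lin_indpt b" using span_li_not_depend(2)[OF _ subW, of b] bU(1) UW by auto
  then have "W.basis b"
    using W.dim_li_is_basis[OF fin[OF W] b(1)] bU(1) UW dim U.dim_basis[OF b] by auto
  then have "W.span b = W" by (auto simp: W.basis_def)
  moreover have "W.span b = span b" using span_li_not_depend(1)[OF _ subW, of b] bU(1) UW by auto
  moreover have "U.span b = span b" using span_li_not_depend(1)[OF bU(1) subU] by auto
  ultimately show ?thesis using bU(3) by simp
qed

lemma mat_range_eq_col_space:
  assumes "X \<in> carrier_mat nr nc"
  shows "mat_range X = vec_space.col_space nr (X :: 'a::field mat)"
proof -
  interpret vec_space "TYPE('a)" nr .
  show ?thesis using col_space_eq[OF assms] assms mult_mat_vec_carrier[OF assms]
    by (auto simp: mat_range_def mat_im_def)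
qed

lemma rank_nullity_mat:
  assumes X: "(X :: 'a::field mat) \<in> carrier_mat nr nc"
  shows "mrank X + kernel_dim X = nc"
proof -
  interpret N: vec_space "TYPE('a)" nc .
  interpret M: vec_space "TYPE('a)" nr .
  interpret kernel nr nc X by unfold_locales (rule X)
  interpret L: linear_map class_ring N.V M.V "\<lambda>v. X *\<^sub>v v"
  proof
    show "(\<lambda>v. X *\<^sub>v v) \<in> module_hom class_ring N.V M.V"
      using X by (auto simp: module_hom_def module_vec_simps class_ring_simps
          mult_add_distrib_mat_vec mult_mat_vec)
  qed
  have ker: "L.kerT = mat_kernel X"
    using X by (auto simp: L.ker_def mat_kernel module_vec_simps)
  have im: "L.imT = M.span (set (cols X))"
    using mat_range_eq_col_space[OF X] X
    by (auto simp: L.im_def M.col_space_def mat_range_def mat_im_def module_vec_simps)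
  have "mrank X = vectorspace.dim class_ring (M.vs L.imT)"
    using X by (simp add: M.rank_def im)
  then show ?thesis using L.rank_nullity[OF N.fin_dim] N.dim_is_n by (simp add: ker)
qed

text \<open>The numbers of rows may differ, so the comparison takes place in the common domain:
  rank-nullity turns equal ranks into equal kernel dimensions, and one kernel contains the
  other.\<close>

lemma kernel_eq_of_rank_eq:
  fixes X Y :: "'a::field mat"
  assumes X: "X \<in> carrier_mat nr nc" and Y: "Y \<in> carrier_mat nr' nc"
    and sub: "mat_kernel Y \<subseteq> mat_kernel X" and rank: "mrank X = mrank Y"
  shows "mat_kernel Y = mat_kernel X"
proof -
  interpret V: vec_space "TYPE('a)" nc .
  interpret X: kernel nr nc X by unfold_locales (rule X)
  interpret Y: kernel nr' nc Y by unfold_locales (rule Y)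
  have ssp: "VectorSpace.subspace class_ring (mat_kernel Z) V.V"
    if Z: "Z \<in> carrier_mat k nc" for Z :: "'a mat" and k
    unfolding subspace_def submodule_def
    using Z mult_add_distrib_mat_vec[OF Z] mult_mat_vec[OF Z] mat_kernel[OF Z] vectorspace.axioms(1)[OF V.vectorspace_axioms]
      V.vectorspace_axioms
    by (auto simp: class_ring_simps module_vec_simps)
  have "kernel_dim X = kernel_dim Y" using rank_nullity_mat[OF X] rank_nullity_mat[OF Y] rank by simp
  then have "X.dim = Y.dim" by simp
  then show ?thesis
    using V.subspace_eq_of_dim_le[OF V.fin_dim ssp[OF Y] ssp[OF X] sub] by simp
qed

lemma mat_kernel_append_rows:
  assumes "X \<in> carrier_mat nr nc" and "Y \<in> carrier_mat nr' nc"
  shows "mat_kernel (X @\<^sub>r Y) = mat_kernel X \<inter> mat_kernel Y"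
proof -
  have XY: "X @\<^sub>r Y \<in> carrier_mat (nr + nr') nc" using assms by blast
  have zero: "0\<^sub>v (nr + nr') = 0\<^sub>v nr @\<^sub>v 0\<^sub>v nr'" by auto
  have "(X @\<^sub>r Y) *\<^sub>v v = 0\<^sub>v (nr + nr') \<longleftrightarrow> X *\<^sub>v v = 0\<^sub>v nr \<and> Y *\<^sub>v v = 0\<^sub>v nr'"
    if v: "v \<in> carrier_vec nc" for v
    unfolding mat_mult_append[OF assms v] zero
    by (rule append_vec_eq[where n = nr]) (use assms v in auto)
  then show ?thesis
    unfolding mat_kernel[OF XY] mat_kernel[OF assms(1)] mat_kernel[OF assms(2)] by auto
qed

lemma rank_eq_iff_kernel_eq:
  fixes X Y :: "'a::field mat"
  assumes X: "X \<in> carrier_mat nr nc" and Y: "Y \<in> carrier_mat nr' nc"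
    and sub: "mat_kernel Y \<subseteq> mat_kernel X"
  shows "mrank Y = mrank X \<longleftrightarrow> mat_kernel X \<subseteq> mat_kernel Y"
proof
  assume "mrank Y = mrank X"
  then show "mat_kernel X \<subseteq> mat_kernel Y" using kernel_eq_of_rank_eq[OF X Y sub] by simp
next
  assume "mat_kernel X \<subseteq> mat_kernel Y"
  then have "mat_kernel Y = mat_kernel X" using sub by blast
  then have "kernel_dim Y = kernel_dim X"
    using X Y unfolding kernel_dim_def by (metis carrier_matD(2))
  then show "mrank Y = mrank X"
    using rank_nullity_mat[OF X] rank_nullity_mat[OF Y] by simp
qed

lemma mat_kernel_of_full_col_rank:
  fixes X :: "'a::field mat"
  assumes X: "X \<in> carrier_mat nr nc" and rank: "mrank X = nc"
    and v: "v \<in> carrier_vec nc" "X *\<^sub>v v = 0\<^sub>v nr"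
  shows "v = 0\<^sub>v nc"
proof -
  \<comment> \<open>The identity matrix is the reference: it has rank \<open>nc\<close>, and its
    zero kernel lies in every kernel.\<close>
  have one: "(1\<^sub>m nc :: 'a mat) \<in> carrier_mat nc nc" by simp
  have ker: "mat_kernel (1\<^sub>m nc :: 'a mat) = {0\<^sub>v nc}" by (auto simp: mat_kernel[OF one])
  have "mrank (1\<^sub>m nc :: 'a mat) = nc"
    using vec_space.det_rank_iff[OF one] by simp
  then have "mat_kernel (1\<^sub>m nc) = mat_kernel X"
    using X by (intro kernel_eq_of_rank_eq[OF X one]) (auto simp: ker rank mat_kernel[OF X])
  then show ?thesis using v ker by (auto simp: mat_kernel[OF X])
qed

lemma mat_range_of_full_row_rank:
  fixes X :: "'a::field mat"
  assumes X: "X \<in> carrier_mat nr nc" and rank: "mrank X = nr"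
  shows "mat_range X = carrier_vec nr"
proof -
  interpret V: vec_space "TYPE('a)" nr .
  have cols: "set (cols X) \<subseteq> carrier_vec nr" using X cols_dim by blast
  have "V.span (set (cols X)) = carrier V.V"
  proof (rule V.subspace_eq_of_dim_le[OF V.fin_dim])
    show "VectorSpace.subspace class_ring (V.span (set (cols X))) V.V"
      using V.span_is_subspace[OF cols] .
    show "VectorSpace.subspace class_ring (carrier V.V) V.V"
      using vectorspace.axioms(1)[OF V.vectorspace_axioms] V.vectorspace_axioms
      unfolding subspace_def submodule_def by (auto simp: module_vec_simps)
    show "V.span (set (cols X)) \<subseteq> carrier V.V" using V.span_is_subset2[OF cols] by simp
    have "V.vs (carrier V.V) = V.V" by (simp add: module_vec_def)
    then show "vectorspace.dim class_ring (V.vs (carrier V.V))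
        \<le> vectorspace.dim class_ring (V.vs (V.span (set (cols X))))"
      using rank X V.dim_is_n by (simp only: V.rank_def carrier_matD)
  qed
  then show ?thesis by (simp add: mat_range_eq_col_space[OF X] V.col_space_def)
qed

text \<open>The vectors are the columns of a square matrix completed by a zero row; its determinant
  vanishes, and a kernel vector holds the coefficients. The general field lets this serve both the
  real chains of W and the complexified chains of V.\<close>

lemma exists_nontrivial_relation:
  fixes f :: "nat \<Rightarrow> 'a::field vec"
  shows "\<exists>c. (\<exists>i\<le>N. c i \<noteq> 0) \<and> (\<forall>j<N. (\<Sum>i\<le>N. c i * f i $ j) = 0)"
proof -
  define M where "M = mat (Suc N) (Suc N) (\<lambda>(j, i). if j < N then f i $ j else 0)"
  have M: "M \<in> carrier_mat (Suc N) (Suc N)" by (simp add: M_def)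
  have "det M = 0"
    using laplace_expansion_row[OF M, of N] by (simp add: M_def)
  then obtain v where v: "v \<in> carrier_vec (Suc N)" "v \<noteq> 0\<^sub>v (Suc N)" "M *\<^sub>v v = 0\<^sub>v (Suc N)"
    using det_0_iff_vec_prod_zero_field[OF M] by blast
  have "\<exists>i\<le>N. v $ i \<noteq> 0" using v(1,2) by (metis eq_vecI carrier_vecD index_zero_vec le_simps(2))
  moreover have "(\<Sum>i\<le>N. v $ i * f i $ j) = 0" if "j < N" for j
  proof -
    have "(M *\<^sub>v v) $ j = (\<Sum>i\<le>N. v $ i * f i $ j)"
      using that v(1) M by (auto simp: scalar_prod_def M_def lessThan_Suc_atMost[symmetric] atLeast0LessThan
          mult.commute intro!: sum.cong)
    then show ?thesis using v(3) that by simp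
  qed
  ultimately show ?thesis by blast
qed

section \<open>Block vectors\<close>

lemma append_cols_carrier [simp]:
  "X \<in> carrier_mat nr n1 \<Longrightarrow> Y \<in> carrier_mat nr n2 \<Longrightarrow> X @\<^sub>c Y \<in> carrier_mat nr (n1 + n2)"
  by (auto simp: append_cols_def)

lemma append_cols_mult_vec:
  fixes X Y :: "'a::semiring_0 mat"
  assumes "X \<in> carrier_mat nr n1" "Y \<in> carrier_mat nr n2" "v \<in> carrier_vec n1" "w \<in> carrier_vec n2"
  shows "(X @\<^sub>c Y) *\<^sub>v (v @\<^sub>v w) = X *\<^sub>v v + Y *\<^sub>v w"
proof (rule eq_vecI)
  fix i assume "i < dim_vec (X *\<^sub>v v + Y *\<^sub>v w)"
  then have i: "i < nr" using assms by simp
  have row: "row (X @\<^sub>c Y) i = row X i @\<^sub>v row Y i"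
    using i assms by (auto simp: append_cols_def)
  have "row X i \<in> carrier_vec n1" "row Y i \<in> carrier_vec n2" using assms by auto
  moreover have "dim_row (X @\<^sub>c Y) = nr" using append_cols_carrier[OF assms(1,2)] by simp
  ultimately show "((X @\<^sub>c Y) *\<^sub>v (v @\<^sub>v w)) $ i = (X *\<^sub>v v + Y *\<^sub>v w) $ i"
    using i assms row by (simp add: scalar_prod_append[of _ n1 _ n2])
qed (use assms in \<open>auto simp: append_cols_def\<close>)

definition vblock :: "nat \<Rightarrow> 'a vec \<Rightarrow> nat \<Rightarrow> 'a vec" where
  "vblock k w i = vec k (\<lambda>j. w $ (i * k + j))"

definition vconcat :: "nat \<Rightarrow> nat \<Rightarrow> (nat \<Rightarrow> 'a vec) \<Rightarrow> 'a vec" where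
  "vconcat N k f = vec (N * k) (\<lambda>j. f (j div k) $ (j mod k))"

lemma vblock_carrier [simp]: "vblock k w i \<in> carrier_vec k" by (simp add: vblock_def)

lemma vconcat_carrier [simp]: "vconcat N k f \<in> carrier_vec (N * k)" by (simp add: vconcat_def)

lemma block_index_less: "i < N \<Longrightarrow> j < k \<Longrightarrow> i * k + j < N * (k::nat)"
  by (metis add.commute add_less_cancel_left less_le_trans mult_Suc mult_le_mono1 Suc_leI)

lemma vblock_vconcat:
  assumes "i < N" "\<And>i. i < N \<Longrightarrow> f i \<in> carrier_vec k"
  shows "vblock k (vconcat N k f) i = f i"
proof (rule eq_vecI)
  have dim: "dim_vec (f i) = k" using assms by auto
  then show "dim_vec (vblock k (vconcat N k f) i) = dim_vec (f i)" by (simp add: vblock_def)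
  fix j assume "j < dim_vec (f i)"
  then show "vblock k (vconcat N k f) i $ j = f i $ j"
    using block_index_less[OF assms(1), of j k] by (simp add: vblock_def vconcat_def dim)
qed

lemma vec_eq_iff_vblocks:
  assumes "v \<in> carrier_vec (N * k)" "w \<in> carrier_vec (N * k)"
  shows "v = w \<longleftrightarrow> (\<forall>i<N. vblock k v i = vblock k w i)"
proof
  assume *: "\<forall>i<N. vblock k v i = vblock k w i"
  show "v = w"
  proof (rule eq_vecI)
    fix j assume "j < dim_vec w"
    then have j: "j < N * k" using assms by simp
    then have "k > 0" by (cases k) auto
    then have "j div k < N" "j mod k < k" using j by (auto simp: less_mult_imp_div_less)
    then have "vblock k v (j div k) $ (j mod k) = vblock k w (j div k) $ (j mod k)" using * by simp
    then show "v $ j = w $ j" using \<open>j mod k < k\<close> by (simp add: vblock_def)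
  qed (use assms in simp)
qed simp

lemma vblock_append_0:
  assumes "v \<in> carrier_vec k"
  shows "vblock k (v @\<^sub>v w) 0 = v"
  using assms by (intro eq_vecI) (auto simp: vblock_def)

lemma block_bidiag_carrier:
  "X \<in> carrier_mat nr nc \<Longrightarrow> block_bidiag k X Y \<in> carrier_mat (k * nr) (k * nc)"
  by (auto simp: block_bidiag_def)

text \<open>Block row i meets only the diagonal block and its right neighbour. The last block row
  has no right neighbour, which is where every chain read off from the matrix ends.\<close>

lemma vblock_block_bidiag_mult:
  fixes X Y :: "'a::comm_semiring_0 mat"
  assumes X: "X \<in> carrier_mat nr nc" and Y: "Y \<in> carrier_mat nr nc" and w: "w \<in> carrier_vec (k * nc)"
    and i: "i < k"
  shows "vblock nr (block_bidiag k X Y *\<^sub>v w) i =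
    (if Suc i < k then X *\<^sub>v vblock nc w i + Y *\<^sub>v vblock nc w (Suc i) else X *\<^sub>v vblock nc w i)"
    (is "_ = ?rhs")
proof (rule eq_vecI)
  show dim: "dim_vec (vblock nr (block_bidiag k X Y *\<^sub>v w) i) = dim_vec ?rhs"
    using X Y by (simp add: vblock_def)
  fix a assume "a < dim_vec ?rhs"
  then have a: "a < nr" using X Y by (simp split: if_splits)
  \<comment> \<open>\<open>g bj\<close> is the contribution of column block \<open>bj\<close> to
    entry \<open>a\<close> of block row \<open>i\<close>; the column sum is grouped into blocks of
    \<open>nc\<close> entries to reach it.\<close>
  define g where "g = (\<lambda>bj. if bj = i then (X *\<^sub>v vblock nc w i) $ a
      else if bj = Suc i then (Y *\<^sub>v vblock nc w (Suc i)) $ a else 0)"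
  have ia: "i * nr + a < k * nr" using i a by (rule block_index_less)
  have "vblock nr (block_bidiag k X Y *\<^sub>v w) i $ a = (block_bidiag k X Y *\<^sub>v w) $ (i * nr + a)"
    using a by (simp add: vblock_def)
  also have "\<dots> = (\<Sum>j<k * nc. block_bidiag k X Y $$ (i * nr + a, j) * w $ j)"
    using ia X w block_bidiag_carrier[OF X, of k Y] by (auto simp: scalar_prod_def atLeast0LessThan)
  also have "\<dots> = (\<Sum>bj<k. \<Sum>j=bj * nc..<bj * nc + nc. block_bidiag k X Y $$ (i * nr + a, j) * w $ j)"
    by (rule sum.nat_group[symmetric])
  also have "\<dots> = (\<Sum>bj<k. g bj)"
  proof (rule sum.cong[OF refl])
    fix bj assume bj: "bj \<in> {..<k}"
    have "(\<Sum>j=bj * nc..<bj * nc + nc. block_bidiag k X Y $$ (i * nr + a, j) * w $ j)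
      = (\<Sum>b<nc. block_bidiag k X Y $$ (i * nr + a, bj * nc + b) * w $ (bj * nc + b))"
      using sum.shift_bounds_nat_ivl[of "\<lambda>j. block_bidiag k X Y $$ (i * nr + a, j) * w $ j" 0 "bj * nc" nc]
      by (simp add: atLeast0LessThan add.commute)
    also have "\<dots> = (\<Sum>b<nc. (if bj = i then X $$ (a, b) else if bj = i + 1 then Y $$ (a, b) else 0)
        * w $ (bj * nc + b))"
    proof (intro sum.cong refl)
      fix b assume b: "b \<in> {..<nc}"
      define q where "q = bj * nc + b"
      have "q < k * nc" using bj b unfolding q_def by (intro block_index_less) auto
      moreover have "q div nc = bj" "q mod nc = b" using b by (auto simp: q_def)
      ultimately have "block_bidiag k X Y $$ (i * nr + a, q) =
          (if bj = i then X $$ (a, b) else if bj = i + 1 then Y $$ (a, b) else 0)"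
        using ia a X Y by (simp add: block_bidiag_def Let_def)
      then show "block_bidiag k X Y $$ (i * nr + a, bj * nc + b) * w $ (bj * nc + b)
          = (if bj = i then X $$ (a, b) else if bj = i + 1 then Y $$ (a, b) else 0) * w $ (bj * nc + b)"
        by (simp add: q_def)
    qed
    also have "\<dots> = g bj"
      using a X Y by (auto simp: g_def scalar_prod_def vblock_def atLeast0LessThan)
    finally show "(\<Sum>j=bj * nc..<bj * nc + nc. block_bidiag k X Y $$ (i * nr + a, j) * w $ j) = g bj" .
  qed
  also have "\<dots> = ?rhs $ a"
  proof (cases "Suc i < k")
    case True
    have "(\<Sum>bj<k. g bj) = (\<Sum>bj\<in>{i, Suc i}. g bj)"
      using True by (intro sum.mono_neutral_right) (auto simp: g_def)
    then show ?thesis using True a X Y by (simp add: g_def)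
  next
    case False
    have "(\<Sum>bj<k. g bj) = (\<Sum>bj\<in>{i}. g bj)"
      using i False by (intro sum.mono_neutral_right) (auto simp: g_def)
    then show ?thesis using False a X Y by (simp add: g_def)
  qed
  finally show "vblock nr (block_bidiag k X Y *\<^sub>v w) i $ a = ?rhs $ a" .
qed

section \<open>Linear subspaces as plain sets of vectors\<close>

definition lin_closed :: "nat \<Rightarrow> 'a::field vec set \<Rightarrow> bool" where
  "lin_closed n M \<longleftrightarrow> M \<subseteq> carrier_vec n \<and> 0\<^sub>v n \<in> M \<and> (\<forall>v\<in>M. \<forall>w\<in>M. v + w \<in> M) \<and> (\<forall>c. \<forall>v\<in>M. c \<cdot>\<^sub>v v \<in> M)"

lemma lin_closedD:
  assumes "lin_closed n M"
  shows "v \<in> M \<Longrightarrow> v \<in> carrier_vec n" "0\<^sub>v n \<in> M" "v \<in> M \<Longrightarrow> w \<in> M \<Longrightarrow> v + w \<in> M" "v \<in> M \<Longrightarrow> c \<cdot>\<^sub>v v \<in> M"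
  using assms by (auto simp: lin_closed_def)

text \<open>The combination is written in coordinates because that is the form in which
  \<open>exists_nontrivial_relation\<close> delivers linear relations.\<close>

lemma lin_closed_sum:
  assumes M: "lin_closed n M" and "finite I" and "\<And>i. i \<in> I \<Longrightarrow> f i \<in> M"
  shows "vec n (\<lambda>j. \<Sum>i\<in>I. c i * f i $ j) \<in> M"
  using assms(2,3)
proof (induction I rule: finite_induct)
  case empty
  have "vec n (\<lambda>j. \<Sum>i\<in>{}. c i * f i $ j) = 0\<^sub>v n" by auto
  then show ?case using lin_closedD(2)[OF M] by metis
next
  case (insert i I)
  have "f i \<in> carrier_vec n" using insert lin_closedD(1)[OF M] by auto
  then have "vec n (\<lambda>j. \<Sum>i\<in>insert i I. c i * f i $ j) = c i \<cdot>\<^sub>v f i + vec n (\<lambda>j. \<Sum>i\<in>I. c i * f i $ j)"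
    using insert by (intro eq_vecI) auto
  then show ?case using insert lin_closedD(3,4)[OF M] by auto
qed

lemma lin_closed_mat_kernel:
  assumes "X \<in> carrier_mat nr nc" shows "lin_closed nc (mat_kernel X)"
  using assms mult_add_distrib_mat_vec[OF assms] mult_mat_vec[OF assms]
  by (auto simp: lin_closed_def mat_kernel[OF assms])

lemma lin_closed_mat_im:
  assumes X: "X \<in> carrier_mat nr nc" and M: "lin_closed nc M" shows "lin_closed nr (mat_im X M)"
  unfolding lin_closed_def
proof (intro conjI ballI allI)
  show "mat_im X M \<subseteq> carrier_vec nr" using X lin_closedD(1)[OF M] by (auto simp: mat_im_def)
  have "X *\<^sub>v 0\<^sub>v nc = 0\<^sub>v nr" using X by auto
  then show "0\<^sub>v nr \<in> mat_im X M" using lin_closedD(2)[OF M] unfolding mat_im_def by (metis imageI)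
  fix v c assume "v \<in> mat_im X M"
  then obtain a where a: "a \<in> M" "v = X *\<^sub>v a" by (auto simp: mat_im_def)
  note ac = lin_closedD(1)[OF M a(1)]
  show "c \<cdot>\<^sub>v v \<in> mat_im X M"
    using a mult_mat_vec[OF X ac] lin_closedD(4)[OF M a(1)] unfolding mat_im_def by (metis imageI)
  fix w assume "w \<in> mat_im X M"
  then obtain b where b: "b \<in> M" "w = X *\<^sub>v b" by (auto simp: mat_im_def)
  show "v + w \<in> mat_im X M"
    using a b mult_add_distrib_mat_vec[OF X ac lin_closedD(1)[OF M b(1)]] lin_closedD(3)[OF M a(1) b(1)]
    unfolding mat_im_def by (metis imageI)
qed

lemma lin_closed_carrier: "lin_closed n (carrier_vec n :: 'a::field vec set)"
  by (auto simp: lin_closed_def)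

lemma lin_closed_subspace_sum:
  assumes M: "lin_closed n M" and N: "lin_closed n N" shows "lin_closed n (subspace_sum M N)"
  unfolding lin_closed_def
proof (intro conjI ballI allI)
  have MN: "M \<subseteq> carrier_vec n" "N \<subseteq> carrier_vec n" using M N by (auto simp: lin_closed_def)
  show "subspace_sum M N \<subseteq> carrier_vec n" using MN unfolding subspace_sum_def by (blast intro: add_carrier_vec)
  have "0\<^sub>v n = 0\<^sub>v n + (0\<^sub>v n :: 'a vec)" by simp
  then show "0\<^sub>v n \<in> subspace_sum M N" using M N unfolding lin_closed_def subspace_sum_def by blast
  fix v c assume "v \<in> subspace_sum M N"
  then obtain a b where v: "v = a + b" "a \<in> M" "b \<in> N" by (auto simp: subspace_sum_def)
  then have ab: "a \<in> carrier_vec n" "b \<in> carrier_vec n" using MN by auto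
  then have "c \<cdot>\<^sub>v v = c \<cdot>\<^sub>v a + c \<cdot>\<^sub>v b" using v smult_add_distrib_vec by auto
  then show "c \<cdot>\<^sub>v v \<in> subspace_sum M N" using v M N unfolding lin_closed_def subspace_sum_def by blast
  fix w assume "w \<in> subspace_sum M N"
  then obtain a' b' where w: "w = a' + b'" "a' \<in> M" "b' \<in> N" by (auto simp: subspace_sum_def)
  then have ab': "a' \<in> carrier_vec n" "b' \<in> carrier_vec n" using MN by auto
  have "v + w = (a + a') + (b + b')" using v w ab ab' by (intro eq_vecI) auto
  then show "v + w \<in> subspace_sum M N" using v w M N unfolding lin_closed_def subspace_sum_def by blast
qed

lemma lin_closed_mat_preim:
  assumes X: "X \<in> carrier_mat nr nc" and M: "lin_closed nr M" shows "lin_closed nc (mat_preim X M)"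
proof -
  have "X *\<^sub>v 0\<^sub>v nc = 0\<^sub>v nr" using X by auto
  then show ?thesis
    using X lin_closedD(2-)[OF M] mult_add_distrib_mat_vec[OF X] mult_mat_vec[OF X]
    by (auto simp: lin_closed_def mat_preim_def)
qed

lemma lin_closed_Int: "lin_closed n M \<Longrightarrow> lin_closed n N \<Longrightarrow> lin_closed n (M \<inter> N)"
  by (auto simp: lin_closed_def)

lemma lin_closed_mat_range:
  assumes X: "X \<in> carrier_mat nr nc" shows "lin_closed nr (mat_range X)"
  using X lin_closed_mat_im[OF X lin_closed_carrier] by (simp add: mat_range_def)

lemma lin_closed_wong_step:
  assumes "X \<in> carrier_mat m n" "Y \<in> carrier_mat m n" "B \<in> carrier_mat m l" "C \<in> carrier_mat p n"
    and "lin_closed n M"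
  shows "lin_closed n (mat_preim X (subspace_sum (mat_im Y M) (mat_range B)) \<inter> mat_kernel C)"
  by (intro lin_closed_Int lin_closed_mat_preim[OF assms(1)] lin_closed_subspace_sum
      lin_closed_mat_im[OF assms(2)] lin_closed_mat_range[OF assms(3)] lin_closed_mat_kernel[OF assms(4)] assms(5))

lemma lin_closed_wong_V:
  assumes "E \<in> carrier_mat m n" "A \<in> carrier_mat m n" "B \<in> carrier_mat m l" "C \<in> carrier_mat p n"
  shows "lin_closed n (wong_V E A B C i)"
proof (induction i)
  case 0
  show ?case using lin_closed_mat_kernel[OF assms(4)] by simp
next
  case (Suc i)
  then show ?case using lin_closed_wong_step[OF assms(2,1,3,4)] by simp
qed

lemma lin_closed_wong_W:
  assumes "E \<in> carrier_mat m n" "A \<in> carrier_mat m n" "B \<in> carrier_mat m l" "C \<in> carrier_mat p n"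
  shows "lin_closed n (wong_W E A B C i)"
proof (induction i)
  case 0
  have "lin_closed n {0\<^sub>v n :: real vec}" by (auto simp: lin_closed_def)
  then show ?case using assms by simp
next
  case (Suc i)
  then show ?case using lin_closed_wong_step[OF assms] by simp
qed

section \<open>Wong sequences and chains\<close>

lemma mat_range_zero:
  "mat_range (0\<^sub>m m l :: 'a::semiring_0 mat) = {0\<^sub>v m}"
proof -
  have "0\<^sub>m m l *\<^sub>v v = (0\<^sub>v m :: 'a vec)" if "v \<in> carrier_vec l" for v
    using that by (intro eq_vecI) (auto simp: scalar_prod_def)
  moreover have "(0\<^sub>v l :: 'a vec) \<in> carrier_vec l" by simp
  ultimately have "(\<lambda>v. 0\<^sub>m m l *\<^sub>v v) ` carrier_vec l = {0\<^sub>v m :: 'a vec}"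
    by (metis (no_types, lifting) image_cong image_constant)
  then show ?thesis by (simp add: mat_range_def mat_im_def)
qed

lemma subspace_sum_zero:
  assumes "M \<subseteq> carrier_vec m"
  shows "subspace_sum M {0\<^sub>v m :: 'a::monoid_add vec} = M"
proof -
  have "v + 0\<^sub>v m = v" if "v \<in> M" for v using that assms by auto
  then show ?thesis unfolding subspace_sum_def by force
qed

lemma mat_kernel_zero: "mat_kernel (0\<^sub>m p n :: 'a::comm_ring_1 mat) = carrier_vec n"
proof -
  have "0\<^sub>m p n *\<^sub>v v = (0\<^sub>v p :: 'a vec)" if "v \<in> carrier_vec n" for v
    using that by (intro eq_vecI) (auto simp: scalar_prod_def)
  then show ?thesis by (auto simp: mat_kernel[of _ p n])
qed

lemma lin_closed_wong_W0:
  assumes "E \<in> carrier_mat m n" "A \<in> carrier_mat m n" "C \<in> carrier_mat p n"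
  shows "lin_closed n (wong_W E A (0\<^sub>m m l) C i)"
  using assms by (intro lin_closed_wong_W) auto

text \<open>A zero input matrix adds nothing to the image of \<open>A\<close>, so a step of the
  recursion is the single equation \<open>E x = A w\<close>. The width \<open>l\<close> of the zero
  matrix stays arbitrary because different widths occur later.\<close>

lemma wong_W_Suc_iff:
  assumes E: "E \<in> carrier_mat m n" and A: "A \<in> carrier_mat m n" and C: "C \<in> carrier_mat p n"
  shows "x \<in> wong_W E A (0\<^sub>m m l) C (Suc k) \<longleftrightarrow>
    x \<in> carrier_vec n \<and> C *\<^sub>v x = 0\<^sub>v p \<and> (\<exists>w \<in> wong_W E A (0\<^sub>m m l) C k. E *\<^sub>v x = A *\<^sub>v w)"
proof -
  have "mat_im A (wong_W E A (0\<^sub>m m l) C k) \<subseteq> carrier_vec m"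
    using lin_closedD(1)[OF lin_closed_mat_im[OF A lin_closed_wong_W0[OF E A C]]] by blast
  then show ?thesis using E C
    by (auto simp: mat_range_zero subspace_sum_zero mat_preim_def mat_kernel[OF C] mat_im_def)
qed

declare wong_W.simps(2) [simp del]

text \<open>The factor \<open>c\<close> covers two readings of one object: \<open>c = 1\<close> is
  the recursion of the Wong sequence, \<open>c = -1\<close> the block row equation
  \<open>E v_i + A v_(i+1) = 0\<close>. The vector of interest is \<open>v 0\<close>; the chain runs
  from it down to zero.\<close>

definition wong_chain :: "real mat \<Rightarrow> real mat \<Rightarrow> real mat \<Rightarrow> real \<Rightarrow> nat \<Rightarrow> (nat \<Rightarrow> real vec) \<Rightarrow> bool" where
  "wong_chain E A C c k v \<longleftrightarrow> (\<forall>i\<le>k. v i \<in> carrier_vec (dim_col E)) \<and> v k = 0\<^sub>v (dim_col E) \<and>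
     (\<forall>i<k. C *\<^sub>v v i = 0\<^sub>v (dim_row C) \<and> E *\<^sub>v v i = c \<cdot>\<^sub>v (A *\<^sub>v v (Suc i)))"

lemma wong_chain_cong:
  assumes "\<And>i. i \<le> k \<Longrightarrow> v i = w i"
  shows "wong_chain E A C c k v \<longleftrightarrow> wong_chain E A C c k w"
  using assms by (auto simp: wong_chain_def Suc_leI less_imp_le)

text \<open>Each link may be rescaled because every \<open>W^k\<close> is a subspace, so all nonzero
  \<open>c\<close> give the same starting vectors.\<close>

lemma wong_W_iff_chain:
  assumes E: "E \<in> carrier_mat m n" and A: "A \<in> carrier_mat m n" and C: "C \<in> carrier_mat p n"
    and c: "c \<noteq> 0"
  shows "x \<in> wong_W E A (0\<^sub>m m l) C k \<longleftrightarrow> (\<exists>v. wong_chain E A C c k v \<and> v 0 = x)"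
proof (induction k arbitrary: x)
  case 0
  have "wong_chain E A C c 0 (\<lambda>i. 0\<^sub>v n)" using E by (auto simp: wong_chain_def)
  then have "\<exists>v. wong_chain E A C c 0 v \<and> v 0 = 0\<^sub>v n" by (intro exI[of _ "\<lambda>i. 0\<^sub>v n"]) simp
  then show ?case using E by (auto simp: wong_chain_def)
next
  case (Suc k)
  let ?W = "wong_W E A (0\<^sub>m m l) C"
  have lc: "lin_closed n (?W k)" by (rule lin_closed_wong_W0[OF E A C])
  show ?case
  proof
    assume "x \<in> ?W (Suc k)"
    then obtain w where x: "x \<in> carrier_vec n" "C *\<^sub>v x = 0\<^sub>v p" and w: "w \<in> ?W k" "E *\<^sub>v x = A *\<^sub>v w"
      unfolding wong_W_Suc_iff[OF E A C] by blast
    have wc: "w \<in> carrier_vec n" using lin_closedD(1)[OF lc w(1)] .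
    \<comment> \<open>The induction hypothesis is applied to \<open>w / c\<close>, so that the
      factor \<open>c\<close> in the first link restores \<open>w\<close>.\<close>
    have "(1 / c) \<cdot>\<^sub>v w \<in> ?W k" using lin_closedD(4)[OF lc w(1)] .
    then obtain v where v: "wong_chain E A C c k v" "v 0 = (1 / c) \<cdot>\<^sub>v w" using Suc.IH by blast
    have "E *\<^sub>v x = c \<cdot>\<^sub>v (A *\<^sub>v v 0)"
      using c wc A w(2) mult_mat_vec[OF A wc, of "1 / c"] by (simp add: v(2) smult_smult_assoc)
    then have "wong_chain E A C c (Suc k) (case_nat x v)"
      using v x E C by (auto simp: wong_chain_def split: nat.splits)
    then show "\<exists>v. wong_chain E A C c (Suc k) v \<and> v 0 = x" by (intro exI[of _ "case_nat x v"]) simp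
  next
    assume "\<exists>v. wong_chain E A C c (Suc k) v \<and> v 0 = x"
    then obtain v where v: "wong_chain E A C c (Suc k) v" "v 0 = x" by blast
    have v1: "v 1 \<in> carrier_vec n" using v E by (auto simp: wong_chain_def)
    have "wong_chain E A C c k (\<lambda>i. v (Suc i))" using v by (auto simp: wong_chain_def)
    then have "v 1 \<in> ?W k" using Suc.IH by auto
    then have "c \<cdot>\<^sub>v v 1 \<in> ?W k" using lin_closedD(4)[OF lc] by blast
    moreover have "E *\<^sub>v x = A *\<^sub>v (c \<cdot>\<^sub>v v 1)"
      using v mult_mat_vec[OF A v1, of c] by (auto simp: wong_chain_def)
    moreover have "x \<in> carrier_vec n" "C *\<^sub>v x = 0\<^sub>v p"
      using v E C by (auto simp: wong_chain_def)
    ultimately show "x \<in> ?W (Suc k)" unfolding wong_W_Suc_iff[OF E A C] by blast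
  qed
qed

lemma wong_W_mono:
  assumes E: "E \<in> carrier_mat m n" and A: "A \<in> carrier_mat m n" and C: "C \<in> carrier_mat p n"
    and "j \<le> k"
  shows "wong_W E A (0\<^sub>m m l) C j \<subseteq> wong_W E A (0\<^sub>m m l) C k"
proof -
  have "wong_W E A (0\<^sub>m m l) C i \<subseteq> wong_W E A (0\<^sub>m m l) C (Suc i)" for i
  proof (induction i)
    case 0
    have "0\<^sub>v n \<in> wong_W E A (0\<^sub>m m l) C (Suc 0)"
      using lin_closedD(2)[OF lin_closed_wong_W0[OF E A C]] by blast
    then show ?case using E by simp
  next
    case (Suc i)
    show ?case
    proof
      fix x assume "x \<in> wong_W E A (0\<^sub>m m l) C (Suc i)"
      then show "x \<in> wong_W E A (0\<^sub>m m l) C (Suc (Suc i))"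
        unfolding wong_W_Suc_iff[OF E A C] using Suc by blast
    qed
  qed
  then show ?thesis using \<open>j \<le> k\<close> lift_Suc_mono_le[of "wong_W E A (0\<^sub>m m l) C" j k] by blast
qed

text \<open>In a chain of length \<open>n + 1\<close> the vectors are linearly dependent; the first one that occurs in
  a relation can be replaced by a combination of later ones, which shortens the chain.\<close>

lemma wong_W_stabilizes:
  assumes E: "E \<in> carrier_mat m n" and A: "A \<in> carrier_mat m n" and C: "C \<in> carrier_mat p n"
  shows "wong_W E A (0\<^sub>m m l) C (Suc n) \<subseteq> wong_W E A (0\<^sub>m m l) C n"
proof
  let ?W = "wong_W E A (0\<^sub>m m l) C"
  have lc: "lin_closed n (?W k)" for k by (rule lin_closed_wong_W0[OF E A C])
  fix x assume "x \<in> ?W (Suc n)"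
  then obtain v where v: "wong_chain E A C 1 (Suc n) v" "v 0 = x"
    using wong_W_iff_chain[OF E A C, of 1] by auto
  \<comment> \<open>The tail of the chain from index i on has n + 1 - i links.\<close>
  have vW: "v i \<in> ?W (Suc n - i)" if "i \<le> Suc n" for i
  proof -
    have "wong_chain E A C 1 (Suc n - i) (\<lambda>j. v (i + j))"
      using v that by (auto simp: wong_chain_def)
    then show ?thesis using wong_W_iff_chain[OF E A C, of 1] by auto
  qed
  obtain c where c: "\<exists>i\<le>n. c i \<noteq> 0" "\<And>j. j < n \<Longrightarrow> (\<Sum>i\<le>n. c i * v i $ j) = 0"
    using exists_nontrivial_relation[of n v] by blast
  define i0 where "i0 = (LEAST i. c i \<noteq> 0)"
  have i0: "c i0 \<noteq> 0" "i0 \<le> n" using c(1) unfolding i0_def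
    by (metis (mono_tags, lifting) LeastI, metis (mono_tags, lifting) Least_le order_trans)
  have less: "c i = 0" if "i < i0" for i using that not_less_Least unfolding i0_def by blast
  have carr: "v i \<in> carrier_vec n" if "i \<le> n" for i using v that E by (auto simp: wong_chain_def)
  have "v i0 = vec n (\<lambda>j. \<Sum>i\<in>{i0<..n}. (- c i / c i0) * v i $ j)"
  proof (rule eq_vecI)
    fix j assume "j < dim_vec (vec n (\<lambda>j. \<Sum>i\<in>{i0<..n}. (- c i / c i0) * v i $ j))"
    then have j: "j < n" by simp
    have "0 = (\<Sum>i\<in>insert i0 {i0<..n}. c i * v i $ j)"
    proof -
      have "c i = 0" if "i \<le> n" "i \<noteq> i0" "\<not> i0 < i" for i using that less[of i] by linarith
      then have "(\<Sum>i\<in>insert i0 {i0<..n}. c i * v i $ j) = (\<Sum>i\<le>n. c i * v i $ j)"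
        using i0(2) by (intro sum.mono_neutral_left) auto
      then show ?thesis using c(2)[OF j] by simp
    qed
    then have "c i0 * v i0 $ j = - (\<Sum>i\<in>{i0<..n}. c i * v i $ j)" by simp
    then have "v i0 $ j = - (\<Sum>i\<in>{i0<..n}. c i * v i $ j) / c i0" using i0(1) by (simp add: field_simps)
    also have "\<dots> = (\<Sum>i\<in>{i0<..n}. (- c i / c i0) * v i $ j)"
      by (simp add: sum_divide_distrib sum_negf)
    finally show "v i0 $ j = vec n (\<lambda>j. \<Sum>i\<in>{i0<..n}. (- c i / c i0) * v i $ j) $ j" using j by simp
  qed (use carr i0 in auto)
  \<comment> \<open>A later \<open>v i\<close> lies in \<open>W^(n+1-i)\<close> and hence in
    \<open>W^(n-i0)\<close>. This gains one index over the chain itself, which gives only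
    \<open>W^(n+1-i0)\<close> for \<open>v i0\<close>.\<close>
  also have "\<dots> \<in> ?W (n - i0)"
  proof (rule lin_closed_sum[OF lc])
    fix i assume "i \<in> {i0<..n}"
    then show "v i \<in> ?W (n - i0)"
      using vW[of i] wong_W_mono[OF E A C, of "Suc n - i" "n - i0" l] by fastforce
  qed simp
  finally have base: "v i0 \<in> ?W (n - i0)" .
  \<comment> \<open>Walking back along the links from \<open>i0\<close> to 0 raises the index by one
    each time and ends with \<open>x\<close> in \<open>W^n\<close>.\<close>
  have "v (i0 - d) \<in> ?W (n - i0 + d)" if "d \<le> i0" for d
    using that
  proof (induction d)
    case 0
    then show ?case using base by simp
  next
    case (Suc d)
    let ?i = "i0 - Suc d"
    have "E *\<^sub>v v ?i = A *\<^sub>v v (Suc ?i)" "C *\<^sub>v v ?i = 0\<^sub>v p"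
      using v C i0 by (auto simp: wong_chain_def)
    moreover have "Suc ?i = i0 - d" using Suc.prems by simp
    ultimately show ?case using Suc carr[of ?i] i0(2) by (auto simp: wong_W_Suc_iff[OF E A C] simp del: wong_W.simps)
  qed
  from this[of i0] show "x \<in> ?W n" using i0(2) v(2) by simp
qed

text \<open>One stable step freezes the recursion, since each member is computed from its
  predecessor alone.\<close>

lemma wong_W_lim_eq:
  assumes E: "E \<in> carrier_mat m n" and A: "A \<in> carrier_mat m n" and C: "C \<in> carrier_mat p n"
  shows "wong_W_lim E A (0\<^sub>m m l) C = wong_W E A (0\<^sub>m m l) C n"
proof -
  have "wong_W E A (0\<^sub>m m l) C (n + d) \<subseteq> wong_W E A (0\<^sub>m m l) C n" for d
  proof (induction d)
    case (Suc d)
    show ?case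
    proof
      fix x assume "x \<in> wong_W E A (0\<^sub>m m l) C (n + Suc d)"
      then have "x \<in> wong_W E A (0\<^sub>m m l) C (Suc n)"
        using Suc unfolding add_Suc_right wong_W_Suc_iff[OF E A C] by blast
      then show "x \<in> wong_W E A (0\<^sub>m m l) C n" using wong_W_stabilizes[OF E A C] by blast
    qed
  qed simp
  moreover have "wong_W E A (0\<^sub>m m l) C i \<subseteq> wong_W E A (0\<^sub>m m l) C (n + i)" for i
    by (rule wong_W_mono[OF E A C]) simp
  ultimately show ?thesis unfolding wong_W_lim_def by blast
qed

lemma wong_V_Suc_iff:
  assumes E: "E \<in> carrier_mat m n" and A: "A \<in> carrier_mat m n" and B: "B \<in> carrier_mat m l"
  shows "x \<in> wong_V E A B (0\<^sub>m p n) (Suc k) \<longleftrightarrow>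
    x \<in> carrier_vec n \<and> (\<exists>v \<in> wong_V E A B (0\<^sub>m p n) k. \<exists>u \<in> carrier_vec l. A *\<^sub>v x = E *\<^sub>v v + B *\<^sub>v u)"
  using A B by (auto simp: mat_kernel_zero mat_preim_def subspace_sum_def mat_im_def mat_range_def)

lemma lin_closed_wong_V0:
  assumes "E \<in> carrier_mat m n" "A \<in> carrier_mat m n" "B \<in> carrier_mat m l"
  shows "lin_closed n (wong_V E A B (0\<^sub>m p n) i)"
  using assms by (intro lin_closed_wong_V) auto

lemma wong_V_0: "wong_V E A B (0\<^sub>m p n) 0 = carrier_vec n"
  by (simp add: mat_kernel_zero)

declare wong_V.simps [simp del]

text \<open>The equation is a homogeneous block row of the bidiagonal matrix. In contrast to
  \<open>wong_chain\<close>, the vector of interest is the last one, \<open>x k\<close>, and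
  \<open>x 0\<close> is free because \<open>V^0\<close> is the whole space.\<close>

definition control_chain :: "real mat \<Rightarrow> real mat \<Rightarrow> real mat \<Rightarrow> nat \<Rightarrow> (nat \<Rightarrow> real vec) \<Rightarrow> (nat \<Rightarrow> real vec) \<Rightarrow> bool" where
  "control_chain E A B k x u \<longleftrightarrow> (\<forall>i\<le>k. x i \<in> carrier_vec (dim_col E)) \<and> (\<forall>i<k. u i \<in> carrier_vec (dim_col B) \<and>
     E *\<^sub>v x i + (A *\<^sub>v x (Suc i) + B *\<^sub>v u i) = 0\<^sub>v (dim_row E))"

text \<open>The recursion says \<open>A x = E v + B u\<close>, while the chain collects all terms on
  one side. Passing to \<open>- v\<close> and \<open>- u\<close> turns one into the other, and
  \<open>V^k\<close> is closed under negation.\<close>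

lemma wong_V_iff_chain:
  assumes E: "E \<in> carrier_mat m n" and A: "A \<in> carrier_mat m n" and B: "B \<in> carrier_mat m l"
  shows "x \<in> wong_V E A B (0\<^sub>m p n) k \<longleftrightarrow> (\<exists>xs us. control_chain E A B k xs us \<and> xs k = x)"
proof (induction k arbitrary: x)
  case 0
  then show ?case using E by (auto simp: wong_V_0 control_chain_def)
next
  case (Suc k)
  let ?V = "wong_V E A B (0\<^sub>m p n)"
  have lc: "lin_closed n (?V k)" by (rule lin_closed_wong_V0[OF E A B])
  have step: "E *\<^sub>v (- v) + (A *\<^sub>v x + B *\<^sub>v (- u)) = 0\<^sub>v m \<longleftrightarrow> A *\<^sub>v x = E *\<^sub>v v + B *\<^sub>v u"
    if c: "v \<in> carrier_vec n" "u \<in> carrier_vec l" "x \<in> carrier_vec n" for v u x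
  proof -
    have "E *\<^sub>v (- v) = - (E *\<^sub>v v)" "B *\<^sub>v (- u) = - (B *\<^sub>v u)"
      using c E B by (intro eq_vecI; simp)+
    then show ?thesis using c E A B
      by (auto simp: vec_eq_iff algebra_simps)
  qed
  have neg: "- v \<in> ?V k" if "v \<in> ?V k" for v
  proof -
    have "- v = (-1) \<cdot>\<^sub>v v" by auto
    then show ?thesis using lin_closedD(4)[OF lc that] by metis
  qed
  show ?case
  proof
    assume "x \<in> ?V (Suc k)"
    then obtain v u where x: "x \<in> carrier_vec n" and v: "v \<in> ?V k" and u: "u \<in> carrier_vec l"
      and eq: "A *\<^sub>v x = E *\<^sub>v v + B *\<^sub>v u"
      unfolding wong_V_Suc_iff[OF E A B] by blast
    have vc: "v \<in> carrier_vec n" using lin_closedD(1)[OF lc v] .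
    obtain xs us where ch: "control_chain E A B k xs us" "xs k = - v"
      using Suc.IH[of "- v"] neg[OF v] by blast
    have "control_chain E A B (Suc k) (xs(Suc k := x)) (us(k := - u))"
      using ch x u E B iffD2[OF step[OF vc u x] eq] by (auto simp: control_chain_def less_Suc_eq le_Suc_eq)
    then show "\<exists>xs us. control_chain E A B (Suc k) xs us \<and> xs (Suc k) = x" by (metis fun_upd_same)
  next
    assume "\<exists>xs us. control_chain E A B (Suc k) xs us \<and> xs (Suc k) = x"
    then obtain xs us where ch: "control_chain E A B (Suc k) xs us" "xs (Suc k) = x" by blast
    then have c: "xs k \<in> carrier_vec n" "us k \<in> carrier_vec l" "x \<in> carrier_vec n"
      using E B by (auto simp: control_chain_def)
    have "control_chain E A B k xs us" using ch by (auto simp: control_chain_def)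
    then have "- xs k \<in> ?V k" using Suc.IH neg by blast
    moreover have "A *\<^sub>v x = E *\<^sub>v (- xs k) + B *\<^sub>v (- us k)"
      using ch E step[of "- xs k" "- us k" x] c by (auto simp: control_chain_def)
    ultimately show "x \<in> ?V (Suc k)"
      unfolding wong_V_Suc_iff[OF E A B] using c by (metis uminus_carrier_vec)
  qed
qed

section \<open>The bidiagonal block matrices read as chains\<close>

lemma append_cols_zero_mult_vec:
  fixes X :: "'a::semiring_0 mat"
  assumes X: "X \<in> carrier_mat nr n1" and v: "v \<in> carrier_vec (n1 + k)"
  shows "(X @\<^sub>c 0\<^sub>m nr k) *\<^sub>v v = X *\<^sub>v vblock n1 v 0"
proof -
  have first: "vec_first v n1 = vblock n1 v 0" by (simp add: vec_first_def vblock_def)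
  have "0\<^sub>m nr k *\<^sub>v vec_last v k = (0\<^sub>v nr :: 'a vec)"
    by (intro eq_vecI) (auto simp: scalar_prod_def)
  then have "(X @\<^sub>c 0\<^sub>m nr k) *\<^sub>v (vec_first v n1 @\<^sub>v vec_last v k) = X *\<^sub>v vblock n1 v 0"
    using X by (subst append_cols_mult_vec[of _ _ n1 _ k]) (auto simp: first)
  then show ?thesis using vec_first_last_append[OF v] by simp
qed

lemma vblock_last_append_rows:
  fixes A :: "'a::semiring_0 mat"
  assumes A: "A \<in> carrier_mat m n" and v: "v \<in> carrier_vec n" and i: "i < N"
  shows "vblock m ((0\<^sub>m ((N - 1) * m) n @\<^sub>r A) *\<^sub>v v) i = (if Suc i = N then A *\<^sub>v v else 0\<^sub>v m)"
proof -
  have zero: "0\<^sub>m ((N - 1) * m) n *\<^sub>v v = (0\<^sub>v ((N - 1) * m) :: 'a vec)"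
    using v by (intro eq_vecI) (auto simp: scalar_prod_def)
  have "(0\<^sub>m ((N - 1) * m) n @\<^sub>r A) *\<^sub>v v = 0\<^sub>v ((N - 1) * m) @\<^sub>v A *\<^sub>v v"
    using mat_mult_append[OF _ A v, of "0\<^sub>m ((N - 1) * m) n" "(N - 1) * m"] zero by simp
  moreover have "N - Suc 0 = i" if "Suc i = N" using that by simp
  moreover have "vblock m (0\<^sub>v ((N - 1) * m) @\<^sub>v A *\<^sub>v v) i = 0\<^sub>v m" if "Suc i \<noteq> N"
  proof (rule eq_vecI)
    fix j assume "j < dim_vec (0\<^sub>v m :: 'a vec)"
    then have j: "j < m" by simp
    define K where "K = (N - 1) * m"
    have "i < N - 1" using that i by simp
    then have "i * m + j < K" using block_index_less[of i "N - 1" j m] j unfolding K_def by blast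
    then have "(0\<^sub>v K @\<^sub>v A *\<^sub>v v) $ (i * m + j) = 0" by simp
    then show "vblock m (0\<^sub>v ((N - 1) * m) @\<^sub>v A *\<^sub>v v) i $ j = 0\<^sub>v m $ j"
      using j by (simp only: vblock_def index_vec K_def index_zero_vec)
  qed (simp add: vblock_def)
  moreover have "vblock m (0\<^sub>v (i * m) @\<^sub>v A *\<^sub>v v) i = A *\<^sub>v v"
    using A by (intro eq_vecI) (auto simp: vblock_def append_vec_def Let_def)
  ultimately show ?thesis by auto
qed

text \<open>Read \<open>A1 v = F w\<close> by block rows. The first n - 1 rows have zero on the left
  and make the blocks of \<open>w\<close> a control chain; the last row says
  \<open>A v = E x_(n-1)\<close>, where \<open>x_(n-1)\<close> is the end of that chain and
  therefore an arbitrary element of \<open>V^(n-1)\<close>.\<close>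

lemma preim_range_block_bidiag:
  fixes E A B :: "real mat"
  assumes n: "n \<ge> 1" and E: "E \<in> carrier_mat m n" and A: "A \<in> carrier_mat m n" and B: "B \<in> carrier_mat m l"
  shows "mat_preim (0\<^sub>m ((n - 1) * m) n @\<^sub>r A) (mat_range (block_bidiag n (E @\<^sub>c 0\<^sub>m m l) (A @\<^sub>c B)))
    = mat_preim A (mat_im E (wong_V E A B (0\<^sub>m p n) (n - 1)))"
proof -
  let ?A1 = "0\<^sub>m ((n - 1) * m) n @\<^sub>r A" and ?X = "E @\<^sub>c 0\<^sub>m m l" and ?Y = "A @\<^sub>c B"
  let ?F = "block_bidiag n ?X ?Y"
  have "(n - 1) * m + m = n * m" using n by (cases n) auto
  then have A1: "?A1 \<in> carrier_mat (n * m) n"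
    using carrier_append_rows[OF _ A, of "0\<^sub>m ((n - 1) * m) n" "(n - 1) * m"] by simp
  have X: "?X \<in> carrier_mat m (n + l)" and Y: "?Y \<in> carrier_mat m (n + l)" using E A B by auto
  have F: "?F \<in> carrier_mat (n * m) (n * (n + l))" by (rule block_bidiag_carrier[OF X])
  have Xm: "?X *\<^sub>v (a @\<^sub>v b) = E *\<^sub>v a" and Ym: "?Y *\<^sub>v (a @\<^sub>v b) = A *\<^sub>v a + B *\<^sub>v b"
    if "a \<in> carrier_vec n" "b \<in> carrier_vec l" for a b
    using append_cols_zero_mult_vec[OF E, of "a @\<^sub>v b" l] that append_cols_mult_vec[OF A B that]
    by (auto simp: vblock_append_0)
  have key: "?A1 *\<^sub>v v \<in> mat_range ?F \<longleftrightarrow> A *\<^sub>v v \<in> mat_im E (wong_V E A B (0\<^sub>m p n) (n - 1))"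
    if v: "v \<in> carrier_vec n" for v
  proof
    assume "?A1 *\<^sub>v v \<in> mat_range ?F"
    then obtain w where w: "w \<in> carrier_vec (n * (n + l))" "?A1 *\<^sub>v v = ?F *\<^sub>v w"
      using F by (auto simp: mat_range_def mat_im_def)
    define xs where "xs = (\<lambda>i. vec_first (vblock (n + l) w i) n)"
    define us where "us = (\<lambda>i. vec_last (vblock (n + l) w i) l)"
    have split: "vblock (n + l) w i = xs i @\<^sub>v us i" for i
      unfolding xs_def us_def by (simp add: vec_first_last_append)
    have xu: "xs i \<in> carrier_vec n" "us i \<in> carrier_vec l" for i by (auto simp: xs_def us_def)
    have rows: "(if Suc i = n then A *\<^sub>v v else 0\<^sub>v m) =
        (if Suc i < n then E *\<^sub>v xs i + (A *\<^sub>v xs (Suc i) + B *\<^sub>v us (Suc i)) else E *\<^sub>v xs i)"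
      if i: "i < n" for i
      using arg_cong[OF w(2), of "\<lambda>z. vblock m z i"]
      unfolding vblock_last_append_rows[OF A v i] vblock_block_bidiag_mult[OF X Y w(1) i] split
      unfolding Xm[OF xu] Ym[OF xu] .
    have dims: "dim_col E = n" "dim_row E = m" "dim_col B = l" using E B by auto
    \<comment> \<open>The inputs are shifted by one: block row i couples \<open>xs i\<close> with
      \<open>us (i + 1)\<close>, and \<open>us 0\<close> meets only the zero columns of
      \<open>?X\<close>.\<close>
    have "control_chain E A B (n - 1) xs (\<lambda>i. us (Suc i))"
      unfolding control_chain_def dims
    proof (intro conjI allI impI)
      fix i assume i: "i < n - 1"
      then have "i < n" and eqs: "(Suc i < n) = True" "(Suc i = n) = False" by auto
      from rows[OF this(1)] show "E *\<^sub>v xs i + (A *\<^sub>v xs (Suc i) + B *\<^sub>v us (Suc i)) = 0\<^sub>v m"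
        by (simp only: eqs if_True if_False)
      show "us (Suc i) \<in> carrier_vec l" by (rule xu)
    next
      fix i show "xs i \<in> carrier_vec n" by (rule xu)
    qed
    then have "xs (n - 1) \<in> wong_V E A B (0\<^sub>m p n) (n - 1)"
      using wong_V_iff_chain[OF E A B, of "xs (n - 1)" p "n - 1"] by blast
    moreover have "A *\<^sub>v v = E *\<^sub>v xs (n - 1)"
    proof -
      have n1: "n - 1 < n" "(Suc (n - 1) = n) = True" "(Suc (n - 1) < n) = False" using n by auto
      from rows[OF n1(1)] show ?thesis by (simp only: n1 if_True if_False)
    qed
    ultimately show "A *\<^sub>v v \<in> mat_im E (wong_V E A B (0\<^sub>m p n) (n - 1))" by (simp add: mat_im_def)
  next
    assume "A *\<^sub>v v \<in> mat_im E (wong_V E A B (0\<^sub>m p n) (n - 1))"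
    then obtain y where y: "y \<in> wong_V E A B (0\<^sub>m p n) (n - 1)" "A *\<^sub>v v = E *\<^sub>v y"
      unfolding mat_im_def by blast
    then obtain xs us where ch: "control_chain E A B (n - 1) xs us" and eq: "A *\<^sub>v v = E *\<^sub>v xs (n - 1)"
      using wong_V_iff_chain[OF E A B, of y p "n - 1"] by blast
    \<comment> \<open>The input of block 0 acts through zero columns only, so it may be chosen as
      zero.\<close>
    define us' where "us' = (\<lambda>i. if i = 0 then 0\<^sub>v l else us (i - 1))"
    have xu: "xs i \<in> carrier_vec n" "us' i \<in> carrier_vec l" if "i < n" for i
    proof -
      have "i \<le> n - 1" "i \<noteq> 0 \<Longrightarrow> i - 1 < n - 1" using that by auto
      then show "xs i \<in> carrier_vec n" "us' i \<in> carrier_vec l"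
        using ch E B unfolding control_chain_def us'_def by auto
    qed
    have ch_eq: "E *\<^sub>v xs i + (A *\<^sub>v xs (Suc i) + B *\<^sub>v us i) = 0\<^sub>v m" if "Suc i < n" for i
    proof -
      have "i < n - 1" using that by simp
      then show ?thesis using ch E unfolding control_chain_def by (metis carrier_matD(1))
    qed
    define w where "w = vconcat n (n + l) (\<lambda>i. xs i @\<^sub>v us' i)"
    have wc: "w \<in> carrier_vec (n * (n + l))" by (simp add: w_def)
    have split: "vblock (n + l) w i = xs i @\<^sub>v us' i" if "i < n" for i
      unfolding w_def using xu that by (intro vblock_vconcat) auto
    have "?A1 *\<^sub>v v = ?F *\<^sub>v w"
    proof (rule iffD2[OF vec_eq_iff_vblocks[of _ n m]])
      show "?A1 *\<^sub>v v \<in> carrier_vec (n * m)" using A1 v by simp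
      show "?F *\<^sub>v w \<in> carrier_vec (n * m)" using F wc by simp
      show "\<forall>i<n. vblock m (?A1 *\<^sub>v v) i = vblock m (?F *\<^sub>v w) i"
      proof (intro allI impI)
        fix i assume i: "i < n"
        show "vblock m (?A1 *\<^sub>v v) i = vblock m (?F *\<^sub>v w) i"
          unfolding vblock_last_append_rows[OF A v i] vblock_block_bidiag_mult[OF X Y wc i]
        proof (cases "Suc i < n")
          case True
          then have "E *\<^sub>v xs i + (A *\<^sub>v xs (Suc i) + B *\<^sub>v us' (Suc i)) = 0\<^sub>v m"
            using ch_eq[of i] by (simp add: us'_def)
          then show "(if Suc i = n then A *\<^sub>v v else 0\<^sub>v m) = (if Suc i < n then ?X *\<^sub>v vblock (n + l) w i
              + ?Y *\<^sub>v vblock (n + l) w (Suc i) else ?X *\<^sub>v vblock (n + l) w i)"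
            using True i by (simp add: split Xm[OF xu] Ym[OF xu])
        next
          case False
          then have "Suc i = n" "i = n - 1" using i by auto
          then show "(if Suc i = n then A *\<^sub>v v else 0\<^sub>v m) = (if Suc i < n then ?X *\<^sub>v vblock (n + l) w i
              + ?Y *\<^sub>v vblock (n + l) w (Suc i) else ?X *\<^sub>v vblock (n + l) w i)"
            using i eq by (simp add: split Xm[OF xu])
        qed
      qed
    qed
    then show "?A1 *\<^sub>v v \<in> mat_range ?F" using wc F by (auto simp: mat_range_def mat_im_def)
  qed
  show ?thesis using key A A1 unfolding mat_preim_def by auto
qed

text \<open>Block row i yields \<open>E v_i + A v_(i+1) = 0\<close> and
  \<open>C v_(i+1) = 0\<close>. The last row yields \<open>E v_(n-1) = 0\<close>, which is the same
  equation once \<open>v_n = 0\<close> is appended. The rows with \<open>C\<close> miss block 0, so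
  \<open>C v_0 = 0\<close> enters as a separate condition; in (i) and (ii) it is supplied by the
  block \<open>Ccal\<close>.\<close>

lemma kernel_block_bidiag_iff:
  fixes E A C :: "real mat"
  assumes n: "n \<ge> 1" and E: "E \<in> carrier_mat m n" and A: "A \<in> carrier_mat m n" and C: "C \<in> carrier_mat p n"
    and v: "v \<in> carrier_vec (n * n)"
  shows "v \<in> mat_kernel (block_bidiag n (E @\<^sub>r 0\<^sub>m p n) (A @\<^sub>r C)) \<and> C *\<^sub>v vblock n v 0 = 0\<^sub>v p \<longleftrightarrow>
    wong_chain E A C (-1) n (\<lambda>i. if i < n then vblock n v i else 0\<^sub>v n)"
proof -
  let ?X = "E @\<^sub>r 0\<^sub>m p n" and ?Y = "A @\<^sub>r C"
  let ?F = "block_bidiag n ?X ?Y"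
  have X: "?X \<in> carrier_mat (m + p) n" and Y: "?Y \<in> carrier_mat (m + p) n" using E A C by auto
  have F: "?F \<in> carrier_mat (n * (m + p)) (n * n)" by (rule block_bidiag_carrier[OF X])
  have Xm: "?X *\<^sub>v a = E *\<^sub>v a @\<^sub>v 0\<^sub>v p" and Ym: "?Y *\<^sub>v a = A *\<^sub>v a @\<^sub>v C *\<^sub>v a" if "a \<in> carrier_vec n" for a
  proof -
    have "0\<^sub>m p n *\<^sub>v a = (0\<^sub>v p :: real vec)"
      using that by (intro eq_vecI) (auto simp: scalar_prod_def)
    then show "?X *\<^sub>v a = E *\<^sub>v a @\<^sub>v 0\<^sub>v p" using mat_mult_append[OF E _ that, of "0\<^sub>m p n" p] by simp
    show "?Y *\<^sub>v a = A *\<^sub>v a @\<^sub>v C *\<^sub>v a" by (rule mat_mult_append[OF A C that])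
  qed
  let ?x = "vblock n v"
  have block: "vblock (m + p) (?F *\<^sub>v v) i =
      (if Suc i < n then (E *\<^sub>v ?x i + A *\<^sub>v ?x (Suc i)) @\<^sub>v C *\<^sub>v ?x (Suc i) else E *\<^sub>v ?x i @\<^sub>v 0\<^sub>v p)"
    if i: "i < n" for i
    unfolding vblock_block_bidiag_mult[OF X Y v i] using E A C
    by (auto simp: Xm Ym append_vec_add[of _ m _ _ p])
  have zero: "a @\<^sub>v b = 0\<^sub>v (m + p) \<longleftrightarrow> a = 0\<^sub>v m \<and> b = 0\<^sub>v p" if "a \<in> carrier_vec m" for a b :: "real vec"
  proof -
    have "0\<^sub>v (m + p) = 0\<^sub>v m @\<^sub>v (0\<^sub>v p :: real vec)" by auto
    then show ?thesis using append_vec_eq[OF that] by simp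
  qed
  have sgn: "a + b = 0\<^sub>v m \<longleftrightarrow> a = (-1) \<cdot>\<^sub>v b" if "a \<in> carrier_vec m" "b \<in> carrier_vec m" for a b :: "real vec"
    using that by (auto simp: vec_eq_iff add_eq_0_iff2)
  have zero_block: "vblock (m + p) (0\<^sub>v (n * (m + p)) :: real vec) i = 0\<^sub>v (m + p)" if "i < n" for i
    using that by (intro eq_vecI) (auto simp: vblock_def block_index_less)
  have "?F *\<^sub>v v = 0\<^sub>v (n * (m + p)) \<longleftrightarrow>
      (\<forall>i<n. vblock (m + p) (?F *\<^sub>v v) i = vblock (m + p) (0\<^sub>v (n * (m + p))) i)"
    by (rule vec_eq_iff_vblocks) (use F v in auto)
  also have "\<dots> \<longleftrightarrow> (\<forall>i<n. vblock (m + p) (?F *\<^sub>v v) i = 0\<^sub>v (m + p))" using zero_block by simp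
  also have "\<dots> \<longleftrightarrow> (\<forall>i<n. E *\<^sub>v ?x i = (-1) \<cdot>\<^sub>v (A *\<^sub>v (if Suc i < n then ?x (Suc i) else 0\<^sub>v n))
      \<and> (Suc i < n \<longrightarrow> C *\<^sub>v ?x (Suc i) = 0\<^sub>v p))"
  proof (intro all_cong)
    fix i assume i: "i < n"
    have "A *\<^sub>v 0\<^sub>v n = 0\<^sub>v m" using A by auto
    then show "vblock (m + p) (?F *\<^sub>v v) i = 0\<^sub>v (m + p) \<longleftrightarrow>
      E *\<^sub>v ?x i = (-1) \<cdot>\<^sub>v (A *\<^sub>v (if Suc i < n then ?x (Suc i) else 0\<^sub>v n))
      \<and> (Suc i < n \<longrightarrow> C *\<^sub>v ?x (Suc i) = 0\<^sub>v p)"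
      unfolding block[OF i] using E A by (auto simp: zero sgn)
  qed
  finally have eq: "v \<in> mat_kernel ?F \<longleftrightarrow> (\<forall>i<n. E *\<^sub>v ?x i = (-1) \<cdot>\<^sub>v (A *\<^sub>v (if Suc i < n then ?x (Suc i) else 0\<^sub>v n))
      \<and> (Suc i < n \<longrightarrow> C *\<^sub>v ?x (Suc i) = 0\<^sub>v p))" using v by (simp add: mat_kernel[OF F])
  have Cs: "C *\<^sub>v ?x 0 = 0\<^sub>v p \<and> (\<forall>i<n. Suc i < n \<longrightarrow> C *\<^sub>v ?x (Suc i) = 0\<^sub>v p) \<longleftrightarrow> (\<forall>i<n. C *\<^sub>v ?x i = 0\<^sub>v p)"
    (is "?L \<longleftrightarrow> ?R")
  proof
    assume ?L
    then have "C *\<^sub>v ?x i = 0\<^sub>v p" if "i < n" for i using that by (cases i) (blast intro: Suc_lessD)+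
    then show ?R by blast
  next
    assume ?R
    then show ?L using n by force
  qed
  show ?thesis unfolding eq wong_chain_def using E C Cs by auto
qed

section \<open>From the rank equality to the first block\<close>

lemma mat_kernel_append_cols:
  fixes X Y :: "'a::comm_ring_1 mat"
  assumes X: "X \<in> carrier_mat nr n1" and Y: "Y \<in> carrier_mat nr n2"
  shows "mat_kernel (X @\<^sub>c Y) =
    {v @\<^sub>v w | v w. v \<in> carrier_vec n1 \<and> w \<in> carrier_vec n2 \<and> X *\<^sub>v v + Y *\<^sub>v w = 0\<^sub>v nr}"
    (is "_ = ?R")
proof -
  have XY: "X @\<^sub>c Y \<in> carrier_mat nr (n1 + n2)" using X Y by simp
  show ?thesis
  proof
    show "?R \<subseteq> mat_kernel (X @\<^sub>c Y)"
      using append_cols_mult_vec[OF X Y] by (auto simp: mat_kernel[OF XY])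
    show "mat_kernel (X @\<^sub>c Y) \<subseteq> ?R"
    proof
      fix z assume "z \<in> mat_kernel (X @\<^sub>c Y)"
      then have z: "z \<in> carrier_vec (n1 + n2)" "(X @\<^sub>c Y) *\<^sub>v z = 0\<^sub>v nr" by (auto simp: mat_kernel[OF XY])
      have split: "z = vec_first z n1 @\<^sub>v vec_last z n2" using vec_first_last_append[OF z(1)] by simp
      have c: "vec_first z n1 \<in> carrier_vec n1" "vec_last z n2 \<in> carrier_vec n2" by auto
      have "X *\<^sub>v vec_first z n1 + Y *\<^sub>v vec_last z n2 = 0\<^sub>v nr"
        using append_cols_mult_vec[OF X Y c] split z(2) by simp
      then show "z \<in> ?R" using split c by blast
    qed
  qed
qed

lemma zero_mult_mat_vec [simp]:
  fixes v :: "'a::semiring_0 vec"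
  assumes "v \<in> carrier_vec n"
  shows "0\<^sub>m k n *\<^sub>v v = 0\<^sub>v k"
  using assms by (intro eq_vecI) (auto simp: scalar_prod_def)

text \<open>Appending rows keeps the rank exactly when it keeps the kernel. In a kernel vector with
  parts v and w, the part v occurs only in the first block row, so its existence says that
  \<open>X w\<close> is in the range of \<open>F\<close>; the other rows constrain w alone.\<close>

lemma rank_eq_iff_preim_subset:
  fixes F X Y Z K :: "'a::field mat"
  assumes F: "F \<in> carrier_mat a nf" and X: "X \<in> carrier_mat a nx" and Y: "Y \<in> carrier_mat b nx"
    and Z: "Z \<in> carrier_mat c nx" and K: "K \<in> carrier_mat r nx"
  shows "mrank ((F @\<^sub>c X) @\<^sub>r (0\<^sub>m b nf @\<^sub>c Y) @\<^sub>r (0\<^sub>m c nf @\<^sub>c Z) @\<^sub>r (0\<^sub>m r nf @\<^sub>c K))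
      = mrank ((F @\<^sub>c X) @\<^sub>r (0\<^sub>m b nf @\<^sub>c Y) @\<^sub>r (0\<^sub>m c nf @\<^sub>c Z))
    \<longleftrightarrow> mat_preim X (mat_range F) \<inter> mat_kernel Y \<inter> mat_kernel Z \<subseteq> mat_kernel K"
    (is "mrank ?L = mrank ?M \<longleftrightarrow> ?sub")
proof -
  let ?n = "nf + nx"
  have c1: "F @\<^sub>c X \<in> carrier_mat a ?n" and c2: "0\<^sub>m b nf @\<^sub>c Y \<in> carrier_mat b ?n"
    and c3: "0\<^sub>m c nf @\<^sub>c Z \<in> carrier_mat c ?n" and c4: "0\<^sub>m r nf @\<^sub>c K \<in> carrier_mat r ?n"
    using assms by auto
  have c34: "(0\<^sub>m c nf @\<^sub>c Z) @\<^sub>r (0\<^sub>m r nf @\<^sub>c K) \<in> carrier_mat (c + r) ?n" using c3 c4 by blast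
  have c234: "(0\<^sub>m b nf @\<^sub>c Y) @\<^sub>r (0\<^sub>m c nf @\<^sub>c Z) @\<^sub>r (0\<^sub>m r nf @\<^sub>c K) \<in> carrier_mat (b + (c + r)) ?n"
    using c2 c34 by blast
  have c23: "(0\<^sub>m b nf @\<^sub>c Y) @\<^sub>r (0\<^sub>m c nf @\<^sub>c Z) \<in> carrier_mat (b + c) ?n" using c2 c3 by blast
  have cL: "?L \<in> carrier_mat (a + (b + (c + r))) ?n" using c1 c234 by blast
  have cM: "?M \<in> carrier_mat (a + (b + c)) ?n" using c1 c23 by blast
  have kM: "mat_kernel ?M = mat_kernel (F @\<^sub>c X) \<inter> (mat_kernel (0\<^sub>m b nf @\<^sub>c Y) \<inter> mat_kernel (0\<^sub>m c nf @\<^sub>c Z))"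
    by (simp only: mat_kernel_append_rows[OF c1 c23] mat_kernel_append_rows[OF c2 c3])
  have kL: "mat_kernel ?L = mat_kernel ?M \<inter> mat_kernel (0\<^sub>m r nf @\<^sub>c K)"
    unfolding kM mat_kernel_append_rows[OF c1 c234] mat_kernel_append_rows[OF c2 c34]
      mat_kernel_append_rows[OF c3 c4] by blast
  have lower: "v @\<^sub>v w \<in> mat_kernel (0\<^sub>m k nf @\<^sub>c U) \<longleftrightarrow> w \<in> mat_kernel U"
    if "U \<in> carrier_mat k nx" "v \<in> carrier_vec nf" "w \<in> carrier_vec nx" for U :: "'a mat" and k v w
  proof -
    have "0\<^sub>m k nf @\<^sub>c U \<in> carrier_mat k ?n" using that by simp
    then show ?thesis
      using append_cols_mult_vec[of "0\<^sub>m k nf" k nf U nx v w] that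
      by (auto simp: mat_kernel[of _ k ?n] mat_kernel[OF that(1)])
  qed
  have upper: "v @\<^sub>v w \<in> mat_kernel (F @\<^sub>c X) \<longleftrightarrow> F *\<^sub>v v + X *\<^sub>v w = 0\<^sub>v a"
    if "v \<in> carrier_vec nf" "w \<in> carrier_vec nx" for v w
    using append_cols_mult_vec[OF F X that] that by (simp add: mat_kernel[OF c1])
  \<comment> \<open>The range is closed under negation, which absorbs the plus sign of the block
    row.\<close>
  have im: "X *\<^sub>v w \<in> mat_range F \<longleftrightarrow> (\<exists>v\<in>carrier_vec nf. F *\<^sub>v v + X *\<^sub>v w = 0\<^sub>v a)"
    if w: "w \<in> carrier_vec nx" for w
  proof -
    have *: "F *\<^sub>v v + X *\<^sub>v w = 0\<^sub>v a \<longleftrightarrow> X *\<^sub>v w = F *\<^sub>v (- v)" if v: "v \<in> carrier_vec nf" for v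
    proof -
      have "F *\<^sub>v (- v) = - (F *\<^sub>v v)" using F v by (intro eq_vecI; simp)
      then show ?thesis using F X v w by (auto simp: vec_eq_iff add_eq_0_iff)
    qed
    show ?thesis
    proof
      assume "X *\<^sub>v w \<in> mat_range F"
      then obtain v where v: "v \<in> carrier_vec nf" "X *\<^sub>v w = F *\<^sub>v v"
        using F by (auto simp: mat_range_def mat_im_def)
      then show "\<exists>v\<in>carrier_vec nf. F *\<^sub>v v + X *\<^sub>v w = 0\<^sub>v a" using *[of "- v"] by (intro bexI[of _ "- v"]) auto
    next
      assume "\<exists>v\<in>carrier_vec nf. F *\<^sub>v v + X *\<^sub>v w = 0\<^sub>v a"
      then obtain v where "v \<in> carrier_vec nf" "X *\<^sub>v w = F *\<^sub>v (- v)" using * by blast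
      then show "X *\<^sub>v w \<in> mat_range F"
        using F by (auto simp: mat_range_def mat_im_def intro!: image_eqI[of _ _ "- v"])
    qed
  qed
  have "mrank ?L = mrank ?M \<longleftrightarrow> mat_kernel ?M \<subseteq> mat_kernel ?L"
    by (rule rank_eq_iff_kernel_eq[OF cM cL]) (use kL in blast)
  also have "\<dots> \<longleftrightarrow> mat_kernel ?M \<subseteq> mat_kernel (0\<^sub>m r nf @\<^sub>c K)" using kL by blast
  also have "\<dots> \<longleftrightarrow> (\<forall>v\<in>carrier_vec nf. \<forall>w\<in>carrier_vec nx. v @\<^sub>v w \<in> mat_kernel ?M \<longrightarrow> w \<in> mat_kernel K)"
  proof
    assume "mat_kernel ?M \<subseteq> mat_kernel (0\<^sub>m r nf @\<^sub>c K)"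
    then show "\<forall>v\<in>carrier_vec nf. \<forall>w\<in>carrier_vec nx. v @\<^sub>v w \<in> mat_kernel ?M \<longrightarrow> w \<in> mat_kernel K"
      using lower[OF K] by blast
  next
    assume *: "\<forall>v\<in>carrier_vec nf. \<forall>w\<in>carrier_vec nx. v @\<^sub>v w \<in> mat_kernel ?M \<longrightarrow> w \<in> mat_kernel K"
    show "mat_kernel ?M \<subseteq> mat_kernel (0\<^sub>m r nf @\<^sub>c K)"
    proof
      fix z assume z: "z \<in> mat_kernel ?M"
      then have "z \<in> mat_kernel (F @\<^sub>c X)" unfolding kM by blast
      then obtain v w where "z = v @\<^sub>v w" "v \<in> carrier_vec nf" "w \<in> carrier_vec nx"
        unfolding mat_kernel_append_cols[OF F X] by blast
      then show "z \<in> mat_kernel (0\<^sub>m r nf @\<^sub>c K)" using z * lower[OF K] by blast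
    qed
  qed
  also have "\<dots> \<longleftrightarrow> (\<forall>v\<in>carrier_vec nf. \<forall>w\<in>carrier_vec nx. F *\<^sub>v v + X *\<^sub>v w = 0\<^sub>v a \<and> w \<in> mat_kernel Y
      \<and> w \<in> mat_kernel Z \<longrightarrow> w \<in> mat_kernel K)"
    unfolding kM using upper lower[OF Y] lower[OF Z] by auto
  also have "\<dots> \<longleftrightarrow> (\<forall>w\<in>carrier_vec nx. X *\<^sub>v w \<in> mat_range F \<and> w \<in> mat_kernel Y
      \<and> w \<in> mat_kernel Z \<longrightarrow> w \<in> mat_kernel K)"
    using im by blast
  also have "\<dots> \<longleftrightarrow> ?sub" using X by (auto simp: mat_preim_def)
  finally show ?thesis .
qed

text \<open>Apart from the chain equations only the first block is constrained. It extends to a full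
  vector exactly when it starts a chain of length \<open>n\<close>, that is, when it lies in
  \<open>W^n\<close>, which is already the limit.\<close>

lemma kernel_subset_iff_first_block:
  fixes E A C K :: "real mat"
  assumes n: "n \<ge> 1" and E: "E \<in> carrier_mat m n" and A: "A \<in> carrier_mat m n"
    and C: "C \<in> carrier_mat p n" and K: "K \<in> carrier_mat r n" and A1: "A1 \<in> carrier_mat q n"
  shows "mat_preim (A1 @\<^sub>c 0\<^sub>m q ((n - 1) * n)) M \<inter> mat_kernel (C @\<^sub>c 0\<^sub>m p ((n - 1) * n))
        \<inter> mat_kernel (block_bidiag n (E @\<^sub>r 0\<^sub>m p n) (A @\<^sub>r C)) \<subseteq> mat_kernel (K @\<^sub>c 0\<^sub>m r ((n - 1) * n))
    \<longleftrightarrow> mat_preim A1 M \<inter> wong_W_lim E A (0\<^sub>m m l) C \<subseteq> mat_kernel K"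
    (is "?P \<inter> ?C \<inter> ?F \<subseteq> ?K \<longleftrightarrow> ?P1 \<inter> ?W \<subseteq> _")
proof -
  have nn: "n + (n - 1) * n = n * n" using n by (cases n) auto
  have c: "A1 @\<^sub>c 0\<^sub>m q ((n - 1) * n) \<in> carrier_mat q (n * n)"
    "C @\<^sub>c 0\<^sub>m p ((n - 1) * n) \<in> carrier_mat p (n * n)"
    "K @\<^sub>c 0\<^sub>m r ((n - 1) * n) \<in> carrier_mat r (n * n)"
    using append_cols_carrier[OF A1, of "0\<^sub>m q ((n - 1) * n)" "(n - 1) * n"]
      append_cols_carrier[OF C, of "0\<^sub>m p ((n - 1) * n)" "(n - 1) * n"]
      append_cols_carrier[OF K, of "0\<^sub>m r ((n - 1) * n)" "(n - 1) * n"] unfolding nn by auto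
  have first: "(X @\<^sub>c 0\<^sub>m k ((n - 1) * n)) *\<^sub>v v = X *\<^sub>v vblock n v 0"
    if "X \<in> carrier_mat k n" "v \<in> carrier_vec (n * n)" for X :: "real mat" and k v
    by (rule append_cols_zero_mult_vec[OF that(1)]) (simp only: nn that(2))
  have P: "v \<in> ?P \<longleftrightarrow> vblock n v 0 \<in> ?P1" and Ck: "v \<in> ?C \<longleftrightarrow> C *\<^sub>v vblock n v 0 = 0\<^sub>v p"
    and Kk: "v \<in> ?K \<longleftrightarrow> vblock n v 0 \<in> mat_kernel K" if v: "v \<in> carrier_vec (n * n)" for v
  proof -
    show "v \<in> ?P \<longleftrightarrow> vblock n v 0 \<in> ?P1"
      using c(1) A1 v first[OF A1 v] by (simp add: mat_preim_def)
    show "v \<in> ?C \<longleftrightarrow> C *\<^sub>v vblock n v 0 = 0\<^sub>v p"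
      unfolding mat_kernel[OF c(2)] using first[OF C v] v by simp
    show "v \<in> ?K \<longleftrightarrow> vblock n v 0 \<in> mat_kernel K"
      unfolding mat_kernel[OF c(3)] mat_kernel[OF K] using first[OF K v] v by simp
  qed
  note chain = kernel_block_bidiag_iff[OF n E A C]
  have W: "x \<in> ?W \<longleftrightarrow> (\<exists>v. wong_chain E A C (-1) n v \<and> v 0 = x)" for x
    unfolding wong_W_lim_eq[OF E A C] by (rule wong_W_iff_chain[OF E A C]) simp
  show ?thesis
  proof
    assume sub: "?P \<inter> ?C \<inter> ?F \<subseteq> ?K"
    show "?P1 \<inter> ?W \<subseteq> mat_kernel K"
    proof
      fix x assume x: "x \<in> ?P1 \<inter> ?W"
      then obtain vs where vs: "wong_chain E A C (-1) n vs" "vs 0 = x" using W by blast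
      \<comment> \<open>The blocks of \<open>v\<close> are the first n members of the chain; the
        final member is zero and is not stored.\<close>
      define v where "v = vconcat n n vs"
      have v: "v \<in> carrier_vec (n * n)" by (simp add: v_def)
      have "vs i \<in> carrier_vec n" if "i < n" for i
        using vs(1) E that unfolding wong_chain_def by (metis carrier_matD(2) less_imp_le)
      then have vb: "vblock n v i = vs i" if "i < n" for i
        unfolding v_def using that by (intro vblock_vconcat) auto
      have vn: "vs n = 0\<^sub>v n" using vs(1) E by (simp add: wong_chain_def)
      have "wong_chain E A C (-1) n (\<lambda>i. if i < n then vblock n v i else 0\<^sub>v n)"
        using vs(1) vb vn by (subst wong_chain_cong[where w = vs]) auto
      then have "v \<in> ?F" "C *\<^sub>v vblock n v 0 = 0\<^sub>v p" using chain[OF v] by auto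
      then have "v \<in> ?P \<inter> ?C \<inter> ?F" using P[OF v] Ck[OF v] vb[of 0] n vs(2) x by auto
      then show "x \<in> mat_kernel K" using sub Kk[OF v] vb[of 0] n vs(2) by auto
    qed
  next
    assume sub: "?P1 \<inter> ?W \<subseteq> mat_kernel K"
    show "?P \<inter> ?C \<inter> ?F \<subseteq> ?K"
    proof
      fix v assume v: "v \<in> ?P \<inter> ?C \<inter> ?F"
      then have vc: "v \<in> carrier_vec (n * n)" unfolding mat_kernel[OF c(2)] by blast
      have "wong_chain E A C (-1) n (\<lambda>i. if i < n then vblock n v i else 0\<^sub>v n)"
        using v chain[OF vc] Ck[OF vc] by blast
      then have "vblock n v 0 \<in> ?W" unfolding W using n
        by (intro exI[of _ "\<lambda>i. if i < n then vblock n v i else 0\<^sub>v n"] conjI) simp_all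
      then show "v \<in> ?K" using sub v P[OF vc] Kk[OF vc] by blast
    qed
  qed
qed

section \<open>Kalman decomposition\<close>

lemma wong_V_antimono:
  assumes E: "E \<in> carrier_mat m n" and A: "A \<in> carrier_mat m n" and B: "B \<in> carrier_mat m l" and "i \<le> k"
  shows "wong_V E A B (0\<^sub>m p n) k \<subseteq> wong_V E A B (0\<^sub>m p n) i"
proof -
  have "wong_V E A B (0\<^sub>m p n) (Suc j) \<subseteq> wong_V E A B (0\<^sub>m p n) j" for j
  proof (induction j)
    case 0
    then show ?case using wong_V_Suc_iff[OF E A B] by (auto simp: wong_V_0)
  next
    case (Suc j)
    show ?case
    proof
      fix x assume "x \<in> wong_V E A B (0\<^sub>m p n) (Suc (Suc j))"
      then show "x \<in> wong_V E A B (0\<^sub>m p n) (Suc j)"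
        unfolding wong_V_Suc_iff[OF E A B] using Suc by blast
    qed
  qed
  then show ?thesis using \<open>i \<le> k\<close> lift_Suc_antimono_le[of "wong_V E A B (0\<^sub>m p n)" i k] by blast
qed

text \<open>A relation of minimal degree \<open>p\<close> between the vectors of a chain is divided by a linear
  factor; the resulting combination is an eigenvector of the pencil.\<close>

lemma wong_V_eq_0_of_pencil_injective:
  fixes E A :: "real mat"
  assumes E: "E \<in> carrier_mat q k" and A: "A \<in> carrier_mat q k"
    and rank: "\<And>\<mu>::complex. mrank (\<mu> \<cdot>\<^sub>m map_mat complex_of_real E - map_mat complex_of_real A) = k"
    and x: "x \<in> wong_V E A (0\<^sub>m q l) (0\<^sub>m p k) k"
  shows "x = 0\<^sub>v k"
proof (rule ccontr)
  assume "x \<noteq> 0\<^sub>v k"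
  have Z: "0\<^sub>m q l \<in> carrier_mat q l" by simp
  obtain xs us where ch: "control_chain E A (0\<^sub>m q l) k xs us" and xsk: "xs k = x"
    using x wong_V_iff_chain[OF E A Z, of x p k] by blast
  \<comment> \<open>Reversed, the chain starts at \<open>x\<close> and satisfies
    \<open>A y_i = - E y_(i+1)\<close>.\<close>
  define y where "y = (\<lambda>i. xs (k - i))"
  have yc: "y i \<in> carrier_vec k" for i using ch E by (auto simp: control_chain_def y_def)
  have y0: "y 0 = x" by (simp add: y_def xsk)
  have yE: "(A *\<^sub>v y i) $ a = - (E *\<^sub>v y (Suc i)) $ a" if "i < k" "a < q" for i a
  proof -
    have *: "k - Suc i < k" "Suc (k - Suc i) = k - i" using that by auto
    then have "us (k - Suc i) \<in> carrier_vec l"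
        "E *\<^sub>v y (Suc i) + (A *\<^sub>v y i + 0\<^sub>m q l *\<^sub>v us (k - Suc i)) = 0\<^sub>v q"
      using ch E unfolding control_chain_def y_def by (metis carrier_matD(1) carrier_matD(2) Z, metis carrier_matD(1))
    then have "E *\<^sub>v y (Suc i) + (A *\<^sub>v y i + 0\<^sub>v q) = 0\<^sub>v q" by simp
    from arg_cong[OF this, of "\<lambda>v. v $ a"] show ?thesis using that E A by simp
  qed
  \<comment> \<open>A relation between \<open>y_0, ..., y_k\<close> is stored as the polynomial of
    its coefficients, so that an index shift becomes multiplication by the variable. The
    coefficients are complex in order to have a root.\<close>
  define rel where "rel = (\<lambda>P. P \<noteq> (0 :: complex poly) \<and> Polynomial.degree P \<le> k \<and>
    (\<forall>j<k. (\<Sum>i\<le>k. coeff P i * of_real (y i $ j)) = 0))"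
  have "\<exists>P. rel P"
  proof -
    obtain c where c: "\<exists>i\<le>k. c i \<noteq> 0" "\<And>j. j < k \<Longrightarrow> (\<Sum>i\<le>k. c i * map_vec complex_of_real (y i) $ j) = 0"
      using exists_nontrivial_relation[of k "\<lambda>i. map_vec complex_of_real (y i)"] by blast
    define P where "P = (\<Sum>i\<le>k. Polynomial.monom (c i) i)"
    have P: "coeff P i = (if i \<le> k then c i else 0)" for i
      by (simp add: P_def coeff_sum)
    have "P \<noteq> 0" using c(1) P by (metis coeff_0)
    moreover have "Polynomial.degree P \<le> k" using P by (simp add: degree_le)
    moreover have "(\<Sum>i\<le>k. coeff P i * of_real (y i $ j)) = 0" if "j < k" for j
    proof -
      have "map_vec complex_of_real (y i) $ j = of_real (y i $ j)" for i using yc[of i] that by auto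
      then show ?thesis using c(2)[OF that] by (simp add: P)
    qed
    ultimately show ?thesis unfolding rel_def by blast
  qed
  then obtain P where P: "rel P" and min: "\<And>Q. rel Q \<Longrightarrow> Polynomial.degree P \<le> Polynomial.degree Q"
    using ex_has_least_nat[of rel _ Polynomial.degree] by blast
  have Pk: "Polynomial.degree P \<le> k" and P0: "P \<noteq> 0"
    and Prel: "\<And>j. j < k \<Longrightarrow> (\<Sum>i\<le>k. coeff P i * of_real (y i $ j)) = 0"
    using P by (auto simp: rel_def)
  have "Polynomial.degree P \<noteq> 0"
  proof
    assume d: "Polynomial.degree P = 0"
    have cz: "coeff P i = 0" if "i \<noteq> 0" for i using d that by (simp add: coeff_eq_0)
    have c0: "coeff P 0 \<noteq> 0" using P0 d by (metis leading_coeff_0_iff)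
    have "y 0 $ j = 0" if "j < k" for j
    proof -
      have "(\<Sum>i\<le>k. coeff P i * of_real (y i $ j)) = (\<Sum>i\<in>{0}. coeff P i * of_real (y i $ j))"
        by (rule sum.mono_neutral_right) (auto simp: cz)
      then show ?thesis using Prel[OF that] c0 by simp
    qed
    then have "x = 0\<^sub>v k" using yc[of 0] y0 by (intro eq_vecI) auto
    then show False using \<open>x \<noteq> 0\<^sub>v k\<close> by simp
  qed
  then obtain \<mu> where "poly P \<mu> = 0" using alg_closed_imp_poly_has_root[of P] by blast
  then obtain Q where PQ: "P = [:-\<mu>, 1:] * Q" by (metis poly_eq_0_iff_dvd dvdE)
  have Q0: "Q \<noteq> 0" using P0 PQ by auto
  have dQ: "Polynomial.degree P = Suc (Polynomial.degree Q)"
    using Q0 unfolding PQ by (subst degree_mult_eq) auto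
  then have dQk: "Polynomial.degree Q < k" using Pk by simp
  have cP: "coeff P 0 = - \<mu> * coeff Q 0" "coeff P (Suc i) = coeff Q i - \<mu> * coeff Q (Suc i)" for i
    by (simp_all add: PQ)
  have Qk: "coeff Q k = 0" using dQk by (simp add: coeff_eq_0)
  \<comment> \<open>\<open>z\<close> is the combination with the coefficients of \<open>Q\<close>,
    the quotient of \<open>P\<close> by its linear factor. It is nonzero because \<open>Q\<close>
    has smaller degree than a minimal relation.\<close>
  define z where "z = vec k (\<lambda>j. \<Sum>i\<le>k. coeff Q i * of_real (y i $ j))"
  have zc: "z \<in> carrier_vec k" by (simp add: z_def)
  have "z \<noteq> 0\<^sub>v k"
  proof
    assume "z = 0\<^sub>v k"
    then have zj: "z $ j = 0" if "j < k" for j using that by simp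
    have "(\<Sum>i\<le>k. coeff Q i * of_real (y i $ j)) = 0" if "j < k" for j
      using zj[OF that] that by (simp add: z_def)
    then have "rel Q" using Q0 dQk by (simp add: rel_def)
    then show False using min[of Q] dQ by simp
  qed
  have split: "(\<Sum>i\<le>k. f i) = f 0 + (\<Sum>i<k. f (Suc i))" for f :: "nat \<Rightarrow> complex"
    by (simp add: sum.atMost_shift)
  have last: "(\<Sum>i\<le>k. coeff Q i * f i) = (\<Sum>i<k. coeff Q i * f i)" for f
    using Qk by (simp add: lessThan_Suc_atMost[symmetric])
  \<comment> \<open>By the factorization of \<open>P\<close>, replacing each \<open>y_i\<close> by
    \<open>y_(i+1)\<close> in \<open>z\<close> multiplies it by \<mu>. With the link equation this
    gives \<open>A z = - \<mu> E z\<close>, so the rank hypothesis is applied at - \<mu>.\<close>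
  have shift: "(\<Sum>i<k. coeff Q i * of_real (y (Suc i) $ j)) = \<mu> * z $ j" if j: "j < k" for j
  proof -
    have "0 = (\<Sum>i\<le>k. coeff P i * of_real (y i $ j))" using Prel[OF j] by simp
    also have "\<dots> = (\<Sum>i<k. coeff Q i * of_real (y (Suc i) $ j))
        - \<mu> * (coeff Q 0 * of_real (y 0 $ j) + (\<Sum>i<k. coeff Q (Suc i) * of_real (y (Suc i) $ j)))"
      unfolding split by (simp add: cP algebra_simps sum_distrib_left sum_subtractf)
    also have "coeff Q 0 * of_real (y 0 $ j) + (\<Sum>i<k. coeff Q (Suc i) * of_real (y (Suc i) $ j))
        = (\<Sum>i\<le>k. coeff Q i * of_real (y i $ j))" unfolding split ..
    finally show ?thesis using j by (simp add: z_def)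
  qed
  have mult: "(map_mat complex_of_real X *\<^sub>v vec k (\<lambda>j. \<Sum>i<k. coeff Q i * of_real (w i $ j))) $ a
      = (\<Sum>i<k. coeff Q i * of_real ((X *\<^sub>v w i) $ a))"
    if X: "X \<in> carrier_mat q k" and w: "\<And>i. w i \<in> carrier_vec k" and a: "a < q" for X w a
  proof -
    have "(map_mat complex_of_real X *\<^sub>v vec k (\<lambda>j. \<Sum>i<k. coeff Q i * of_real (w i $ j))) $ a
      = (\<Sum>j<k. \<Sum>i<k. of_real (X $$ (a, j)) * (coeff Q i * of_real (w i $ j)))"
      using X a by (simp add: scalar_prod_def atLeast0LessThan sum_distrib_left)
    also have "\<dots> = (\<Sum>i<k. \<Sum>j<k. of_real (X $$ (a, j)) * (coeff Q i * of_real (w i $ j)))"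
      by (rule sum.swap)
    also have "\<dots> = (\<Sum>i<k. coeff Q i * of_real ((X *\<^sub>v w i) $ a))"
    proof (rule sum.cong[OF refl])
      fix i
      have dw: "dim_vec (w i) = k" using w[of i] by simp
      show "(\<Sum>j<k. of_real (X $$ (a, j)) * (coeff Q i * of_real (w i $ j))) = coeff Q i * of_real ((X *\<^sub>v w i) $ a)"
        using X a by (simp add: dw scalar_prod_def atLeast0LessThan sum_distrib_left mult_ac)
    qed
    finally show ?thesis .
  qed
  let ?E = "map_mat complex_of_real E" and ?A = "map_mat complex_of_real A"
  have zs: "z = vec k (\<lambda>j. \<Sum>i<k. coeff Q i * of_real (y i $ j))" unfolding z_def last ..
  have \<mu>z: "\<mu> \<cdot>\<^sub>v z = vec k (\<lambda>j. \<Sum>i<k. coeff Q i * of_real (y (Suc i) $ j))"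
    using zc shift by (intro eq_vecI) auto
  have Ec: "?E \<in> carrier_mat q k" and Ac: "?A \<in> carrier_mat q k" using E A by auto
  have "((- \<mu> \<cdot>\<^sub>m ?E - ?A) *\<^sub>v z) $ a = 0" if a: "a < q" for a
  proof -
    have "(?A *\<^sub>v z) $ a = - (?E *\<^sub>v (\<mu> \<cdot>\<^sub>v z)) $ a"
      unfolding \<mu>z unfolding zs mult[OF A yc a] mult[OF E yc a] by (simp add: yE a sum_negf)
    moreover have "(?E *\<^sub>v (\<mu> \<cdot>\<^sub>v z)) $ a = \<mu> * (?E *\<^sub>v z) $ a"
      using mult_mat_vec[OF Ec zc] a Ec by simp
    moreover have "((- \<mu> \<cdot>\<^sub>m ?E - ?A) *\<^sub>v z) $ a = (- \<mu> \<cdot>\<^sub>m ?E *\<^sub>v z) $ a - (?A *\<^sub>v z) $ a"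
      using a Ac Ec zc by (subst minus_mult_distrib_mat_vec[of _ q k]) auto
    moreover have "(- \<mu> \<cdot>\<^sub>m ?E *\<^sub>v z) $ a = - \<mu> * (?E *\<^sub>v z) $ a"
      using a Ec zc by (simp add: scalar_prod_def sum_distrib_left mult.assoc sum_negf)
    ultimately show ?thesis by simp
  qed
  then have "(- \<mu> \<cdot>\<^sub>m ?E - ?A) *\<^sub>v z = 0\<^sub>v q" using Ac Ec by (intro eq_vecI) auto
  moreover have "- \<mu> \<cdot>\<^sub>m ?E - ?A \<in> carrier_mat q k" using Ac Ec by auto
  ultimately have "z = 0\<^sub>v k" using mat_kernel_of_full_col_rank[OF _ rank zc] by blast
  then show False using \<open>z \<noteq> 0\<^sub>v k\<close> by simp
qed

section \<open>Invariance of (iv) under a change of coordinates\<close>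

lemma invertible_mat_inverse:
  fixes S :: "'a::field mat"
  assumes S: "S \<in> carrier_mat n n" and inv: "invertible_mat S"
  obtains S' where "S' \<in> carrier_mat n n" "S' * S = 1\<^sub>m n" "S * S' = 1\<^sub>m n"
proof -
  obtain S' where S': "S * S' = 1\<^sub>m (dim_row S)" "S' * S = 1\<^sub>m (dim_row S')"
    using inv unfolding invertible_mat_def inverts_mat_def by blast
  have "dim_col S' = n" using arg_cong[OF S'(1), of dim_col] S by simp
  moreover have "dim_row S' = n" using arg_cong[OF S'(2), of dim_col] S by simp
  ultimately show thesis using S' S that by auto
qed

lemma invertible_mult_vec_eq_iff:
  fixes S :: "'a::field mat"
  assumes S: "S \<in> carrier_mat n n" and inv: "invertible_mat S" and "v \<in> carrier_vec n" "w \<in> carrier_vec n"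
  shows "S *\<^sub>v v = S *\<^sub>v w \<longleftrightarrow> v = w"
proof -
  obtain S' where S': "S' \<in> carrier_mat n n" "S' * S = 1\<^sub>m n"
    using invertible_mat_inverse[OF S inv] by blast
  have "S' *\<^sub>v (S *\<^sub>v u) = u" if "u \<in> carrier_vec n" for u
    using assoc_mult_mat_vec[OF S'(1) S that] S'(2) that by simp
  then show ?thesis using assms by metis
qed

lemma invertible_mult_vec_surj:
  fixes T :: "'a::field mat"
  assumes T: "T \<in> carrier_mat n n" and inv: "invertible_mat T" and w: "w \<in> carrier_vec n"
  shows "\<exists>v\<in>carrier_vec n. T *\<^sub>v v = w"
proof -
  obtain T' where T': "T' \<in> carrier_mat n n" "T * T' = 1\<^sub>m n"
    using invertible_mat_inverse[OF T inv] by blast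
  have "T *\<^sub>v (T' *\<^sub>v w) = w"
    using assoc_mult_mat_vec[OF T T'(1) w] T'(2) w by simp
  then show ?thesis using T'(1) w by (intro bexI[of _ "T' *\<^sub>v w"]) auto
qed

context
  fixes E A B C K S T :: "real mat" and m n l p r :: nat
  assumes E: "E \<in> carrier_mat m n" and A: "A \<in> carrier_mat m n" and B: "B \<in> carrier_mat m l"
    and C: "C \<in> carrier_mat p n" and K: "K \<in> carrier_mat r n"
    and S: "S \<in> carrier_mat m m" "invertible_mat S" and T: "T \<in> carrier_mat n n" "invertible_mat T"
begin

lemma equiv_mult_vec:
  assumes X: "X \<in> carrier_mat m n" and x: "x \<in> carrier_vec n"
  shows "(S * X * T) *\<^sub>v x = S *\<^sub>v (X *\<^sub>v (T *\<^sub>v x))"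
proof -
  have "S * X \<in> carrier_mat m n" "T *\<^sub>v x \<in> carrier_vec n" using S X T x by auto
  then show ?thesis
    using assoc_mult_mat_vec[OF _ T(1) x, of "S * X"] assoc_mult_mat_vec[OF S(1) X, of "T *\<^sub>v x"] by simp
qed

lemma equiv_carrier: "X \<in> carrier_mat m n \<Longrightarrow> S * X * T \<in> carrier_mat m n"
  "S * B \<in> carrier_mat m l" "C * T \<in> carrier_mat p n" "K * T \<in> carrier_mat r n"
  using S T B C K by auto

text \<open>\<open>S\<close> is injective and cancels from the defining equation of each step;
  \<open>T\<close> is onto, so every witness in the old coordinates has a counterpart in the new
  ones.\<close>

lemma wong_V_equiv:
  assumes "x \<in> carrier_vec n"
  shows "x \<in> wong_V (S * E * T) (S * A * T) (S * B) (0\<^sub>m p n) k \<longleftrightarrow> T *\<^sub>v x \<in> wong_V E A B (0\<^sub>m p n) k"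
  using assms
proof (induction k arbitrary: x)
  case 0
  then show ?case using T by (simp add: wong_V_0)
next
  case (Suc k)
  note Tc = mult_mat_vec_carrier[OF T(1)]
  let ?V' = "wong_V (S * E * T) (S * A * T) (S * B) (0\<^sub>m p n)" and ?V = "wong_V E A B (0\<^sub>m p n)"
  have lc: "v \<in> carrier_vec n" if "v \<in> ?V' k" for v
    using lin_closedD(1)[OF lin_closed_wong_V0[OF equiv_carrier(1)[OF E] equiv_carrier(1)[OF A] equiv_carrier(2)] that] .
  have lc': "v \<in> carrier_vec n" if "v \<in> ?V k" for v
    using lin_closedD(1)[OF lin_closed_wong_V0[OF E A B] that] .
  have eq: "(S * A * T) *\<^sub>v x = (S * E * T) *\<^sub>v v + (S * B) *\<^sub>v u \<longleftrightarrow> A *\<^sub>v (T *\<^sub>v x) = E *\<^sub>v (T *\<^sub>v v) + B *\<^sub>v u"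
    if v: "v \<in> carrier_vec n" and u: "u \<in> carrier_vec l" for v u
  proof -
    have "(S * E * T) *\<^sub>v v + (S * B) *\<^sub>v u = S *\<^sub>v (E *\<^sub>v (T *\<^sub>v v) + B *\<^sub>v u)"
      using equiv_mult_vec[OF E v] assoc_mult_mat_vec[OF S(1) B u]
        mult_add_distrib_mat_vec[OF S(1), of "E *\<^sub>v (T *\<^sub>v v)" "B *\<^sub>v u"] Tc[OF v] u E B by simp
    moreover have "A *\<^sub>v (T *\<^sub>v x) \<in> carrier_vec m" "E *\<^sub>v (T *\<^sub>v v) + B *\<^sub>v u \<in> carrier_vec m"
      using Tc[OF v] Tc[OF Suc.prems] A E B u by auto
    ultimately show ?thesis
      using equiv_mult_vec[OF A Suc.prems] invertible_mult_vec_eq_iff[OF S] by simp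
  qed
  have "(\<exists>v\<in>?V' k. \<exists>u\<in>carrier_vec l. (S * A * T) *\<^sub>v x = (S * E * T) *\<^sub>v v + (S * B) *\<^sub>v u)
    \<longleftrightarrow> (\<exists>v\<in>?V k. \<exists>u\<in>carrier_vec l. A *\<^sub>v (T *\<^sub>v x) = E *\<^sub>v v + B *\<^sub>v u)" (is "?L \<longleftrightarrow> ?R")
  proof
    assume ?L
    then show ?R using lc Suc.IH eq by meson
  next
    assume ?R
    then obtain v u where vu: "v \<in> ?V k" "u \<in> carrier_vec l" "A *\<^sub>v (T *\<^sub>v x) = E *\<^sub>v v + B *\<^sub>v u" by blast
    obtain v' where v': "v' \<in> carrier_vec n" "T *\<^sub>v v' = v"
      using invertible_mult_vec_surj[OF T lc'[OF vu(1)]] by blast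
    then show ?L using vu Suc.IH[OF v'(1)] eq[OF v'(1) vu(2)] by blast
  qed
  then show ?case
    unfolding wong_V_Suc_iff[OF E A B] wong_V_Suc_iff[OF equiv_carrier(1)[OF E] equiv_carrier(1)[OF A] equiv_carrier(2)]
    using Suc.prems Tc by blast
qed

lemma wong_W_equiv:
  assumes "x \<in> carrier_vec n"
  shows "x \<in> wong_W (S * E * T) (S * A * T) (0\<^sub>m m l) (C * T) k \<longleftrightarrow> T *\<^sub>v x \<in> wong_W E A (0\<^sub>m m l) C k"
  using assms
proof (induction k arbitrary: x)
  case 0
  have "T *\<^sub>v 0\<^sub>v n = 0\<^sub>v n" using T by auto
  then show ?case using T E 0 invertible_mult_vec_eq_iff[OF T 0, of "0\<^sub>v n"] by auto
next
  case (Suc k)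
  note Tc = mult_mat_vec_carrier[OF T(1)]
  let ?W' = "wong_W (S * E * T) (S * A * T) (0\<^sub>m m l) (C * T)" and ?W = "wong_W E A (0\<^sub>m m l) C"
  have lc: "v \<in> carrier_vec n" if "v \<in> ?W' k" for v
    using lin_closedD(1)[OF lin_closed_wong_W0[OF equiv_carrier(1)[OF E] equiv_carrier(1)[OF A] equiv_carrier(3)] that] .
  have lc': "v \<in> carrier_vec n" if "v \<in> ?W k" for v
    using lin_closedD(1)[OF lin_closed_wong_W0[OF E A C] that] .
  have eq: "(S * E * T) *\<^sub>v x = (S * A * T) *\<^sub>v v \<longleftrightarrow> E *\<^sub>v (T *\<^sub>v x) = A *\<^sub>v (T *\<^sub>v v)"
    if v: "v \<in> carrier_vec n" for v
    unfolding equiv_mult_vec[OF E Suc.prems] equiv_mult_vec[OF A v]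
    by (rule invertible_mult_vec_eq_iff[OF S]) (use E A Tc[OF v] Tc[OF Suc.prems] in auto)
  have "(\<exists>v\<in>?W' k. (S * E * T) *\<^sub>v x = (S * A * T) *\<^sub>v v)
    \<longleftrightarrow> (\<exists>v\<in>?W k. E *\<^sub>v (T *\<^sub>v x) = A *\<^sub>v v)" (is "?L \<longleftrightarrow> ?R")
  proof
    assume ?L
    then show ?R using lc Suc.IH eq by meson
  next
    assume ?R
    then obtain v where v: "v \<in> ?W k" "E *\<^sub>v (T *\<^sub>v x) = A *\<^sub>v v" by blast
    obtain v' where v': "v' \<in> carrier_vec n" "T *\<^sub>v v' = v"
      using invertible_mult_vec_surj[OF T lc'[OF v(1)]] by blast
    then show ?L using v Suc.IH[OF v'(1)] eq[OF v'(1)] by blast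
  qed
  moreover have "(C * T) *\<^sub>v x = C *\<^sub>v (T *\<^sub>v x)" using assoc_mult_mat_vec[OF C T(1) Suc.prems] .
  ultimately show ?case
    unfolding wong_W_Suc_iff[OF E A C] wong_W_Suc_iff[OF equiv_carrier(1)[OF E] equiv_carrier(1)[OF A] equiv_carrier(3)]
    using Suc.prems Tc by simp
qed

text \<open>\<open>T\<close> carries each set of the transformed system onto the original one, and
  \<open>K * T\<close> vanishes at x exactly when \<open>K\<close> vanishes at \<open>T x\<close>.
  This permits passing to Kalman coordinates.\<close>

lemma observability_subset_equiv:
  "mat_preim A (mat_im E (wong_V E A B (0\<^sub>m p n) k)) \<inter> wong_W_lim E A (0\<^sub>m m l) C \<subseteq> mat_kernel K \<longleftrightarrow>
   mat_preim (S * A * T) (mat_im (S * E * T) (wong_V (S * E * T) (S * A * T) (S * B) (0\<^sub>m p n) k))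
     \<inter> wong_W_lim (S * E * T) (S * A * T) (0\<^sub>m m l) (C * T) \<subseteq> mat_kernel (K * T)"
  (is "?I \<subseteq> _ \<longleftrightarrow> ?I' \<subseteq> _")
proof -
  note Tc = mult_mat_vec_carrier[OF T(1)]
  note c = equiv_carrier(1)[OF E] equiv_carrier(1)[OF A] equiv_carrier(2)
  let ?V' = "wong_V (S * E * T) (S * A * T) (S * B) (0\<^sub>m p n) k" and ?V = "wong_V E A B (0\<^sub>m p n) k"
  have lc: "v \<in> carrier_vec n" if "v \<in> ?V'" for v
    using lin_closedD(1)[OF lin_closed_wong_V0[OF c] that] .
  have lc': "v \<in> carrier_vec n" if "v \<in> ?V" for v
    using lin_closedD(1)[OF lin_closed_wong_V0[OF E A B] that] .
  have main: "x \<in> ?I' \<longleftrightarrow> T *\<^sub>v x \<in> ?I" if x: "x \<in> carrier_vec n" for x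
  proof -
    have eq: "(S * A * T) *\<^sub>v x = (S * E * T) *\<^sub>v v \<longleftrightarrow> A *\<^sub>v (T *\<^sub>v x) = E *\<^sub>v (T *\<^sub>v v)"
      if v: "v \<in> carrier_vec n" for v
      unfolding equiv_mult_vec[OF A x] equiv_mult_vec[OF E v]
      by (rule invertible_mult_vec_eq_iff[OF S]) (use E A Tc[OF v] Tc[OF x] in auto)
    have "(\<exists>v\<in>?V'. (S * A * T) *\<^sub>v x = (S * E * T) *\<^sub>v v) \<longleftrightarrow> (\<exists>v\<in>?V. A *\<^sub>v (T *\<^sub>v x) = E *\<^sub>v v)"
      (is "?L \<longleftrightarrow> ?R")
    proof
      assume ?L
      then show ?R using lc wong_V_equiv eq by meson
    next
      assume ?R
      then obtain v where v: "v \<in> ?V" "A *\<^sub>v (T *\<^sub>v x) = E *\<^sub>v v" by blast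
      obtain v' where v': "v' \<in> carrier_vec n" "T *\<^sub>v v' = v"
        using invertible_mult_vec_surj[OF T lc'[OF v(1)]] by blast
      then show ?L using v wong_V_equiv[OF v'(1)] eq[OF v'(1)] by blast
    qed
    then have "x \<in> mat_preim (S * A * T) (mat_im (S * E * T) ?V') \<longleftrightarrow> T *\<^sub>v x \<in> mat_preim A (mat_im E ?V)"
      using x Tc[OF x] c A T by (auto simp: mat_preim_def mat_im_def)
    moreover have "x \<in> wong_W_lim (S * E * T) (S * A * T) (0\<^sub>m m l) (C * T) \<longleftrightarrow>
        T *\<^sub>v x \<in> wong_W_lim E A (0\<^sub>m m l) C"
      unfolding wong_W_lim_def using wong_W_equiv[OF x] by blast
    ultimately show ?thesis by blast
  qed
  have K': "x \<in> mat_kernel (K * T) \<longleftrightarrow> T *\<^sub>v x \<in> mat_kernel K" if x: "x \<in> carrier_vec n" for x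
    unfolding mat_kernel[OF K] mat_kernel[OF equiv_carrier(4)]
    using assoc_mult_mat_vec[OF K T(1) x] x Tc[OF x] by simp
  have I: "?I \<subseteq> carrier_vec n" "?I' \<subseteq> carrier_vec n" using A T by (auto simp: mat_preim_def)
  show ?thesis
  proof
    assume "?I \<subseteq> mat_kernel K"
    then show "?I' \<subseteq> mat_kernel (K * T)" using main K' I by blast
  next
    assume *: "?I' \<subseteq> mat_kernel (K * T)"
    show "?I \<subseteq> mat_kernel K"
    proof
      fix x assume x: "x \<in> ?I"
      then have "x \<in> carrier_vec n" using I(1) by blast
      then obtain x' where x': "x' \<in> carrier_vec n" "T *\<^sub>v x' = x"
        using invertible_mult_vec_surj[OF T] by blast
      then show "x \<in> mat_kernel K" using * main[OF x'(1)] K'[OF x'(1)] x by blast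
    qed
  qed
qed

end

section \<open>Block triangular coordinates\<close>

definition slice :: "nat \<Rightarrow> nat \<Rightarrow> 'a vec \<Rightarrow> 'a vec" where
  "slice i k v = vec k (\<lambda>j. v $ (i + j))"

lemma slice_carrier [simp]: "slice i k v \<in> carrier_vec k" by (simp add: slice_def)

lemma block_at_carrier [simp]: "block_at X i j nr nc \<in> carrier_mat nr nc" by (simp add: block_at_def)

lemma slice_add:
  "i + k \<le> n \<Longrightarrow> v \<in> carrier_vec n \<Longrightarrow> w \<in> carrier_vec n \<Longrightarrow> slice i k (v + w) = slice i k v + slice i k w"
  by (intro eq_vecI) (auto simp: slice_def)

lemma slice_zero [simp]: "i + k \<le> n \<Longrightarrow> slice i k (0\<^sub>v n) = 0\<^sub>v k"
  by (intro eq_vecI) (auto simp: slice_def)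

lemma vec_eq_of_slices:
  assumes "v \<in> carrier_vec (n1 + n2 + n3)" "w \<in> carrier_vec (n1 + n2 + n3)"
    and "slice 0 n1 v = slice 0 n1 w" "slice n1 n2 v = slice n1 n2 w" "slice (n1 + n2) n3 v = slice (n1 + n2) n3 w"
  shows "v = w"
proof (rule eq_vecI)
  have s: "v $ (i + j) = w $ (i + j)" if "slice i k v = slice i k w" "j < k" for i j k
    using arg_cong[OF that(1), of "\<lambda>u. u $ j"] that(2) by (simp add: slice_def)
  fix j assume "j < dim_vec w"
  then have j: "j < n1 + n2 + n3" using assms(2) by simp
  consider "j < n1" | "n1 \<le> j" "j < n1 + n2" | "n1 + n2 \<le> j" by linarith
  then show "v $ j = w $ j"
  proof cases
    case 1
    then show ?thesis using s[OF assms(3), of j] by simp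
  next
    case 2
    then show ?thesis using s[OF assms(4), of "j - n1"] by simp
  next
    case 3
    then show ?thesis using s[OF assms(5), of "j - (n1 + n2)"] j by simp
  qed
qed (use assms in simp)

lemma slice_mult_mat_vec:
  fixes X :: "'a::comm_semiring_0 mat"
  assumes X: "X \<in> carrier_mat R (n1 + n2 + n3)" and x: "x \<in> carrier_vec (n1 + n2 + n3)" and R: "i + k \<le> R"
  shows "slice i k (X *\<^sub>v x) = block_at X i 0 k n1 *\<^sub>v slice 0 n1 x
    + (block_at X i n1 k n2 *\<^sub>v slice n1 n2 x + block_at X i (n1 + n2) k n3 *\<^sub>v slice (n1 + n2) n3 x)"
proof (rule eq_vecI)
  fix a assume "a < dim_vec (block_at X i 0 k n1 *\<^sub>v slice 0 n1 x
    + (block_at X i n1 k n2 *\<^sub>v slice n1 n2 x + block_at X i (n1 + n2) k n3 *\<^sub>v slice (n1 + n2) n3 x))"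
  then have a: "a < k" by (simp add: block_at_def)
  have split: "(\<Sum>j<n1 + n2 + n3. f j) = (\<Sum>j<n1. f j) + ((\<Sum>j<n2. f (n1 + j)) + (\<Sum>j<n3. f (n1 + n2 + j)))"
    for f :: "nat \<Rightarrow> 'a"
  proof -
    have concat: "(\<Sum>j<u + v. f j) = (\<Sum>j<u. f j) + (\<Sum>j<v. f (u + j))" for u v
      by (induction v) (simp_all add: add_ac)
    show ?thesis by (simp only: concat[of "n1 + n2" n3] concat[of n1 n2] add.assoc[of "\<Sum>j<n1. f j"])
  qed
  have "slice i k (X *\<^sub>v x) $ a = (\<Sum>j<n1 + n2 + n3. X $$ (i + a, j) * x $ j)"
    using a R X x by (simp add: slice_def scalar_prod_def atLeast0LessThan)
  also have "\<dots> = (block_at X i 0 k n1 *\<^sub>v slice 0 n1 x) $ a + ((block_at X i n1 k n2 *\<^sub>v slice n1 n2 x) $ a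
      + (block_at X i (n1 + n2) k n3 *\<^sub>v slice (n1 + n2) n3 x) $ a)"
    unfolding split using a by (simp add: block_at_def slice_def scalar_prod_def atLeast0LessThan)
  finally show "slice i k (X *\<^sub>v x) $ a = (block_at X i 0 k n1 *\<^sub>v slice 0 n1 x
    + (block_at X i n1 k n2 *\<^sub>v slice n1 n2 x + block_at X i (n1 + n2) k n3 *\<^sub>v slice (n1 + n2) n3 x)) $ a"
    using a by (simp add: block_at_def)
qed (simp add: slice_def block_at_def)

text \<open>Used to embed the first Kalman component into the whole space.\<close>

definition pad :: "nat \<Rightarrow> 'a::zero vec \<Rightarrow> 'a vec" where
  "pad n a = vec n (\<lambda>j. if j < dim_vec a then a $ j else 0)"

lemma pad_carrier [simp]: "pad n a \<in> carrier_vec n" by (simp add: pad_def)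

lemma slice_pad:
  assumes "a \<in> carrier_vec n1" "n1 \<le> n"
  shows "slice 0 n1 (pad n a) = a" "n1 \<le> i \<Longrightarrow> i + k \<le> n \<Longrightarrow> slice i k (pad n a) = 0\<^sub>v k"
  using assms by (auto intro!: eq_vecI simp: slice_def pad_def)

text \<open>Here \<open>E\<close>, \<open>A\<close>, \<open>B\<close>, \<open>C\<close>,
  \<open>K\<close> are already in Kalman coordinates: the final proof instantiates them with
  \<open>S * E * T\<close>, \<open>S * A * T\<close>, \<open>S * B\<close>, \<open>C * T\<close>,
  \<open>K * T\<close>. The blocks above the diagonal remain arbitrary.\<close>

context
  fixes E A B C K :: "real mat" and m1 m2 m3 n1 n2 n3 m n l p r :: nat
    and E11 A11 B1 C1 K1 E22 E33 A33 :: "real mat"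
  defines "E11 \<equiv> block_at E 0 0 m1 n1" and "A11 \<equiv> block_at A 0 0 m1 n1" and "B1 \<equiv> block_at B 0 0 m1 l"
    and "C1 \<equiv> block_at C 0 0 p n1" and "K1 \<equiv> block_at K 0 0 r n1" and "E22 \<equiv> block_at E m1 n1 m2 n2"
    and "E33 \<equiv> block_at E (m1 + m2) (n1 + n2) m3 n3" and "A33 \<equiv> block_at A (m1 + m2) (n1 + n2) m3 n3"
  assumes m: "m = m1 + m2 + m3" and n: "n = n1 + n2 + n3"
    and E: "E \<in> carrier_mat m n" and A: "A \<in> carrier_mat m n" and B: "B \<in> carrier_mat m l"
    and C: "C \<in> carrier_mat p n" and K: "K \<in> carrier_mat r n"
    and zero: "\<And>X. X \<in> {E, A} \<Longrightarrow> block_at X m1 0 m2 n1 = 0\<^sub>m m2 n1 \<and>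
      block_at X (m1 + m2) 0 m3 n1 = 0\<^sub>m m3 n1 \<and> block_at X (m1 + m2) n1 m3 n2 = 0\<^sub>m m3 n2"
    and zeroB: "block_at B m1 0 m2 l = 0\<^sub>m m2 l" "block_at B (m1 + m2) 0 m3 l = 0\<^sub>m m3 l"
    and rank1: "m1 = mrank (E11 @\<^sub>c B1)"
    and sq: "m2 = n2" and inv: "invertible_mat E22"
    and rank3: "\<And>\<mu>::complex. mrank (\<mu> \<cdot>\<^sub>m map_mat complex_of_real E33 - map_mat complex_of_real A33) = n3"
begin

lemma block_carrier:
  "E11 \<in> carrier_mat m1 n1" "A11 \<in> carrier_mat m1 n1" "B1 \<in> carrier_mat m1 l" "C1 \<in> carrier_mat p n1"
  "K1 \<in> carrier_mat r n1" "E22 \<in> carrier_mat n2 n2" "E33 \<in> carrier_mat m3 n3" "A33 \<in> carrier_mat m3 n3"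
  by (simp_all add: E11_def A11_def B1_def C1_def K1_def E22_def E33_def A33_def sq)

text \<open>The triangular form decouples from below: the third component of the product sees only
  the third component of \<open>x\<close>, the second sees only the second once the third vanishes,
  and so on upwards. Components are therefore shown to vanish in the order three, two.\<close>

lemma slice3_mult:
  assumes X: "X \<in> {E, A}" and x: "x \<in> carrier_vec n"
  shows "slice (m1 + m2) m3 (X *\<^sub>v x) = block_at X (m1 + m2) (n1 + n2) m3 n3 *\<^sub>v slice (n1 + n2) n3 x"
proof -
  have Xc: "X \<in> carrier_mat m n" using X E A by blast
  have "block_at X (m1 + m2) (n1 + n2) m3 n3 *\<^sub>v slice (n1 + n2) n3 x \<in> carrier_vec m3"
    using block_at_carrier slice_carrier by (rule mult_mat_vec_carrier)
  then show ?thesis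
    using slice_mult_mat_vec[of X m n1 n2 n3 x "m1 + m2" m3] zero[OF X] Xc x by (simp add: m n)
qed

lemma slice2_mult:
  assumes X: "X \<in> {E, A}" and x: "x \<in> carrier_vec n" and x3: "slice (n1 + n2) n3 x = 0\<^sub>v n3"
  shows "slice m1 m2 (X *\<^sub>v x) = block_at X m1 n1 m2 n2 *\<^sub>v slice n1 n2 x"
proof -
  have Xc: "X \<in> carrier_mat m n" using X E A by blast
  have "block_at X m1 n1 m2 n2 *\<^sub>v slice n1 n2 x \<in> carrier_vec m2"
    using block_at_carrier slice_carrier by (rule mult_mat_vec_carrier)
  moreover have "block_at X m1 (n1 + n2) m2 n3 *\<^sub>v 0\<^sub>v n3 = 0\<^sub>v m2"
    by (intro eq_vecI) (auto simp: block_at_def)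
  ultimately show ?thesis
    using slice_mult_mat_vec[of X m n1 n2 n3 x m1 m2] zero[OF X] Xc x x3 by (simp add: m n)
qed

lemma slice1_mult:
  fixes X :: "real mat"
  assumes X: "X \<in> carrier_mat R n" and k: "k \<le> R" and x: "x \<in> carrier_vec n" 
    and x2: "slice n1 n2 x = 0\<^sub>v n2" and x3: "slice (n1 + n2) n3 x = 0\<^sub>v n3"
  shows "slice 0 k (X *\<^sub>v x) = block_at X 0 0 k n1 *\<^sub>v slice 0 n1 x"
proof -
  have "block_at X 0 0 k n1 *\<^sub>v slice 0 n1 x \<in> carrier_vec k"
    using block_at_carrier slice_carrier by (rule mult_mat_vec_carrier)
  moreover have "block_at X 0 (n1 + n2) k n3 *\<^sub>v 0\<^sub>v n3 = 0\<^sub>v k" "block_at X 0 n1 k n2 *\<^sub>v 0\<^sub>v n2 = 0\<^sub>v k"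
    by (auto intro!: eq_vecI simp: block_at_def)
  ultimately show ?thesis
    using slice_mult_mat_vec[of X R n1 n2 n3 x 0 k] X x x2 x3 k by (simp add: n)
qed

lemma full_slice: "v \<in> carrier_vec k \<Longrightarrow> slice 0 k v = v"
  by (intro eq_vecI) (auto simp: slice_def)

lemma sliceB_mult:
  assumes u: "u \<in> carrier_vec l"
  shows "slice 0 m1 (B *\<^sub>v u) = B1 *\<^sub>v u" "slice m1 m2 (B *\<^sub>v u) = 0\<^sub>v m2" "slice (m1 + m2) m3 (B *\<^sub>v u) = 0\<^sub>v m3"
proof -
  have s: "slice i k (B *\<^sub>v u) = block_at B i 0 k l *\<^sub>v u" if "i + k \<le> m" for i k
    using that u B by (intro eq_vecI) (auto simp: slice_def block_at_def scalar_prod_def)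
  show "slice 0 m1 (B *\<^sub>v u) = B1 *\<^sub>v u" "slice m1 m2 (B *\<^sub>v u) = 0\<^sub>v m2"
    "slice (m1 + m2) m3 (B *\<^sub>v u) = 0\<^sub>v m3"
    using s[of 0 m1] s[of m1 m2] s[of "m1 + m2" m3] zeroB u by (simp_all add: m B1_def)
qed

lemma pad_mult:
  assumes X: "X \<in> {E, A}" and a: "a \<in> carrier_vec n1"
  shows "X *\<^sub>v pad n a = pad m (block_at X 0 0 m1 n1 *\<^sub>v a)"
proof -
  have Xc: "X \<in> carrier_mat m n" using X E A by blast
  have p: "pad n a \<in> carrier_vec n" by simp
  have s: "slice 0 n1 (pad n a) = a" "slice n1 n2 (pad n a) = 0\<^sub>v n2" "slice (n1 + n2) n3 (pad n a) = 0\<^sub>v n3"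
    using slice_pad[OF a] by (simp_all add: n)
  have y: "block_at X 0 0 m1 n1 *\<^sub>v a \<in> carrier_vec m1" using block_at_carrier a by (rule mult_mat_vec_carrier)
  have zs: "block_at X m1 n1 m2 n2 *\<^sub>v 0\<^sub>v n2 = 0\<^sub>v m2" "block_at X (m1 + m2) (n1 + n2) m3 n3 *\<^sub>v 0\<^sub>v n3 = 0\<^sub>v m3"
    by (auto intro!: eq_vecI simp: block_at_def)
  show ?thesis
  proof (rule vec_eq_of_slices[of _ m1 m2 m3])
    show "X *\<^sub>v pad n a \<in> carrier_vec (m1 + m2 + m3)" using mult_mat_vec_carrier[OF Xc p] by (simp add: m)
    show "slice 0 m1 (X *\<^sub>v pad n a) = slice 0 m1 (pad m (block_at X 0 0 m1 n1 *\<^sub>v a))"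
      using slice1_mult[OF Xc _ p s(2,3), of m1] slice_pad(1)[OF y, of m] by (simp add: m s)
    show "slice m1 m2 (X *\<^sub>v pad n a) = slice m1 m2 (pad m (block_at X 0 0 m1 n1 *\<^sub>v a))"
      using slice2_mult[OF X p s(3)] slice_pad(2)[OF y, of m m1 m2] by (simp add: m s zs)
    show "slice (m1 + m2) m3 (X *\<^sub>v pad n a) = slice (m1 + m2) m3 (pad m (block_at X 0 0 m1 n1 *\<^sub>v a))"
      using slice3_mult[OF X p] slice_pad(2)[OF y, of m "m1 + m2" m3] by (simp add: m s zs)
  qed (simp add: m)
qed

text \<open>The rank condition at \<mu> = 0, transferred from complex to real vectors.\<close>

lemma A33_inj:
  assumes "v \<in> carrier_vec n3" "A33 *\<^sub>v v = 0\<^sub>v m3"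
  shows "v = 0\<^sub>v n3"
proof -
  let ?v = "map_vec complex_of_real v" and ?M = "0 \<cdot>\<^sub>m map_mat complex_of_real E33 - map_mat complex_of_real A33"
  have M: "?M \<in> carrier_mat m3 n3" using block_carrier by auto
  have M0: "?M *\<^sub>v ?v = 0\<^sub>v m3"
  proof (rule eq_vecI)
    fix i assume "i < dim_vec (0\<^sub>v m3 :: complex vec)"
    then have i: "i < m3" by simp
    have "(?M *\<^sub>v ?v) $ i = - of_real ((A33 *\<^sub>v v) $ i)"
      using i block_carrier assms(1) by (simp add: scalar_prod_def sum_negf)
    then show "(?M *\<^sub>v ?v) $ i = 0\<^sub>v m3 $ i" using assms(2) i by simp
  qed (use block_carrier(8) in simp)
  have "?v = 0\<^sub>v n3" by (rule mat_kernel_of_full_col_rank[OF M rank3 _ M0]) (use assms(1) in simp)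
  then have "complex_of_real (v $ i) = 0" if "i < n3" for i
    using that assms(1) by (metis index_map_vec(1) index_zero_vec(1) carrier_vecD)
  then show ?thesis using assms(1) by (intro eq_vecI) auto
qed

text \<open>The input does not reach the third block row, so the third component follows the pencil
  alone. The missing input and output are a matrix without columns and one without rows.\<close>

lemma wong_V_slice3:
  "v \<in> wong_V E A B (0\<^sub>m p n) i \<Longrightarrow> slice (n1 + n2) n3 v \<in> wong_V E33 A33 (0\<^sub>m m3 0) (0\<^sub>m 0 n3) i"
proof (induction i arbitrary: v)
  case 0
  then show ?case by (simp add: wong_V_0)
next
  case (Suc i)
  note c = block_carrier(7,8)
  have Z: "0\<^sub>m m3 0 \<in> carrier_mat m3 0" by simp
  obtain w u where v: "v \<in> carrier_vec n" and w: "w \<in> wong_V E A B (0\<^sub>m p n) i" and u: "u \<in> carrier_vec l"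
    and eq: "A *\<^sub>v v = E *\<^sub>v w + B *\<^sub>v u"
    using Suc.prems unfolding wong_V_Suc_iff[OF E A B] by blast
  have wc: "w \<in> carrier_vec n" using lin_closedD(1)[OF lin_closed_wong_V0[OF E A B] w] .
  have "slice (m1 + m2) m3 (A *\<^sub>v v) = slice (m1 + m2) m3 (E *\<^sub>v w) + slice (m1 + m2) m3 (B *\<^sub>v u)"
    unfolding eq by (rule slice_add[of _ _ m]) (use E B wc u in \<open>auto simp: m\<close>)
  then have "A33 *\<^sub>v slice (n1 + n2) n3 v = E33 *\<^sub>v slice (n1 + n2) n3 w + 0\<^sub>v m3"
    using slice3_mult[of A v] slice3_mult[of E w] sliceB_mult(3)[OF u] v wc by (simp add: A33_def E33_def)
  moreover have "0\<^sub>m m3 0 *\<^sub>v 0\<^sub>v 0 = (0\<^sub>v m3 :: real vec)" by simp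
  ultimately have "\<exists>u\<in>carrier_vec 0. A33 *\<^sub>v slice (n1 + n2) n3 v = E33 *\<^sub>v slice (n1 + n2) n3 w + 0\<^sub>m m3 0 *\<^sub>v u"
    by (intro bexI[of _ "0\<^sub>v 0"]) auto
  then show ?case
    unfolding wong_V_Suc_iff[OF c Z] using Suc.IH[OF w] by auto
qed

lemma wong_V_slice3_eq_0:
  assumes "v \<in> wong_V E A B (0\<^sub>m p n) i" "n3 \<le> i"
  shows "slice (n1 + n2) n3 v = 0\<^sub>v n3"
proof -
  note c = block_carrier(7,8)
  have Z: "0\<^sub>m m3 0 \<in> carrier_mat m3 0" by simp
  have "slice (n1 + n2) n3 v \<in> wong_V E33 A33 (0\<^sub>m m3 0) (0\<^sub>m 0 n3) n3"
    using wong_V_slice3[OF assms(1)] wong_V_antimono[OF c Z assms(2)] by blast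
  then show ?thesis by (rule wong_V_eq_0_of_pencil_injective[OF c rank3])
qed

lemma slice2_eq_0:
  assumes "v \<in> carrier_vec n" "slice (n1 + n2) n3 v = 0\<^sub>v n3" "slice m1 m2 (E *\<^sub>v v) = 0\<^sub>v m2"
  shows "slice n1 n2 v = 0\<^sub>v n2"
proof -
  have "E22 *\<^sub>v slice n1 n2 v = E22 *\<^sub>v 0\<^sub>v n2"
  proof -
    have "E22 *\<^sub>v 0\<^sub>v n2 = 0\<^sub>v m2" using block_carrier(6) by (auto simp: sq)
    then show ?thesis using slice2_mult[OF _ assms(1,2), of E] assms(3) by (simp add: E22_def)
  qed
  then show ?thesis
    using invertible_mult_vec_eq_iff[OF block_carrier(6) inv, of "slice n1 n2 v" "0\<^sub>v n2"] by simp
qed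

lemma pad_in_wong_V:
  assumes "a \<in> carrier_vec n1"
  shows "pad n a \<in> wong_V E A B (0\<^sub>m p n) i"
  using assms
proof (induction i arbitrary: a)
  case 0
  then show ?case by (simp add: wong_V_0)
next
  case (Suc i)
  note c = block_carrier(1,3)
  have c2: "E11 @\<^sub>c B1 \<in> carrier_mat m1 (n1 + l)" using c by simp
  have "A11 *\<^sub>v a \<in> carrier_vec m1" using block_carrier(2) Suc.prems by auto
  \<comment> \<open>Full row rank solves \<open>A11 a = E11 b + B1 u\<close> for every
    \<open>a\<close>. The resulting \<open>b\<close> is not under control, so the induction is over
    all \<open>a\<close> at once.\<close>
  then have "A11 *\<^sub>v a \<in> mat_range (E11 @\<^sub>c B1)"
    using mat_range_of_full_row_rank[OF c2 rank1[symmetric]] by simp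
  then obtain w where w: "w \<in> carrier_vec (n1 + l)" "A11 *\<^sub>v a = (E11 @\<^sub>c B1) *\<^sub>v w"
    using c2 by (auto simp: mat_range_def mat_im_def)
  define b u where "b = vec_first w n1" and "u = vec_last w l"
  have bu: "b \<in> carrier_vec n1" "u \<in> carrier_vec l" "w = b @\<^sub>v u"
    using vec_first_last_append[OF w(1)] by (auto simp: b_def u_def)
  have eq: "A11 *\<^sub>v a = E11 *\<^sub>v b + B1 *\<^sub>v u"
    using w(2) append_cols_mult_vec[OF c bu(1,2)] bu(3) by simp
  have s1: "E11 *\<^sub>v b \<in> carrier_vec m1" "A11 *\<^sub>v a \<in> carrier_vec m1" using block_carrier Suc.prems bu by auto
  have Bu: "B *\<^sub>v u \<in> carrier_vec m" using B bu by auto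
  have m1m: "m1 \<le> m" by (simp add: m)
  have "A *\<^sub>v pad n a = pad m (A11 *\<^sub>v a)" using pad_mult[of A a] Suc.prems by (simp add: A11_def)
  also have "\<dots> = pad m (E11 *\<^sub>v b) + B *\<^sub>v u"
  proof (rule vec_eq_of_slices[of _ m1 m2 m3])
    have ps: "slice i k (pad m (E11 *\<^sub>v b) + B *\<^sub>v u) = slice i k (pad m (E11 *\<^sub>v b)) + slice i k (B *\<^sub>v u)"
      if "i + k \<le> m" for i k
      by (rule slice_add[of _ _ m]) (use that Bu in auto)
    show "slice 0 m1 (pad m (A11 *\<^sub>v a)) = slice 0 m1 (pad m (E11 *\<^sub>v b) + B *\<^sub>v u)"
      using ps[of 0 m1] slice_pad(1)[OF s1(1) m1m] slice_pad(1)[OF s1(2) m1m] sliceB_mult(1)[OF bu(2)] eq m1m by simp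
    show "slice m1 m2 (pad m (A11 *\<^sub>v a)) = slice m1 m2 (pad m (E11 *\<^sub>v b) + B *\<^sub>v u)"
      using ps[of m1 m2] slice_pad(2)[OF s1(1) m1m, of m1 m2] slice_pad(2)[OF s1(2) m1m, of m1 m2] sliceB_mult(2)[OF bu(2)]
      by (simp add: m)
    show "slice (m1 + m2) m3 (pad m (A11 *\<^sub>v a)) = slice (m1 + m2) m3 (pad m (E11 *\<^sub>v b) + B *\<^sub>v u)"
      using ps[of "m1 + m2" m3] slice_pad(2)[OF s1(1) m1m, of "m1 + m2" m3] slice_pad(2)[OF s1(2) m1m, of "m1 + m2" m3]
        sliceB_mult(3)[OF bu(2)] by (simp add: m)
  qed (use Bu in \<open>auto simp: m\<close>)
  also have "pad m (E11 *\<^sub>v b) = E *\<^sub>v pad n b" using pad_mult[of E b] bu by (simp add: E11_def)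
  finally have "A *\<^sub>v pad n a = E *\<^sub>v pad n b + B *\<^sub>v u" .
  then show ?case unfolding wong_V_Suc_iff[OF E A B] using Suc.IH[OF bu(1)] bu(2) by auto
qed

text \<open>Follow a chain from \<open>x\<close> down to zero. Third components vanish forwards from
  \<open>x\<close>, by injectivity of \<open>A33\<close>; second components vanish backwards from
  the end, by invertibility of \<open>E22\<close>. What remains is a chain of the first
  subsystem.\<close>

lemma slice_inner_set:
  assumes x: "x \<in> mat_preim A (mat_im E (wong_V E A B (0\<^sub>m p n) (n - 1))) \<inter> wong_W_lim E A (0\<^sub>m m l) C"
  shows "slice n1 n2 x = 0\<^sub>v n2" "slice (n1 + n2) n3 x = 0\<^sub>v n3"
    "slice 0 n1 x \<in> mat_preim A11 (mat_range E11) \<inter> wong_W_lim E11 A11 (0\<^sub>m m1 l') C1"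
proof -
  have xc: "x \<in> carrier_vec n" using x A by (auto simp: mat_preim_def)
  obtain v where v: "v \<in> wong_V E A B (0\<^sub>m p n) (n - 1)" "A *\<^sub>v x = E *\<^sub>v v"
    using x by (auto simp: mat_preim_def mat_im_def)
  have vc: "v \<in> carrier_vec n" using lin_closedD(1)[OF lin_closed_wong_V0[OF E A B] v(1)] .
  have "B *\<^sub>v 0\<^sub>v l = 0\<^sub>v m" using B by auto
  moreover have "E *\<^sub>v v \<in> carrier_vec m" using E vc by auto
  ultimately have "A *\<^sub>v x = E *\<^sub>v v + B *\<^sub>v 0\<^sub>v l" using v(2) by simp
  \<comment> \<open>With zero input \<open>x\<close> moves one step further in the sequence than
    \<open>v\<close>, and the index \<open>Suc (n - 1)\<close> is at least n3.\<close>
  then have "x \<in> wong_V E A B (0\<^sub>m p n) (Suc (n - 1))"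
    unfolding wong_V_Suc_iff[OF E A B] using v(1) xc zero_carrier_vec by blast
  moreover have "n3 \<le> Suc (n - 1)" by (simp add: n)
  ultimately show x3: "slice (n1 + n2) n3 x = 0\<^sub>v n3" using wong_V_slice3_eq_0 by blast
  obtain k where "x \<in> wong_W E A (0\<^sub>m m l) C k" using x by (auto simp: wong_W_lim_def)
  then obtain w where w: "wong_chain E A C 1 k w" "w 0 = x" using wong_W_iff_chain[OF E A C, of 1 x l k] by auto
  have wc: "w i \<in> carrier_vec n" if "i \<le> k" for i using w(1) E that by (auto simp: wong_chain_def)
  have wk: "w k = 0\<^sub>v n" using w(1) E by (auto simp: wong_chain_def)
  have wE: "E *\<^sub>v w i = A *\<^sub>v w (Suc i)" "C *\<^sub>v w i = 0\<^sub>v p" if "i < k" for i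
  proof -
    have "E *\<^sub>v w i = 1 \<cdot>\<^sub>v (A *\<^sub>v w (Suc i))" using w(1) that unfolding wong_chain_def by blast
    then show "E *\<^sub>v w i = A *\<^sub>v w (Suc i)" by simp
    show "C *\<^sub>v w i = 0\<^sub>v p" using w(1) that C unfolding wong_chain_def by (metis carrier_matD(1))
  qed
  have w3: "slice (n1 + n2) n3 (w i) = 0\<^sub>v n3" if "i \<le> k" for i
    using that
  proof (induction i)
    case 0
    then show ?case using w(2) x3 by simp
  next
    case (Suc i)
    have E0: "E33 *\<^sub>v 0\<^sub>v n3 = 0\<^sub>v m3" using block_carrier(7) by auto
    have "A33 *\<^sub>v slice (n1 + n2) n3 (w (Suc i)) = slice (m1 + m2) m3 (E *\<^sub>v w i)"
      using slice3_mult[of A "w (Suc i)"] wc[OF Suc.prems] wE(1)[of i] Suc.prems by (simp add: A33_def)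
    also have "\<dots> = 0\<^sub>v m3" using slice3_mult[of E "w i"] wc[of i] Suc E0 by (simp add: E33_def)
    finally show ?case by (intro A33_inj) auto
  qed
  have w2: "slice n1 n2 (w (k - d)) = 0\<^sub>v n2" if "d \<le> k" for d
    using that
  proof (induction d)
    case 0
    then show ?case by (simp add: wk n)
  next
    case (Suc d)
    let ?i = "k - Suc d"
    have i: "?i < k" "Suc ?i = k - d" using Suc.prems by auto
    have i': "?i \<le> k" "k - d \<le> k" by auto
    show ?case
    proof (rule slice2_eq_0[OF wc[OF i'(1)] w3[OF i'(1)]])
      have "block_at A m1 n1 m2 n2 *\<^sub>v 0\<^sub>v n2 = 0\<^sub>v m2" by (auto intro!: eq_vecI simp: block_at_def)
      moreover have "slice m1 m2 (A *\<^sub>v w (k - d)) = block_at A m1 n1 m2 n2 *\<^sub>v slice n1 n2 (w (k - d))"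
        by (rule slice2_mult[OF _ wc[OF i'(2)] w3[OF i'(2)]]) simp
      moreover have "slice n1 n2 (w (k - d)) = 0\<^sub>v n2" using Suc by simp
      ultimately show "slice m1 m2 (E *\<^sub>v w ?i) = 0\<^sub>v m2"
        unfolding wE(1)[OF i(1)] i(2) by (simp only:)
    qed
  qed
  have w2': "slice n1 n2 (w i) = 0\<^sub>v n2" if "i \<le> k" for i using w2[of "k - i"] that by simp
  show "slice n1 n2 x = 0\<^sub>v n2" using w2'[of 0] w(2) by simp
  have m1m: "m1 \<le> m" by (simp add: m)
  have "wong_chain E11 A11 C1 1 k (\<lambda>i. slice 0 n1 (w i))"
    unfolding wong_chain_def
  proof (intro conjI allI impI)
    show "slice 0 n1 (w k) = 0\<^sub>v (dim_col E11)" using block_carrier(1) by (simp add: wk n)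
    fix i assume i: "i < k"
    then have i': "i \<le> k" "Suc i \<le> k" by auto
    have "C1 *\<^sub>v slice 0 n1 (w i) = slice 0 p (C *\<^sub>v w i)"
      using slice1_mult[OF C order_refl wc[OF i'(1)] w2'[OF i'(1)] w3[OF i'(1)]] by (simp add: C1_def)
    then show "C1 *\<^sub>v slice 0 n1 (w i) = 0\<^sub>v (dim_row C1)" using wE(2)[OF i] block_carrier(4) by simp
    have "E11 *\<^sub>v slice 0 n1 (w i) = A11 *\<^sub>v slice 0 n1 (w (Suc i))"
      using slice1_mult[OF E m1m wc[OF i'(1)] w2'[OF i'(1)] w3[OF i'(1)]]
        slice1_mult[OF A m1m wc[OF i'(2)] w2'[OF i'(2)] w3[OF i'(2)]] wE(1)[OF i]
      by (simp add: E11_def A11_def)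
    then show "E11 *\<^sub>v slice 0 n1 (w i) = 1 \<cdot>\<^sub>v (A11 *\<^sub>v slice 0 n1 (w (Suc i)))" by simp
  qed (use block_carrier(1) in auto)
  then have "slice 0 n1 x \<in> wong_W E11 A11 (0\<^sub>m m1 l') C1 k"
    using wong_W_iff_chain[OF block_carrier(1,2,4), of 1 "slice 0 n1 x" l' k] w(2) by auto
  then have W: "slice 0 n1 x \<in> wong_W_lim E11 A11 (0\<^sub>m m1 l') C1" by (auto simp: wong_W_lim_def)
  \<comment> \<open>The vector \<open>v\<close> is known only to lie in \<open>V^(n-1)\<close>, so
    its third component vanishes if n3 <= n - 1. For n3 = n the first component has dimension 0 and
    both sides are trivial.\<close>
  have "A11 *\<^sub>v slice 0 n1 x \<in> mat_range E11"
  proof (cases "n3 = n")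
    case True
    then have n1: "n1 = 0" by (simp add: n)
    have "A11 *\<^sub>v slice 0 n1 x = E11 *\<^sub>v 0\<^sub>v n1" using block_carrier(1,2) n1
      by (intro eq_vecI) (auto simp: scalar_prod_def slice_def)
    then show ?thesis using block_carrier(1) by (auto simp: mat_range_def mat_im_def)
  next
    case False
    then have "n3 \<le> n - 1" using n by linarith
    then have v3: "slice (n1 + n2) n3 v = 0\<^sub>v n3" using wong_V_slice3_eq_0[OF v(1)] by blast
    have v2: "slice n1 n2 v = 0\<^sub>v n2"
    proof (rule slice2_eq_0[OF vc v3])
      have "block_at A m1 n1 m2 n2 *\<^sub>v 0\<^sub>v n2 = 0\<^sub>v m2" by (auto intro!: eq_vecI simp: block_at_def)
      moreover have "slice m1 m2 (A *\<^sub>v x) = block_at A m1 n1 m2 n2 *\<^sub>v slice n1 n2 x"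
        by (rule slice2_mult[OF _ xc x3]) simp
      ultimately show "slice m1 m2 (E *\<^sub>v v) = 0\<^sub>v m2"
        using \<open>slice n1 n2 x = 0\<^sub>v n2\<close> v(2) by (simp only:)
    qed
    have "A11 *\<^sub>v slice 0 n1 x = E11 *\<^sub>v slice 0 n1 v"
      using slice1_mult[OF E m1m vc v2 v3] slice1_mult[OF A m1m xc \<open>slice n1 n2 x = 0\<^sub>v n2\<close> x3] v(2)
      by (simp add: E11_def A11_def)
    then show ?thesis using block_carrier(1) by (auto simp: mat_range_def mat_im_def)
  qed
  then show "slice 0 n1 x \<in> mat_preim A11 (mat_range E11) \<inter> wong_W_lim E11 A11 (0\<^sub>m m1 l') C1"
    using W block_carrier(2) by (simp add: mat_preim_def)
qed

text \<open>Padding with zeros commutes with \<open>E\<close> and \<open>A\<close> by the triangular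
  form, so a chain of the first subsystem and a relation \<open>A11 a = E11 b\<close> lift to the
  whole system, and \<open>pad n b\<close> lies in every \<open>V^i\<close>.\<close>

lemma pad_inner_set:
  assumes a: "a \<in> mat_preim A11 (mat_range E11) \<inter> wong_W_lim E11 A11 (0\<^sub>m m1 l') C1"
  shows "pad n a \<in> mat_preim A (mat_im E (wong_V E A B (0\<^sub>m p n) (n - 1))) \<inter> wong_W_lim E A (0\<^sub>m m l) C"
proof -
  have ac: "a \<in> carrier_vec n1" using a block_carrier(2) by (auto simp: mat_preim_def)
  obtain b where b: "b \<in> carrier_vec n1" "A11 *\<^sub>v a = E11 *\<^sub>v b"
    using a block_carrier(1) by (auto simp: mat_preim_def mat_range_def mat_im_def)
  have "A *\<^sub>v pad n a = E *\<^sub>v pad n b"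
    using pad_mult[of A a] pad_mult[of E b] ac b by (simp add: A11_def E11_def)
  then have 1: "pad n a \<in> mat_preim A (mat_im E (wong_V E A B (0\<^sub>m p n) (n - 1)))"
    using pad_in_wong_V[OF b(1)] A by (auto simp: mat_preim_def mat_im_def)
  obtain k where "a \<in> wong_W E11 A11 (0\<^sub>m m1 l') C1 k" using a by (auto simp: wong_W_lim_def)
  then obtain w where w: "wong_chain E11 A11 C1 1 k w" "w 0 = a"
    using wong_W_iff_chain[OF block_carrier(1,2,4), of 1 a l' k] by auto
  have wc: "w i \<in> carrier_vec n1" if "i \<le> k" for i
    using w(1) block_carrier(1) that by (auto simp: wong_chain_def)
  have "wong_chain E A C 1 k (\<lambda>i. pad n (w i))"
    unfolding wong_chain_def
  proof (intro conjI allI impI)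
    have "w k = 0\<^sub>v n1" using w(1) block_carrier(1) by (auto simp: wong_chain_def)
    then show "pad n (w k) = 0\<^sub>v (dim_col E)" using E by (auto simp: pad_def)
    fix i assume i: "i < k"
    then have i': "i \<le> k" "Suc i \<le> k" by auto
    have "C1 *\<^sub>v w i = 0\<^sub>v p" using w(1) i block_carrier(4) unfolding wong_chain_def by (metis carrier_matD(1))
    moreover have s: "slice 0 n1 (pad n (w i)) = w i" "slice n1 n2 (pad n (w i)) = 0\<^sub>v n2" "slice (n1 + n2) n3 (pad n (w i)) = 0\<^sub>v n3"
      using slice_pad[OF wc[OF i'(1)]] by (simp_all add: n)
    moreover have "C *\<^sub>v pad n (w i) \<in> carrier_vec p" using C by (intro mult_mat_vec_carrier) auto
    ultimately show "C *\<^sub>v pad n (w i) = 0\<^sub>v (dim_row C)"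
      using slice1_mult[OF C order_refl _ s(2,3)] C full_slice[of "C *\<^sub>v pad n (w i)" p]
      by (simp add: C1_def)
    have "E11 *\<^sub>v w i = 1 \<cdot>\<^sub>v (A11 *\<^sub>v w (Suc i))" using w(1) i unfolding wong_chain_def by blast
    then show "E *\<^sub>v pad n (w i) = 1 \<cdot>\<^sub>v (A *\<^sub>v pad n (w (Suc i)))"
      using pad_mult[of E "w i"] pad_mult[of A "w (Suc i)"] wc[OF i'(1)] wc[OF i'(2)]
      by (simp add: A11_def E11_def)
  qed (use E in auto)
  then have "pad n a \<in> wong_W E A (0\<^sub>m m l) C k"
    using wong_W_iff_chain[OF E A C, of 1 "pad n a" l k] w(2) by auto
  then show ?thesis using 1 by (auto simp: wong_W_lim_def)
qed

lemma observability_subset_block: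
  "mat_preim A (mat_im E (wong_V E A B (0\<^sub>m p n) (n - 1))) \<inter> wong_W_lim E A (0\<^sub>m m l) C \<subseteq> mat_kernel K
    \<longleftrightarrow> mat_preim A11 (mat_range E11) \<inter> wong_W_lim E11 A11 (0\<^sub>m m1 l') C1 \<subseteq> mat_kernel K1"
    (is "?I \<subseteq> _ \<longleftrightarrow> ?J \<subseteq> _")
proof -
  have Kx: "x \<in> mat_kernel K \<longleftrightarrow> slice 0 n1 x \<in> mat_kernel K1"
    if x: "x \<in> carrier_vec n" "slice n1 n2 x = 0\<^sub>v n2" "slice (n1 + n2) n3 x = 0\<^sub>v n3" for x
  proof -
    have "K *\<^sub>v x \<in> carrier_vec r" using K x by auto
    then have "K *\<^sub>v x = K1 *\<^sub>v slice 0 n1 x"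
      using slice1_mult[OF K order_refl x] full_slice[of "K *\<^sub>v x" r] by (simp add: K1_def)
    then show ?thesis
      unfolding mat_kernel[OF K] mat_kernel[OF block_carrier(5)] using x(1) by simp
  qed
  show ?thesis
  proof
    assume sub: "?I \<subseteq> mat_kernel K"
    show "?J \<subseteq> mat_kernel K1"
    proof
      fix a assume a: "a \<in> ?J"
      then have ac: "a \<in> carrier_vec n1" using block_carrier(2) by (auto simp: mat_preim_def)
      have "pad n a \<in> mat_kernel K" using pad_inner_set[OF a] sub by blast
      then show "a \<in> mat_kernel K1" using Kx[of "pad n a"] slice_pad[OF ac] by (simp add: n)
    qed
  next
    assume sub: "?J \<subseteq> mat_kernel K1"
    show "?I \<subseteq> mat_kernel K"
    proof
      fix x assume x: "x \<in> ?I"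
      then have "x \<in> carrier_vec n" using A by (auto simp: mat_preim_def)
      then show "x \<in> mat_kernel K" using Kx slice_inner_set[OF x] sub by blast
    qed
  qed
qed

end

section \<open>Smooth and piecewise smooth functions\<close>

text \<open>Smoothness is the largest property that implies differentiability and passes to the
  derivative. Membership in a class closed under differentiation is thus a proof of smoothness that
  avoids formulas for higher derivatives.\<close>

lemma smooth_fun_coinduct:
  assumes "P f" and step: "\<And>g. P g \<Longrightarrow> (\<forall>s. g differentiable at s) \<and> P (deriv g)"
  shows "smooth_fun f"
proof -
  have "P ((deriv ^^ k) f)" for k by (induction k) (use assms in auto)
  then show ?thesis using step unfolding smooth_fun_def by blast
qed

lemma smooth_fun_deriv:
  assumes "smooth_fun f" shows "smooth_fun (deriv f)"
  using assms unfolding smooth_fun_def by (metis comp_apply funpow_Suc_right)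

lemma smooth_fun_DERIV:
  assumes "smooth_fun f" shows "(f has_real_derivative deriv f s) (at s)"
  using assms unfolding smooth_fun_def
  by (metis DERIV_deriv_iff_real_differentiable funpow_0)

lemma smooth_fun_isCont: "smooth_fun f \<Longrightarrow> isCont f s"
  using smooth_fun_DERIV DERIV_isCont by blast

lemma smooth_fun_continuous_on: "smooth_fun f \<Longrightarrow> continuous_on A f"
  using smooth_fun_isCont continuous_at_imp_continuous_on by blast

inductive smooth_alg :: "(real \<Rightarrow> real) \<Rightarrow> bool" where
  base: "smooth_fun f \<Longrightarrow> smooth_alg f"
| const: "smooth_alg (\<lambda>s. c)"
| ident: "smooth_alg (\<lambda>s. s)"
| add: "smooth_alg f \<Longrightarrow> smooth_alg g \<Longrightarrow> smooth_alg (\<lambda>s. f s + g s)"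
| mult: "smooth_alg f \<Longrightarrow> smooth_alg g \<Longrightarrow> smooth_alg (\<lambda>s. f s * g s)"
| comp: "smooth_alg f \<Longrightarrow> smooth_alg (\<lambda>s. f (a * s + b))"

lemma smooth_alg_derivative:
  "smooth_alg f \<Longrightarrow> \<exists>f'. smooth_alg f' \<and> (\<forall>s. (f has_real_derivative f' s) (at s))"
proof (induction rule: smooth_alg.induct)
  case (base f)
  then show ?case using smooth_fun_DERIV smooth_fun_deriv smooth_alg.base by blast
next
  case (const c)
  then show ?case using smooth_alg.const[of 0] by (intro exI[of _ "\<lambda>s. 0"]) auto
next
  case ident
  then show ?case using smooth_alg.const[of 1] by (intro exI[of _ "\<lambda>s. 1"]) auto
next
  case (add f g)
  then obtain f' g' where "smooth_alg f'" "\<And>s. (f has_real_derivative f' s) (at s)"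
    "smooth_alg g'" "\<And>s. (g has_real_derivative g' s) (at s)" by blast
  then show ?case using smooth_alg.add[of f' g'] 
    by (intro exI[of _ "\<lambda>s. f' s + g' s"]) (auto intro!: derivative_eq_intros)
next
  case (mult f g)
  then obtain f' g' where d: "smooth_alg f'" "\<And>s. (f has_real_derivative f' s) (at s)"
    "smooth_alg g'" "\<And>s. (g has_real_derivative g' s) (at s)" by blast
  have "smooth_alg (\<lambda>s. f' s * g s + f s * g' s)"
    by (rule smooth_alg.add[OF smooth_alg.mult[OF d(1) mult.hyps(2)] smooth_alg.mult[OF mult.hyps(1) d(3)]])
  then show ?case using d
    by (intro exI[of _ "\<lambda>s. f' s * g s + f s * g' s"]) (auto intro!: derivative_eq_intros)
next
  case (comp f a b)
  then obtain f' where d: "smooth_alg f'" "\<And>s. (f has_real_derivative f' s) (at s)" by blast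
  have "smooth_alg (\<lambda>s. a * f' (a * s + b))"
    by (rule smooth_alg.mult[OF smooth_alg.const smooth_alg.comp[OF d(1)]])
  moreover have "((\<lambda>s. f (a * s + b)) has_real_derivative a * f' (a * s + b)) (at s)" for s
  proof -
    have "((\<lambda>s. a * s + b) has_real_derivative a) (at s)" by (auto intro!: derivative_eq_intros)
    then show ?thesis
      using DERIV_chain2[of f "f' (a * s + b)" "\<lambda>s. a * s + b" s a UNIV] d(2) by (simp only: mult.commute)
  qed
  ultimately show ?case by (intro exI[of _ "\<lambda>s. a * f' (a * s + b)"]) auto
qed

lemma smooth_alg_imp_smooth_fun:
  assumes "smooth_alg f" shows "smooth_fun f"
proof (rule smooth_fun_coinduct[of smooth_alg, OF assms])
  fix g assume "smooth_alg g"
  then obtain g' where g': "smooth_alg g'" "\<And>s. (g has_real_derivative g' s) (at s)"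
    using smooth_alg_derivative by blast
  then have "deriv g = g'" using DERIV_imp_deriv by blast
  then show "(\<forall>s. g differentiable at s) \<and> smooth_alg (deriv g)"
    using g' real_differentiable_def by blast
qed

lemma smooth_fun_const: "smooth_fun (\<lambda>s. c)"
  by (rule smooth_alg_imp_smooth_fun[OF smooth_alg.const])

lemma smooth_fun_ident: "smooth_fun (\<lambda>s. s)"
  by (rule smooth_alg_imp_smooth_fun[OF smooth_alg.ident])

lemma smooth_fun_add: "smooth_fun f \<Longrightarrow> smooth_fun g \<Longrightarrow> smooth_fun (\<lambda>s. f s + g s)"
  by (rule smooth_alg_imp_smooth_fun[OF smooth_alg.add[OF smooth_alg.base smooth_alg.base]])

lemma smooth_fun_mult: "smooth_fun f \<Longrightarrow> smooth_fun g \<Longrightarrow> smooth_fun (\<lambda>s. f s * g s)"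
  by (rule smooth_alg_imp_smooth_fun[OF smooth_alg.mult[OF smooth_alg.base smooth_alg.base]])

lemma smooth_fun_affine: "smooth_fun f \<Longrightarrow> smooth_fun (\<lambda>s. f (a * s + b))"
  by (rule smooth_alg_imp_smooth_fun[OF smooth_alg.comp[OF smooth_alg.base]])

lemma smooth_fun_power: "smooth_fun f \<Longrightarrow> smooth_fun (\<lambda>s. f s ^ k)"
  by (induction k) (auto intro: smooth_fun_const smooth_fun_mult)

lemma smooth_fun_sum:
  "(\<And>i. i \<in> I \<Longrightarrow> smooth_fun (f i)) \<Longrightarrow> smooth_fun (\<lambda>s. \<Sum>i\<in>I. f i s)"
  by (induction I rule: infinite_finite_induct) (auto intro: smooth_fun_const smooth_fun_add)

section \<open>Bump functions\<close>

definition flat :: "real poly \<Rightarrow> real \<Rightarrow> real" where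
  "flat P x = (if x > 0 then poly P (1 / x) * exp (- (1 / x)) else 0)"

lemma poly_div_exp_tendsto_0:
  "((\<lambda>y. poly P y * exp (- y)) \<longlongrightarrow> (0::real)) at_top"
proof -
  have "((\<lambda>y. \<Sum>i\<le>Polynomial.degree P. coeff P i * (y ^ i / exp y)) \<longlongrightarrow> (\<Sum>i\<le>Polynomial.degree P. coeff P i * 0)) at_top"
    by (intro tendsto_sum tendsto_mult tendsto_const tendsto_power_div_exp_0)
  then show ?thesis
    by (simp add: poly_altdef exp_minus divide_inverse sum_distrib_right mult.assoc)
qed

lemma flat_tendsto_0: "((\<lambda>x. poly P (1 / x) * exp (- (1 / x))) \<longlongrightarrow> 0) (at_right (0::real))"
  using filterlim_compose[OF poly_div_exp_tendsto_0[of P] filterlim_inverse_at_top_right]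
  by (simp add: inverse_eq_divide)

text \<open>With y = 1/x, the derivative of \<open>P(y) exp(-y)\<close> with respect to x is
  \<open>(P - P')(y) y^2 exp(-y)\<close>, again of the same form. The polynomial factor is carried
  along for this closure.\<close>

lemma flat_has_derivative:
  "(flat P has_real_derivative flat ((P - pderiv P) * [:0, 0, 1:]) x) (at x)"
proof -
  consider "x > 0" | "x < 0" | "x = 0" by linarith
  then show ?thesis
  proof cases
    case 1
    have "((\<lambda>x. poly P (1 / x) * exp (- (1 / x))) has_real_derivative
        flat ((P - pderiv P) * [:0, 0, 1:]) x) (at x)"
      using 1 by (auto intro!: derivative_eq_intros DERIV_chain2[OF poly_DERIV]
          simp: flat_def field_simps power2_eq_square)
    then show ?thesis
      by (rule has_field_derivative_transform_within_open[where S = "{0<..}"]) (use 1 in \<open>auto simp: flat_def\<close>)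
  next
    case 2
    have "((\<lambda>x. 0) has_real_derivative flat ((P - pderiv P) * [:0, 0, 1:]) x) (at x)"
      using 2 by (simp add: flat_def)
    then show ?thesis
      by (rule has_field_derivative_transform_within_open[where S = "{..<0}"]) (use 2 in \<open>auto simp: flat_def\<close>)
  next
    case 3
    \<comment> \<open>At 0 the right difference quotient is an expression of the same kind with one
      more power of 1/h, hence tends to 0.\<close>
    have "((\<lambda>h. flat P h / h) \<longlongrightarrow> 0) (at_right 0)"
    proof (rule Lim_transform_eventually[OF flat_tendsto_0[of "P * [:0, 1:]"]])
      show "\<forall>\<^sub>F h in at_right 0. poly (P * [:0, 1:]) (1 / h) * exp (- (1 / h)) = flat P h / h"
        using eventually_at_right_less[of 0] by eventually_elim (simp add: flat_def)
    qed
    moreover have "((\<lambda>h. flat P h / h) \<longlongrightarrow> 0) (at_left 0)"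
    proof (rule Lim_transform_eventually[OF tendsto_const])
      show "\<forall>\<^sub>F h in at_left 0. 0 = flat P h / h"
        using eventually_at_left[of "-1" "0::real"] by (auto simp: flat_def intro!: exI[of _ "-1"])
    qed
    ultimately have "((\<lambda>h. flat P h / h) \<longlongrightarrow> 0) (at 0)" by (simp add: filterlim_at_split)
    then show ?thesis unfolding DERIV_def 3 by (simp add: flat_def)
  qed
qed

lemma smooth_fun_flat: "smooth_fun (flat P)"
proof (rule smooth_fun_coinduct[of "\<lambda>f. \<exists>P. f = flat P"])
  fix g assume "\<exists>P. g = flat P"
  then obtain P where P: "g = flat P" by blast
  then have "deriv g = flat ((P - pderiv P) * [:0, 0, 1:])"
    using flat_has_derivative DERIV_imp_deriv by blast
  then show "(\<forall>s. g differentiable at s) \<and> (\<exists>P. deriv g = flat P)"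
    using P flat_has_derivative real_differentiable_def by blast
qed blast

text \<open>The product of a flat function and its mirror image is positive exactly on the interval
  of radius \<open>e\<close> around \<open>t\<close>. The factor exp 2 normalizes the centre, where
  both factors are exp(-1). The bound exp 2 is independent of \<open>e\<close>, as the estimate in
  \<open>pw_distr_zero_impulse\<close> requires.\<close>

lemma exists_bump:
  fixes t e :: real
  assumes e: "e > 0"
  shows "\<exists>\<psi>. smooth_fun \<psi> \<and> \<psi> t = 1 \<and> (\<forall>s. 0 \<le> \<psi> s \<and> \<psi> s \<le> exp 2) \<and>
    (\<forall>s. \<bar>s - t\<bar> \<ge> e \<longrightarrow> \<psi> s = 0) \<and> (\<forall>s. \<bar>s - t\<bar> < e \<longrightarrow> \<psi> s > 0)"
proof -
  define \<psi> where "\<psi> = (\<lambda>s. exp 2 * (flat 1 ((1 / e) * s + (1 - t / e)) * flat 1 ((- (1 / e)) * s + (1 + t / e))))"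
  have eq: "\<psi> s = exp 2 * (flat 1 (1 + (s - t) / e) * flat 1 (1 - (s - t) / e))" for s
    unfolding \<psi>_def using e by (simp add: diff_divide_distrib algebra_simps)
  have flat01: "0 \<le> flat 1 x" "flat 1 x \<le> 1" for x by (auto simp: flat_def)
  have "smooth_fun \<psi>" unfolding \<psi>_def
    by (rule smooth_fun_mult[OF smooth_fun_const smooth_fun_mult[OF smooth_fun_affine[OF smooth_fun_flat] smooth_fun_affine[OF smooth_fun_flat]]])
  moreover have "\<psi> t = 1"
  proof -
    have "exp 2 * (exp (- 1) * exp (- 1)) = (1::real)" unfolding exp_add[symmetric] by simp
    then show ?thesis by (simp add: eq flat_def)
  qed
  moreover have "0 \<le> \<psi> s" for s unfolding eq using flat01 by simp
  moreover have "\<psi> s \<le> exp 2" for s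
    unfolding eq using mult_le_one[OF flat01(2) flat01(1) flat01(2)] by simp
  moreover have "\<psi> s = 0" if "\<bar>s - t\<bar> \<ge> e" for s
  proof -
    have "1 + (s - t) / e \<le> 0 \<or> 1 - (s - t) / e \<le> 0"
      using that e by (auto simp: abs_if field_simps split: if_splits)
    then show ?thesis unfolding eq by (auto simp: flat_def)
  qed
  moreover have "\<psi> s > 0" if "\<bar>s - t\<bar> < e" for s
  proof -
    have "1 + (s - t) / e > 0 \<and> 1 - (s - t) / e > 0"
      using that e by (auto simp: abs_if field_simps split: if_splits)
    then show ?thesis unfolding eq by (auto simp: flat_def)
  qed
  ultimately show ?thesis by blast
qed

lemma funpow_deriv_eq_0_on_open:
  fixes \<phi> :: "real \<Rightarrow> real"
  assumes "open U" and "\<And>s. s \<in> U \<Longrightarrow> \<phi> s = 0" and "s \<in> U"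
  shows "(deriv ^^ j) \<phi> s = 0"
  using assms(3)
proof (induction j arbitrary: s)
  case (Suc j)
  have "((deriv ^^ j) \<phi> has_real_derivative 0) (at s)"
    by (rule has_field_derivative_transform_within_open[OF _ assms(1) Suc.prems, of "\<lambda>s. 0"])
      (use Suc.IH in auto)
  then show ?case by (simp add: DERIV_imp_deriv)
qed (use assms in simp)

section \<open>Test functions and Dirac impulses\<close>

lemma test_funE:
  assumes "test_fun \<phi>"
  obtains a b where "a < b" "{s. \<phi> s \<noteq> 0} \<subseteq> {a<..<b}"
proof -
  obtain a b where ab: "\<And>s. s \<notin> {a..b} \<Longrightarrow> \<phi> s = 0" using assms by (auto simp: test_fun_def)
  \<comment> \<open>Widening the interval by 1 on each side puts the support into an open interval,
    so that boundary terms vanish at its ends.\<close>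
  have "s \<in> {a - 1<..<max a b + 1}" if "\<phi> s \<noteq> 0" for s using that ab[of s] by fastforce
  then have "{s. \<phi> s \<noteq> 0} \<subseteq> {a - 1<..<max a b + 1}" by blast
  then show thesis by (intro that[of "a - 1" "max a b + 1"]) auto
qed

lemma test_fun_smooth: "test_fun \<phi> \<Longrightarrow> smooth_fun \<phi>" by (simp add: test_fun_def)

lemma deriv_eq_0_outside:
  fixes \<phi> :: "real \<Rightarrow> real"
  assumes z: "{s. \<phi> s \<noteq> 0} \<subseteq> {a<..<b}" and s: "s \<notin> {a..b}"
  shows "deriv \<phi> s = 0"
proof -
  have "open (- {a..b})" by auto
  moreover have "\<phi> s = 0" if "s \<in> - {a..b}" for s using that z by force
  ultimately show ?thesis using funpow_deriv_eq_0_on_open[of "- {a..b}" \<phi> s 1] s by simp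
qed

lemma test_fun_deriv:
  assumes "test_fun \<phi>" shows "test_fun (deriv \<phi>)"
proof -
  obtain a b where ab: "a < b" "{s. \<phi> s \<noteq> 0} \<subseteq> {a<..<b}" using test_funE[OF assms] by blast
  then show ?thesis unfolding test_fun_def
    using deriv_eq_0_outside[OF ab(2)] smooth_fun_deriv[OF test_fun_smooth[OF assms]]
    by blast
qed

lemma dirac_comb_eq_sum:
  assumes "Polynomial.degree c \<le> N"
  shows "dirac_comb t c \<phi> = (\<Sum>j\<le>N. coeff c j * ((-1) ^ j * (deriv ^^ j) \<phi> t))"
  unfolding dirac_comb_def using assms by (intro sum.mono_neutral_left) (auto simp: coeff_eq_0)

lemma dirac_comb_0 [simp]: "dirac_comb t 0 \<phi> = 0"
  by (simp add: dirac_comb_def)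

lemma dirac_comb_add: "dirac_comb t (c + d) \<phi> = dirac_comb t c \<phi> + dirac_comb t d \<phi>"
proof -
  define N where "N = max (Polynomial.degree c) (Polynomial.degree d)"
  have N: "Polynomial.degree c \<le> N" "Polynomial.degree d \<le> N" "Polynomial.degree (c + d) \<le> N"
    unfolding N_def using degree_add_le_max[of c d] by auto
  show ?thesis
    by (simp only: dirac_comb_eq_sum[OF N(1)] dirac_comb_eq_sum[OF N(2)] dirac_comb_eq_sum[OF N(3)]
        coeff_add distrib_right sum.distrib)
qed

lemma dirac_comb_smult: "dirac_comb t (Polynomial.smult a c) \<phi> = a * dirac_comb t c \<phi>"
  using dirac_comb_eq_sum[of "Polynomial.smult a c" "Polynomial.degree c" t \<phi>]
  by (simp add: dirac_comb_def sum_distrib_left mult.assoc degree_smult_le)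

text \<open>The derivative of a distribution pairs as \<open>- U (deriv \<phi>)\<close>, so moving
  all coefficients up by one place differentiates the impulse; the new coefficient \<open>a\<close>
  is that of a plain Dirac impulse.\<close>

lemma dirac_comb_pCons: "dirac_comb t (pCons a c) \<phi> = a * \<phi> t - dirac_comb t c (deriv \<phi>)"
proof -
  have "dirac_comb t (pCons a c) \<phi>
      = (\<Sum>j\<le>Suc (Polynomial.degree c). coeff (pCons a c) j * ((-1) ^ j * (deriv ^^ j) \<phi> t))"
    by (rule dirac_comb_eq_sum) (rule degree_pCons_le)
  also have "\<dots> = a * \<phi> t - dirac_comb t c (deriv \<phi>)"
    unfolding sum.atMost_Suc_shift
    by (simp add: dirac_comb_def sum_negf[symmetric] funpow_Suc_right del: funpow.simps)
  finally show ?thesis .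
qed

lemma dirac_comb_eq_0_outside:
  assumes "t \<notin> closure {s. \<phi> s \<noteq> 0}"
  shows "dirac_comb t c \<phi> = 0"
proof -
  have "(deriv ^^ j) \<phi> t = 0" for j
    by (rule funpow_deriv_eq_0_on_open[of "- closure {s. \<phi> s \<noteq> 0}"])
      (use assms closure_subset[of "{s. \<phi> s \<noteq> 0}"] in auto)
  then show ?thesis by (simp add: dirac_comb_def)
qed

text \<open>The index set in \<open>pw_distr\<close> depends on \<open>D\<close> and \<phi>.
  Enlarging it by zero terms to a free finite \<open>T\<close> allows the sums of several
  distributions to be combined.\<close>

lemma pw_distr_eq_sum:
  assumes z: "{s. \<phi> s \<noteq> 0} \<subseteq> {a<..<b}" and T: "finite T" "{t. D t \<noteq> 0} \<inter> {a..b} \<subseteq> T"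
  shows "pw_distr f D \<phi> = (LINT s|lborel. f s * \<phi> s) + (\<Sum>t\<in>T. dirac_comb t (D t) \<phi>)"
proof -
  have "closure {s. \<phi> s \<noteq> 0} \<subseteq> {a..b}"
  proof (rule closure_minimal)
    show "{s. \<phi> s \<noteq> 0} \<subseteq> {a..b}" using z by force
  qed simp
  then have "(\<Sum>t | D t \<noteq> 0 \<and> t \<in> closure {s. \<phi> s \<noteq> 0}. dirac_comb t (D t) \<phi>) = (\<Sum>t\<in>T. dirac_comb t (D t) \<phi>)"
    using T dirac_comb_eq_0_outside[of _ \<phi>] by (intro sum.mono_neutral_left) auto
  then show ?thesis by (simp add: pw_distr_def)
qed

section \<open>Locally finite sets of break points\<close>

lemma locally_finite_set_Un: "locally_finite_set S \<Longrightarrow> locally_finite_set T \<Longrightarrow> locally_finite_set (S \<union> T)"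
  by (auto simp: locally_finite_set_def Int_Un_distrib2)

lemma locally_finite_set_subset: "locally_finite_set T \<Longrightarrow> S \<subseteq> T \<Longrightarrow> locally_finite_set S"
  unfolding locally_finite_set_def by (meson Int_mono finite_subset order_refl)

lemma locally_finite_set_finite: "finite S \<Longrightarrow> locally_finite_set S"
  by (simp add: locally_finite_set_def)

lemma locally_finite_set_UN:
  "finite I \<Longrightarrow> (\<And>i. i \<in> I \<Longrightarrow> locally_finite_set (S i)) \<Longrightarrow> locally_finite_set (\<Union>i\<in>I. S i)"
  by (induction rule: finite_induct) (auto intro: locally_finite_set_Un locally_finite_set_finite)

text \<open>The break set of a piecewise smooth function is made explicit, so that several functions
  can share one and integration by parts can sum over it.\<close>

definition smooth_between :: "real set \<Rightarrow> (real \<Rightarrow> real) \<Rightarrow> bool" where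
  "smooth_between S f \<longleftrightarrow>
     (\<forall>a b. a < b \<longrightarrow> {a<..<b} \<inter> S = {} \<longrightarrow> (\<exists>g. smooth_fun g \<and> (\<forall>s\<in>{a<..<b}. f s = g s)))"

lemma piecewise_smooth_iff: "piecewise_smooth f \<longleftrightarrow> (\<exists>S. locally_finite_set S \<and> smooth_between S f)"
  by (simp add: piecewise_smooth_def smooth_between_def)

lemma smooth_betweenE:
  assumes "smooth_between S f" "a < b" "{a<..<b} \<inter> S = {}"
  obtains g where "smooth_fun g" "\<And>s. s \<in> {a<..<b} \<Longrightarrow> f s = g s"
  using assms unfolding smooth_between_def by blast

lemma smooth_between_mono: "smooth_between S f \<Longrightarrow> S \<subseteq> T \<Longrightarrow> smooth_between T f"
  unfolding smooth_between_def by blast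

lemma smooth_between_sum:
  assumes "finite I" "\<And>i. i \<in> I \<Longrightarrow> smooth_between S (f i)"
  shows "smooth_between S (\<lambda>s. \<Sum>i\<in>I. c i * f i s)"
  unfolding smooth_between_def
proof (intro allI impI)
  fix a b :: real assume *: "a < b" "{a<..<b} \<inter> S = {}"
  have "\<forall>i\<in>I. \<exists>g. smooth_fun g \<and> (\<forall>s\<in>{a<..<b}. f i s = g s)"
    using assms(2) * unfolding smooth_between_def by blast
  then obtain g where g: "\<And>i. i \<in> I \<Longrightarrow> smooth_fun (g i)" "\<And>i s. i \<in> I \<Longrightarrow> s \<in> {a<..<b} \<Longrightarrow> f i s = g i s"
    by metis
  have "smooth_fun (\<lambda>s. \<Sum>i\<in>I. c i * g i s)"
    by (intro smooth_fun_sum smooth_fun_mult smooth_fun_const g)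
  moreover have "\<forall>s\<in>{a<..<b}. (\<Sum>i\<in>I. c i * f i s) = (\<Sum>i\<in>I. c i * g i s)"
    using g(2) by (intro ballI sum.cong) auto
  ultimately show "\<exists>h. smooth_fun h \<and> (\<forall>s\<in>{a<..<b}. (\<Sum>i\<in>I. c i * f i s) = h s)" by blast
qed

lemma smooth_between_indicator:
  assumes "smooth_between S f" "0 \<in> S"
  shows "smooth_between S (\<lambda>s. f s * indicator {0..} s)"
  unfolding smooth_between_def
proof (intro allI impI)
  fix a b :: real assume *: "a < b" "{a<..<b} \<inter> S = {}"
  then obtain g where g: "smooth_fun g" "\<And>s. s \<in> {a<..<b} \<Longrightarrow> f s = g s"
    using smooth_betweenE[OF assms(1)] by blast
  have "0 \<notin> {a<..<b}" using * assms(2) by blast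
  then consider "b \<le> 0" | "a \<ge> 0" by fastforce
  then show "\<exists>g. smooth_fun g \<and> (\<forall>s\<in>{a<..<b}. f s * indicator {0..} s = g s)"
  proof cases
    case 1
    then show ?thesis by (intro exI[of _ "\<lambda>s. 0"]) (auto simp: smooth_fun_const)
  next
    case 2
    then show ?thesis using g by (intro exI[of _ g]) auto
  qed
qed

lemma smooth_between_deriv:
  assumes "smooth_between S f"
  shows "smooth_between S (deriv f)"
  unfolding smooth_between_def
proof (intro allI impI)
  fix a b :: real assume *: "a < b" "{a<..<b} \<inter> S = {}"
  then obtain g where g: "smooth_fun g" "\<And>s. s \<in> {a<..<b} \<Longrightarrow> f s = g s"
    using smooth_betweenE[OF assms] by blast
  have "deriv f s = deriv g s" if "s \<in> {a<..<b}" for s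
  proof (rule deriv_cong_ev)
    show "\<forall>\<^sub>F x in nhds s. f x = g x" using g(2) that eventually_nhds_in_open[of "{a<..<b}" s]
      by (auto elim: eventually_mono)
  qed simp
  then show "\<exists>g. smooth_fun g \<and> (\<forall>s\<in>{a<..<b}. deriv f s = g s)" using smooth_fun_deriv[OF g(1)] by blast
qed

text \<open>Induction on the number of break points inside the interval, cutting at one of them.
  Facts about piecewise smooth functions reduce to a smooth piece and a gluing step.\<close>

lemma interval_splitting_induct:
  assumes S: "locally_finite_set S" and "a < (b::real)"
    and base: "\<And>c d. c < d \<Longrightarrow> {c<..<d} \<inter> S = {} \<Longrightarrow> P c d"
    and join: "\<And>c d e. c < d \<Longrightarrow> d < e \<Longrightarrow> d \<in> S \<Longrightarrow> P c d \<Longrightarrow> P d e \<Longrightarrow> P c e"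
  shows "P a b"
proof -
  have fin: "finite (S \<inter> {c<..<d})" for c d
    using S finite_subset[of "S \<inter> {c<..<d}" "S \<inter> {c..d}"] unfolding locally_finite_set_def by force
  show ?thesis using \<open>a < b\<close>
  proof (induction "card (S \<inter> {a<..<b})" arbitrary: a b rule: less_induct)
    case less
    show ?case
    proof (cases "{a<..<b} \<inter> S = {}")
      case True
      then show ?thesis using base less.prems by blast
    next
      case False
      then obtain t where t: "t \<in> S" "a < t" "t < b" by auto
      have "card (S \<inter> {a<..<t}) < card (S \<inter> {a<..<b})" "card (S \<inter> {t<..<b}) < card (S \<inter> {a<..<b})"
        by (rule psubset_card_mono[OF fin]; use t in force)+
      then show ?thesis using less.hyps join[of a t b] t by blast
    qed
  qed
qed

lemma smooth_between_integrable:
  assumes S: "locally_finite_set S" and f: "smooth_between S f" and \<phi>: "smooth_fun \<phi>" and ab: "a < b"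
  shows "set_integrable lborel {a..b} (\<lambda>s. f s * \<phi> s)"
proof (rule interval_splitting_induct[OF S ab])
  fix c d :: real assume *: "c < d" "{c<..<d} \<inter> S = {}"
  then obtain g where g: "smooth_fun g" "\<And>s. s \<in> {c<..<d} \<Longrightarrow> f s = g s"
    using smooth_betweenE[OF f] by blast
  have "set_integrable lborel {c..d} (\<lambda>s. g s * \<phi> s)"
    by (intro borel_integrable_atLeastAtMost' continuous_intros smooth_fun_continuous_on g \<phi>)
  then have "set_integrable lborel {c<..<d} (\<lambda>s. g s * \<phi> s)"
    by (rule set_integrable_subset) auto
  then have o: "set_integrable lborel {c<..<d} (\<lambda>s. f s * \<phi> s)"
    using g(2) by (subst set_integrable_cong[where M' = lborel and A' = "{c<..<d}"]) auto
  \<comment> \<open>The values of \<open>f\<close> at the ends are arbitrary, so the end points are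
    added separately to obtain closed intervals, which glue.\<close>
  have "set_integrable lborel {x} (\<lambda>s. f s * \<phi> s)" for x
  proof -
    have "integrable lborel (\<lambda>s. indicator {x} s *\<^sub>R (f x * \<phi> x))" by (simp add: integrable_indicator_iff)
    moreover have "(\<lambda>s. indicator {x} s *\<^sub>R (f x * \<phi> x)) = (\<lambda>s. indicator {x} s *\<^sub>R (f s * \<phi> s))"
      by (auto simp: indicator_def)
    ultimately show ?thesis unfolding set_integrable_def by metis
  qed
  then have "set_integrable lborel ({c} \<union> ({c<..<d} \<union> {d})) (\<lambda>s. f s * \<phi> s)"
    by (intro set_integrable_Un o) auto
  moreover have "{c} \<union> ({c<..<d} \<union> {d}) = {c..d}" using * by auto
  ultimately show "set_integrable lborel {c..d} (\<lambda>s. f s * \<phi> s)" by simp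
next
  fix c d e :: real assume *: "c < d" "d < e" "set_integrable lborel {c..d} (\<lambda>s. f s * \<phi> s)"
    "set_integrable lborel {d..e} (\<lambda>s. f s * \<phi> s)"
  then have "set_integrable lborel ({c..d} \<union> {d..e}) (\<lambda>s. f s * \<phi> s)"
    by (intro set_integrable_Un) auto
  moreover have "{c..d} \<union> {d..e} = {c..e}" using * by auto
  ultimately show "set_integrable lborel {c..e} (\<lambda>s. f s * \<phi> s)" by simp
qed

lemma integral_eq_set_integral:
  fixes \<phi> :: "real \<Rightarrow> real"
  assumes "{s. \<phi> s \<noteq> 0} \<subseteq> {a<..<b}"
  shows "(LINT s|lborel. f s * \<phi> s) = (LINT s:{a..b}|lborel. f s * \<phi> s)"
  unfolding set_lebesgue_integral_def
proof (rule Bochner_Integration.integral_cong[OF refl])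
  fix s show "f s * \<phi> s = indicator {a..b} s *\<^sub>R (f s * \<phi> s)"
  proof (cases "s \<in> {a..b}")
    case False
    then have "\<phi> s = 0" using assms by force
    then show ?thesis by simp
  qed simp
qed

lemma piecewise_smooth_integrable:
  assumes f: "piecewise_smooth f" and \<phi>: "test_fun \<phi>"
  shows "integrable lborel (\<lambda>s. f s * \<phi> s)"
proof -
  obtain S where S: "locally_finite_set S" "smooth_between S f" using f by (auto simp: piecewise_smooth_iff)
  obtain a b where ab: "a < b" "{s. \<phi> s \<noteq> 0} \<subseteq> {a<..<b}" using test_funE[OF \<phi>] by blast
  have "(\<lambda>s. indicator {a..b} s *\<^sub>R (f s * \<phi> s)) = (\<lambda>s. f s * \<phi> s)"
  proof
    fix s show "indicator {a..b} s *\<^sub>R (f s * \<phi> s) = f s * \<phi> s"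
    proof (cases "s \<in> {a..b}")
      case False
      then have "\<phi> s = 0" using ab(2) by force
      then show ?thesis by simp
    qed simp
  qed
  then show ?thesis
    using smooth_between_integrable[OF S test_fun_smooth[OF \<phi>] ab(1)] unfolding set_integrable_def by metis
qed

section \<open>Piecewise smooth distributions\<close>

text \<open>The smooth function \<open>g\<close> is continuous at the ends as well, where
  \<open>f\<close> itself may take any value.\<close>

lemma one_sided_limits:
  fixes f g :: "real \<Rightarrow> real"
  assumes cd: "c < d" and g: "smooth_fun g" and fg: "\<And>s. s \<in> {c<..<d} \<Longrightarrow> f s = g s"
  shows "Lim (at_right c) f = g c" "Lim (at_left d) f = g d"
proof -
  have "(g \<longlongrightarrow> g c) (at_right c)" "(g \<longlongrightarrow> g d) (at_left d)"
    using smooth_fun_isCont[OF g] by (auto simp: isCont_def intro: tendsto_mono[OF at_le[OF subset_UNIV]])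
  moreover have "\<forall>\<^sub>F s in at_right c. g s = f s" "\<forall>\<^sub>F s in at_left d. g s = f s"
    using cd fg unfolding eventually_at_right[OF cd] eventually_at_left[OF cd] by auto
  ultimately have "(f \<longlongrightarrow> g c) (at_right c)" "(f \<longlongrightarrow> g d) (at_left d)"
    by (auto intro: Lim_transform_eventually)
  then show "Lim (at_right c) f = g c" "Lim (at_left d) f = g d"
    by (auto intro!: tendsto_Lim simp: trivial_limit_at_right_real trivial_limit_at_left_real)
qed

lemma set_integral_Icc_cong_interior:
  fixes f g :: "real \<Rightarrow> real"
  assumes "\<And>s. s \<in> {c<..<d} \<Longrightarrow> f s = g s"
  shows "(LINT s:{c..d}|lborel. f s) = (LINT s:{c..d}|lborel. g s)"
proof -
  have "(LINT s:{c..d}|lborel. f s) = (LINT s:{c<..<d}|lborel. f s)" for f :: "real \<Rightarrow> real"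
    by (rule set_integral_discrete_difference[where X = "{c, d}"]) auto
  moreover have "(LINT s:{c<..<d}|lborel. f s) = (LINT s:{c<..<d}|lborel. g s)"
    by (rule set_lebesgue_integral_cong) (use assms in auto)
  ultimately show ?thesis by simp
qed

lemma set_integral_Icc_join:
  fixes f :: "real \<Rightarrow> real"
  assumes "c < d" "d < e" "set_integrable lborel {c..e} f"
  shows "(LINT s:{c..e}|lborel. f s) = (LINT s:{c..d}|lborel. f s) + (LINT s:{d..e}|lborel. f s)"
proof -
  have "{c..e} = {c..d} \<union> {d..e}" using assms by auto
  moreover have "AE s in lborel. \<not> (s \<in> {c..d} \<and> s \<in> {d..e})"
    using AE_lborel_singleton[of d] by eventually_elim auto
  ultimately show ?thesis
    using set_integrable_subset[OF assms(3), of "{c..d}"] set_integrable_subset[OF assms(3), of "{d..e}"] assms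
    by (simp add: set_integral_Un_AE)
qed

abbreviation jump :: "(real \<Rightarrow> real) \<Rightarrow> real \<Rightarrow> real" where
  "jump f t \<equiv> Lim (at_right t) f - Lim (at_left t) f"

text \<open>On a smooth piece this is the fundamental theorem of calculus for g \<phi>. When two
  pieces are joined at d, their boundary terms there combine into the jump of \<open>f\<close> at
  d.\<close>

lemma smooth_between_by_parts:
  assumes S: "locally_finite_set S" and f: "smooth_between S f" and \<phi>: "smooth_fun \<phi>" and ab: "a < b"
  shows "(LINT s:{a..b}|lborel. f s * deriv \<phi> s) + (LINT s:{a..b}|lborel. deriv f s * \<phi> s)
    = Lim (at_left b) f * \<phi> b - Lim (at_right a) f * \<phi> a - (\<Sum>t\<in>S \<inter> {a<..<b}. jump f t * \<phi> t)"
proof (rule interval_splitting_induct[OF S ab])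
  fix c d :: real assume *: "c < d" "{c<..<d} \<inter> S = {}"
  obtain g where g: "smooth_fun g" "\<And>s. s \<in> {c<..<d} \<Longrightarrow> f s = g s"
    using smooth_betweenE[OF f *] by blast
  have dfg: "deriv f s = deriv g s" if "s \<in> {c<..<d}" for s
  proof (rule deriv_cong_ev)
    show "\<forall>\<^sub>F x in nhds s. f x = g x" using g(2) that eventually_nhds_in_open[of "{c<..<d}" s]
      by (auto elim: eventually_mono)
  qed simp
  have i1: "set_integrable lborel {c..d} (\<lambda>s. g s * deriv \<phi> s)"
    by (intro borel_integrable_atLeastAtMost' continuous_intros smooth_fun_continuous_on g(1) smooth_fun_deriv \<phi>)
  have i2: "set_integrable lborel {c..d} (\<lambda>s. deriv g s * \<phi> s)"
    by (intro borel_integrable_atLeastAtMost' continuous_intros smooth_fun_continuous_on g(1) smooth_fun_deriv \<phi>)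
  have "(LINT s:{c..d}|lborel. f s * deriv \<phi> s) + (LINT s:{c..d}|lborel. deriv f s * \<phi> s)
      = (LINT s:{c..d}|lborel. g s * deriv \<phi> s) + (LINT s:{c..d}|lborel. deriv g s * \<phi> s)"
    using set_integral_Icc_cong_interior[of c d "\<lambda>s. f s * deriv \<phi> s" "\<lambda>s. g s * deriv \<phi> s"]
      set_integral_Icc_cong_interior[of c d "\<lambda>s. deriv f s * \<phi> s" "\<lambda>s. deriv g s * \<phi> s"] g(2) dfg by simp
  also have "\<dots> = (LINT s:{c..d}|lborel. g s * deriv \<phi> s + deriv g s * \<phi> s)"
    using set_integral_add(2)[OF i1 i2] by simp
  also have "(LINT s:{c..d}|lborel. g s * deriv \<phi> s + deriv g s * \<phi> s) = g d * \<phi> d - g c * \<phi> c"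
    unfolding set_lebesgue_integral_def
  proof (rule integral_FTC_atLeastAtMost)
    show "continuous_on {c..d} (\<lambda>s. g s * deriv \<phi> s + deriv g s * \<phi> s)"
      using g(1) \<phi> by (intro smooth_fun_continuous_on smooth_fun_add smooth_fun_mult smooth_fun_deriv)
    show "c \<le> d" using * by simp
    fix s
    have "((\<lambda>s. g s * \<phi> s) has_real_derivative g s * deriv \<phi> s + deriv g s * \<phi> s) (at s)"
      using DERIV_mult[OF smooth_fun_DERIV[OF g(1), of s] smooth_fun_DERIV[OF \<phi>, of s]] by (simp add: algebra_simps)
    then show "((\<lambda>s. g s * \<phi> s) has_vector_derivative g s * deriv \<phi> s + deriv g s * \<phi> s) (at s within {c..d})"
      using has_real_derivative_iff_has_vector_derivative has_vector_derivative_at_within by blast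
  qed
  also have "g d * \<phi> d - g c * \<phi> c = Lim (at_left d) f * \<phi> d - Lim (at_right c) f * \<phi> c - (\<Sum>t\<in>S \<inter> {c<..<d}. jump f t * \<phi> t)"
    using one_sided_limits[OF *(1) g] *(2) by (simp add: Int_commute)
  finally show "(LINT s:{c..d}|lborel. f s * deriv \<phi> s) + (LINT s:{c..d}|lborel. deriv f s * \<phi> s)
    = Lim (at_left d) f * \<phi> d - Lim (at_right c) f * \<phi> c - (\<Sum>t\<in>S \<inter> {c<..<d}. jump f t * \<phi> t)" .
next
  fix c d e assume *: "c < d" "d < e" "d \<in> S"
    and 1: "(LINT s:{c..d}|lborel. f s * deriv \<phi> s) + (LINT s:{c..d}|lborel. deriv f s * \<phi> s)
      = Lim (at_left d) f * \<phi> d - Lim (at_right c) f * \<phi> c - (\<Sum>t\<in>S \<inter> {c<..<d}. jump f t * \<phi> t)"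
    and 2: "(LINT s:{d..e}|lborel. f s * deriv \<phi> s) + (LINT s:{d..e}|lborel. deriv f s * \<phi> s)
      = Lim (at_left e) f * \<phi> e - Lim (at_right d) f * \<phi> d - (\<Sum>t\<in>S \<inter> {d<..<e}. jump f t * \<phi> t)"
  have fin: "finite (S \<inter> {c<..<d})" for c d
    using S finite_subset[of "S \<inter> {c<..<d}" "S \<inter> {c..d}"] unfolding locally_finite_set_def by force
  have ce: "c < e" using * by simp
  note j1 = set_integral_Icc_join[OF *(1,2) smooth_between_integrable[OF S f smooth_fun_deriv[OF \<phi>] ce]]
  note j2 = set_integral_Icc_join[OF *(1,2) smooth_between_integrable[OF S smooth_between_deriv[OF f] \<phi> ce]]
  have "S \<inter> {c<..<e} = insert d ((S \<inter> {c<..<d}) \<union> (S \<inter> {d<..<e}))" using * by auto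
  moreover have "d \<notin> (S \<inter> {c<..<d}) \<union> (S \<inter> {d<..<e})" by auto
  ultimately have "(\<Sum>t\<in>S \<inter> {c<..<e}. jump f t * \<phi> t) = jump f d * \<phi> d + ((\<Sum>t\<in>S \<inter> {c<..<d}. jump f t * \<phi> t)
      + (\<Sum>t\<in>S \<inter> {d<..<e}. jump f t * \<phi> t))"
    using fin by (simp add: sum.union_disjoint disjoint_iff)
  then show "(LINT s:{c..e}|lborel. f s * deriv \<phi> s) + (LINT s:{c..e}|lborel. deriv f s * \<phi> s)
    = Lim (at_left e) f * \<phi> e - Lim (at_right c) f * \<phi> c - (\<Sum>t\<in>S \<inter> {c<..<e}. jump f t * \<phi> t)"
    unfolding j1 j2 using 1 2 by (simp add: algebra_simps)
qed

text \<open>Integration by parts moves the derivative from the test function to \<open>f\<close> and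
  leaves one Dirac impulse per jump, while the impulses already present rise by one order.
  \<open>pCons\<close> records both effects.\<close>

lemma represents_deriv:
  assumes U: "represents f D U" and S: "locally_finite_set S" and f: "smooth_between S f"
  shows "represents (deriv f) (\<lambda>t. pCons (if t \<in> S then jump f t else 0) (D t)) (\<lambda>\<phi>. - U (deriv \<phi>))"
    (is "represents _ ?D' _")
  unfolding represents_def
proof (intro conjI allI impI)
  have D: "locally_finite_set {t. D t \<noteq> 0}" using U by (simp add: represents_def)
  have SD: "locally_finite_set (S \<union> {t. D t \<noteq> 0})" by (rule locally_finite_set_Un[OF S D])
  have sub: "{t. ?D' t \<noteq> 0} \<subseteq> S \<union> {t. D t \<noteq> 0}" by (auto split: if_splits)
  show "piecewise_smooth (deriv f)" using S smooth_between_deriv[OF f] by (auto simp: piecewise_smooth_iff)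
  show "locally_finite_set {t. ?D' t \<noteq> 0}" by (rule locally_finite_set_subset[OF SD sub])
  fix \<phi> assume \<phi>: "test_fun \<phi>"
  note sm = test_fun_smooth[OF \<phi>]
  obtain a1 b1 where 1: "a1 < b1" "{s. \<phi> s \<noteq> 0} \<subseteq> {a1<..<b1}" using test_funE[OF \<phi>] by blast
  obtain a2 b2 where 2: "a2 < b2" "{s. deriv \<phi> s \<noteq> 0} \<subseteq> {a2<..<b2}" using test_funE[OF test_fun_deriv[OF \<phi>]] by blast
  \<comment> \<open>One interval that contains the supports of both \<phi> and its
    derivative.\<close>
  define a b where "a = min a1 a2" and "b = max b1 b2"
  have ab: "a < b" and z1: "{s. \<phi> s \<noteq> 0} \<subseteq> {a<..<b}" and z2: "{s. deriv \<phi> s \<noteq> 0} \<subseteq> {a<..<b}"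
    using 1 2 by (force simp: a_def b_def)+
  have \<phi>ab: "\<phi> a = 0" "\<phi> b = 0" using z1 by auto
  define T where "T = (S \<union> {t. D t \<noteq> 0}) \<inter> {a..b}"
  have T: "finite T" using SD by (simp add: T_def locally_finite_set_def)
  have "U (deriv \<phi>) = (LINT s|lborel. f s * deriv \<phi> s) + (\<Sum>t\<in>T. dirac_comb t (D t) (deriv \<phi>))"
    using U test_fun_deriv[OF \<phi>] pw_distr_eq_sum[where D = D and f = f, OF z2 T] by (auto simp: represents_def T_def)
  moreover have "pw_distr (deriv f) ?D' \<phi> = (LINT s|lborel. deriv f s * \<phi> s) + (\<Sum>t\<in>T. dirac_comb t (?D' t) \<phi>)"
    by (rule pw_distr_eq_sum[OF z1 T]) (use sub in \<open>auto simp: T_def\<close>)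
  moreover have "(\<Sum>t\<in>T. dirac_comb t (?D' t) \<phi>)
      = (\<Sum>t\<in>T. (if t \<in> S then jump f t else 0) * \<phi> t) - (\<Sum>t\<in>T. dirac_comb t (D t) (deriv \<phi>))"
    by (simp add: dirac_comb_pCons sum_subtractf)
  moreover have "(\<Sum>t\<in>T. (if t \<in> S then jump f t else 0) * \<phi> t) = (\<Sum>t\<in>S \<inter> {a<..<b}. jump f t * \<phi> t)"
    using T z1 by (intro sum.mono_neutral_cong_right) (auto simp: T_def)
  moreover have "(LINT s|lborel. f s * deriv \<phi> s) + (LINT s|lborel. deriv f s * \<phi> s)
      = - (\<Sum>t\<in>S \<inter> {a<..<b}. jump f t * \<phi> t)"
    using smooth_between_by_parts[OF S f sm ab] integral_eq_set_integral[OF z1] integral_eq_set_integral[OF z2]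
    by (simp add: \<phi>ab)
  ultimately show "- U (deriv \<phi>) = pw_distr (deriv f) ?D' \<phi>" by linarith
qed

lemma represents_sum:
  assumes I: "finite I" and r: "\<And>i. i \<in> I \<Longrightarrow> represents (f i) (D i) (U i)"
  shows "represents (\<lambda>s. \<Sum>i\<in>I. c i * f i s) (\<lambda>t. \<Sum>i\<in>I. Polynomial.smult (c i) (D i t)) (\<lambda>\<phi>. \<Sum>i\<in>I. c i * U i \<phi>)"
    (is "represents ?f ?D _")
  unfolding represents_def
proof (intro conjI allI impI)
  have "\<forall>i\<in>I. \<exists>S. locally_finite_set S \<and> smooth_between S (f i)"
    using r by (auto simp: represents_def piecewise_smooth_iff)
  then obtain S where S: "\<And>i. i \<in> I \<Longrightarrow> locally_finite_set (S i)" "\<And>i. i \<in> I \<Longrightarrow> smooth_between (S i) (f i)"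
    by metis
  have "smooth_between (\<Union>i\<in>I. S i) (f i)" if "i \<in> I" for i
    using smooth_between_mono[OF S(2)[OF that]] that by blast
  then have "smooth_between (\<Union>i\<in>I. S i) ?f" by (rule smooth_between_sum[OF I])
  moreover have "locally_finite_set (\<Union>i\<in>I. S i)" using S(1) by (rule locally_finite_set_UN[OF I])
  ultimately show "piecewise_smooth ?f" unfolding piecewise_smooth_iff by (intro exI conjI)
  have lf: "locally_finite_set (\<Union>i\<in>I. {t. D i t \<noteq> 0})"
    using r by (intro locally_finite_set_UN[OF I]) (auto simp: represents_def)
  have sub: "{t. ?D t \<noteq> 0} \<subseteq> (\<Union>i\<in>I. {t. D i t \<noteq> 0})" by (auto intro: sum.neutral)
  show "locally_finite_set {t. ?D t \<noteq> 0}" by (rule locally_finite_set_subset[OF lf sub])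
  fix \<phi> assume \<phi>: "test_fun \<phi>"
  obtain a b where ab: "a < b" "{s. \<phi> s \<noteq> 0} \<subseteq> {a<..<b}" using test_funE[OF \<phi>] by blast
  define T where "T = (\<Union>i\<in>I. {t. D i t \<noteq> 0}) \<inter> {a..b}"
  have T: "finite T" using lf by (simp add: T_def locally_finite_set_def)
  have Ui: "U i \<phi> = (LINT s|lborel. f i s * \<phi> s) + (\<Sum>t\<in>T. dirac_comb t (D i t) \<phi>)" if "i \<in> I" for i
    using r[OF that] \<phi> pw_distr_eq_sum[where D = "D i" and f = "f i", OF ab(2) T] that by (auto simp: represents_def T_def)
  have int: "integrable lborel (\<lambda>s. f i s * \<phi> s)" if "i \<in> I" for i
    using piecewise_smooth_integrable[OF _ \<phi>] r[OF that] by (simp add: represents_def)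
  have comb: "dirac_comb t (?D t) \<phi> = (\<Sum>i\<in>I. c i * dirac_comb t (D i t) \<phi>)" for t
    using I by (induction rule: finite_induct) (simp_all add: dirac_comb_add dirac_comb_smult)
  have "pw_distr ?f ?D \<phi> = (LINT s|lborel. ?f s * \<phi> s) + (\<Sum>t\<in>T. dirac_comb t (?D t) \<phi>)"
    by (rule pw_distr_eq_sum[OF ab(2) T]) (use sub in \<open>auto simp: T_def\<close>)
  also have "(LINT s|lborel. ?f s * \<phi> s) = (LINT s|lborel. (\<Sum>i\<in>I. c i * (f i s * \<phi> s)))"
    by (simp add: sum_distrib_right mult.assoc)
  also have "\<dots> = (\<Sum>i\<in>I. c i * (LINT s|lborel. f i s * \<phi> s))"
    using int by simp
  also have "(\<Sum>t\<in>T. dirac_comb t (?D t) \<phi>) = (\<Sum>i\<in>I. c i * (\<Sum>t\<in>T. dirac_comb t (D i t) \<phi>))"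
    unfolding comb sum_distrib_left by (rule sum.swap)
  finally show "(\<Sum>i\<in>I. c i * U i \<phi>) = pw_distr ?f ?D \<phi>"
    by (simp add: Ui sum.distrib distrib_left)
qed

section \<open>Uniqueness of the representation\<close>

lemma smooth_between_bounded:
  assumes S: "locally_finite_set S" and f: "smooth_between S f" and ab: "a < b"
  shows "\<exists>M. \<forall>s\<in>{a..b}. \<bar>f s\<bar> \<le> M"
proof (rule interval_splitting_induct[OF S ab])
  fix c d :: real assume *: "c < d" "{c<..<d} \<inter> S = {}"
  obtain g where g: "smooth_fun g" "\<And>s. s \<in> {c<..<d} \<Longrightarrow> f s = g s" using smooth_betweenE[OF f *] by blast
  have "bounded (g ` {c..d})"
    by (intro compact_imp_bounded compact_continuous_image smooth_fun_continuous_on g compact_Icc)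
  then have "\<exists>M. \<forall>s\<in>{c..d}. \<bar>g s\<bar> \<le> M" by (auto simp: bounded_iff)
  then obtain M where M: "\<And>s. s \<in> {c..d} \<Longrightarrow> \<bar>g s\<bar> \<le> M" by blast
  have "\<bar>f s\<bar> \<le> max M (max \<bar>f c\<bar> \<bar>f d\<bar>)" if "s \<in> {c..d}" for s
  proof (cases "s = c \<or> s = d")
    case False
    then have "s \<in> {c<..<d}" using that by auto
    then show ?thesis using g(2) M[OF that] by auto
  qed auto
  then show "\<exists>M. \<forall>s\<in>{c..d}. \<bar>f s\<bar> \<le> M" by blast
next
  fix c d e :: real assume "\<exists>M. \<forall>s\<in>{c..d}. \<bar>f s\<bar> \<le> M" "\<exists>M. \<forall>s\<in>{d..e}. \<bar>f s\<bar> \<le> M"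
  then obtain M N where MN: "\<And>s. s \<in> {c..d} \<Longrightarrow> \<bar>f s\<bar> \<le> M" "\<And>s. s \<in> {d..e} \<Longrightarrow> \<bar>f s\<bar> \<le> N" by blast
  have "\<bar>f s\<bar> \<le> max M N" if "s \<in> {c..e}" for s
    using MN(1)[of s] MN(2)[of s] that by (cases "s \<le> d") (auto simp: le_max_iff_disj)
  then show "\<exists>M. \<forall>s\<in>{c..e}. \<bar>f s\<bar> \<le> M" by blast
qed

text \<open>Each differentiation uses up one factor (s - t) and leaves a smooth cofactor
  \<open>g\<close>. The last conjunct follows the value of \<open>g\<close> at \<open>t\<close>,
  with factorials on both sides to avoid division; for j = q it is the derivative itself.\<close>

lemma funpow_deriv_power_mult:
  fixes h :: "real \<Rightarrow> real"
  assumes h: "smooth_fun h" and "j \<le> q"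
  shows "\<exists>g. smooth_fun g \<and> (deriv ^^ j) (\<lambda>s. (s - t) ^ q * h s) = (\<lambda>s. (s - t) ^ (q - j) * g s)
    \<and> fact (q - j) * g t = fact q * h t"
  using assms(2)
proof (induction j)
  case 0
  then show ?case using h by (intro exI[of _ h]) simp
next
  case (Suc j)
  define r where "r = q - Suc j"
  have qj: "q - j = Suc r" using Suc.prems by (simp add: r_def)
  obtain g where g: "smooth_fun g" "(deriv ^^ j) (\<lambda>s. (s - t) ^ q * h s) = (\<lambda>s. (s - t) ^ (q - j) * g s)"
    "fact (q - j) * g t = fact q * h t" using Suc by auto
  define g' where "g' = (\<lambda>s. real (Suc r) * g s + (1 * s + - t) * deriv g s)"
  have "deriv (\<lambda>s. (s - t) ^ Suc r * g s) s = (s - t) ^ r * g' s" for s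
  proof (rule DERIV_imp_deriv)
    have "((\<lambda>s. (s - t) ^ Suc r) has_real_derivative real (Suc r) * (s - t) ^ r) (at s)"
      by (rule derivative_eq_intros refl | simp)+
    from DERIV_mult[OF this smooth_fun_DERIV[OF g(1), of s]]
    show "((\<lambda>s. (s - t) ^ Suc r * g s) has_real_derivative (s - t) ^ r * g' s) (at s)"
      by (simp add: g'_def algebra_simps)
  qed
  then have "deriv (\<lambda>s. (s - t) ^ Suc r * g s) = (\<lambda>s. (s - t) ^ r * g' s)" by (rule ext)
  then have "(deriv ^^ Suc j) (\<lambda>s. (s - t) ^ q * h s) = (\<lambda>s. (s - t) ^ (q - Suc j) * g' s)"
    by (simp only: funpow.simps o_apply g(2) qj r_def)
  moreover have "smooth_fun g'" unfolding g'_def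
    by (rule smooth_fun_add[OF smooth_fun_mult[OF smooth_fun_const g(1)]
          smooth_fun_mult[OF smooth_fun_affine[OF smooth_fun_ident] smooth_fun_deriv[OF g(1)]]])
  moreover have "fact (q - Suc j) * g' t = fact q * h t"
    using g(3) unfolding qj by (simp add: g'_def r_def[symmetric] algebra_simps)
  ultimately show ?case by blast
qed

text \<open>The factor \<open>(s - t) ^ q\<close> kills all derivatives of order below
  \<open>q\<close> at \<open>t\<close>, so the pairing sees only the leading coefficient.\<close>

lemma dirac_comb_power_mult:
  assumes h: "smooth_fun h" and q: "q = Polynomial.degree c"
  shows "dirac_comb t c (\<lambda>s. (s - t) ^ q * h s) = lead_coeff c * (- 1) ^ q * (fact q * h t)"
proof -
  let ?\<phi> = "\<lambda>s. (s - t) ^ q * h s"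
  have low: "(deriv ^^ j) ?\<phi> t = 0" if "j < q" for j
    using funpow_deriv_power_mult[OF h, of j q t] that by (auto simp: power_0_left)
  have top: "(deriv ^^ q) ?\<phi> t = fact q * h t"
    using funpow_deriv_power_mult[OF h, of q q t] by auto
  have "dirac_comb t c ?\<phi> = (\<Sum>j\<in>{q}. coeff c j * ((-1) ^ j * (deriv ^^ j) ?\<phi> t))"
    unfolding dirac_comb_def q[symmetric] using low by (intro sum.mono_neutral_right) auto
  also have "\<dots> = lead_coeff c * ((-1) ^ q * (deriv ^^ q) ?\<phi> t)" by (simp add: q[symmetric])
  finally show ?thesis by (simp only: top mult.assoc)
qed

lemma locally_finite_set_isolated:
  assumes "locally_finite_set S"
  obtains d where "d > 0" "d \<le> 1" "\<And>s. s \<in> S \<Longrightarrow> \<bar>s - t\<bar> < d \<Longrightarrow> s = t"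
proof -
  have "finite (S \<inter> {t - 1..t + 1})" using assms by (simp add: locally_finite_set_def)
  then obtain d where d: "d > 0" "\<And>x. x \<in> S \<inter> {t - 1..t + 1} \<Longrightarrow> x \<noteq> t \<Longrightarrow> d \<le> dist t x"
    using finite_set_avoid[of "S \<inter> {t - 1..t + 1}" t] by blast
  show thesis
  proof (rule that[of "min d 1"])
    fix s assume s: "s \<in> S" "\<bar>s - t\<bar> < min d 1"
    then have "s \<in> S \<inter> {t - 1..t + 1}" by (auto simp: abs_less_iff)
    then show "s = t" using d(2)[of s] s(2) by (auto simp: dist_real_def abs_minus_commute)
  qed (use d in auto)
qed

text \<open>Testing against \<open>(s - t)^q \<psi>(s)\<close> with a bump \<open>\<psi>\<close> of width \<open>e\<close> isolates the leading
  coefficient of the impulse at \<open>t\<close>, while the function part contributes only \<open>O(e)\<close>.\<close>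

lemma pw_distr_zero_impulse:
  assumes f: "piecewise_smooth f" and D: "locally_finite_set {t. D t \<noteq> 0}"
    and zero: "\<And>\<phi>. test_fun \<phi> \<Longrightarrow> pw_distr f D \<phi> = 0"
  shows "D t = 0"
proof (rule ccontr)
  assume Dt: "D t \<noteq> 0"
  define q where "q = Polynomial.degree (D t)"
  define L where "L = \<bar>lead_coeff (D t)\<bar> * fact q"
  have L: "L > 0" using Dt by (simp add: L_def)
  obtain S where S: "locally_finite_set S" "smooth_between S f" using f by (auto simp: piecewise_smooth_iff)
  have "\<exists>M. \<forall>s\<in>{t - 1..t + 1}. \<bar>f s\<bar> \<le> M" by (rule smooth_between_bounded[OF S]) simp
  then obtain M0 where M0: "\<And>s. s \<in> {t - 1..t + 1} \<Longrightarrow> \<bar>f s\<bar> \<le> M0" by blast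
  \<comment> \<open>A bound for f \<phi> that does not depend on the width of the bump, as long as
    the width is at most 1: \<open>f\<close> is bounded near \<open>t\<close> and the bump by exp 2.
    The maximum with 1 makes it positive.\<close>
  define M where "M = max M0 1 * exp 2"
  have M: "M > 0" by (simp add: M_def)
  obtain d where d: "d > 0" "d \<le> 1" "\<And>s. s \<in> {t. D t \<noteq> 0} \<Longrightarrow> \<bar>s - t\<bar> < d \<Longrightarrow> s = t"
    using locally_finite_set_isolated[OF D] by blast
  \<comment> \<open>The bound \<open>d / 2\<close> leaves \<open>t\<close> as the only possible
    impulse in the closed interval of radius \<open>e\<close>. The bound \<open>L / (4 * M)\<close>
    keeps the integral below \<open>2 e M <= L / 2\<close>, whereas the impulse contributes
    \<open>L\<close>.\<close>
  define e where "e = min (d / 2) (L / (4 * M))"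
  have e: "e > 0" "e < d" "e \<le> 1" "e \<le> L / (4 * M)" using d L M by (auto simp: e_def)
  obtain \<psi> where \<psi>: "smooth_fun \<psi>" "\<psi> t = 1" "\<And>s. 0 \<le> \<psi> s" "\<And>s. \<psi> s \<le> exp 2"
      "\<And>s. \<bar>s - t\<bar> \<ge> e \<Longrightarrow> \<psi> s = 0" using exists_bump[OF e(1), of t] by blast
  define \<phi> where "\<phi> = (\<lambda>s. (s - t) ^ q * \<psi> s)"
  have supp: "{s. \<phi> s \<noteq> 0} \<subseteq> {t - e<..<t + e}"
  proof
    fix s assume "s \<in> {s. \<phi> s \<noteq> 0}"
    then have "\<psi> s \<noteq> 0" by (auto simp: \<phi>_def)
    then have "\<bar>s - t\<bar> < e" using \<psi>(5)[of s] by linarith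
    then show "s \<in> {t - e<..<t + e}" by auto
  qed
  have "smooth_fun (\<lambda>s. (1 * s + - t) ^ q * \<psi> s)"
    by (rule smooth_fun_mult[OF smooth_fun_power[OF smooth_fun_affine[OF smooth_fun_ident]] \<psi>(1)])
  then have "smooth_fun \<phi>" by (simp add: \<phi>_def)
  moreover have "\<forall>s. s \<notin> {t - e..t + e} \<longrightarrow> \<phi> s = 0" using supp by force
  ultimately have test: "test_fun \<phi>" unfolding test_fun_def by blast
  have "{s. D s \<noteq> 0} \<inter> {t - e..t + e} \<subseteq> {t}"
  proof
    fix s assume s: "s \<in> {s. D s \<noteq> 0} \<inter> {t - e..t + e}"
    then have "\<bar>s - t\<bar> < d" using e(2) by (auto simp: abs_less_iff)
    then show "s \<in> {t}" using d(3)[of s] s by auto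
  qed
  then have "pw_distr f D \<phi> = (LINT s|lborel. f s * \<phi> s) + dirac_comb t (D t) \<phi>"
    using pw_distr_eq_sum[OF supp, of "{t}" D f] by simp
  then have eq: "(LINT s|lborel. f s * \<phi> s) = - (lead_coeff (D t) * (- 1) ^ q * fact q)"
    using zero[OF test] dirac_comb_power_mult[OF \<psi>(1), of q "D t" t] \<psi>(2) by (simp add: \<phi>_def q_def)
  have "\<bar>- (lead_coeff (D t) * (- 1) ^ q * fact q)\<bar> = L" by (simp add: L_def abs_mult)
  then have "L = \<bar>LINT s|lborel. f s * \<phi> s\<bar>" using eq by simp
  also have "\<dots> \<le> (LINT s|lborel. M * indicator {t - e..t + e} s)"
  proof (rule integral_abs_bound[THEN order_trans], rule integral_mono)
    show "integrable lborel (\<lambda>s. \<bar>f s * \<phi> s\<bar>)" using piecewise_smooth_integrable[OF f test] by simp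
    show "integrable lborel (\<lambda>s. M * indicator {t - e..t + e} s)"
      by (intro integrable_mult_right integrable_real_indicator) (auto simp: emeasure_lborel_Icc_eq)
    fix s
    show "\<bar>f s * \<phi> s\<bar> \<le> M * indicator {t - e..t + e} s"
    proof (cases "s \<in> {t - e..t + e}")
      case True
      then have "\<bar>s - t\<bar> \<le> 1" and s1: "s \<in> {t - 1..t + 1}" using e(3) by (auto simp: abs_le_iff)
      then have "\<bar>s - t\<bar> ^ q \<le> 1" by (simp add: power_le_one)
      then have "\<bar>\<phi> s\<bar> \<le> 1 * exp 2"
        unfolding \<phi>_def abs_mult power_abs using \<psi>(3,4) by (intro mult_mono) auto
      moreover have "\<bar>f s\<bar> \<le> max M0 1" using M0[OF s1] by simp
      ultimately have "\<bar>f s\<bar> * \<bar>\<phi> s\<bar> \<le> max M0 1 * exp 2" by (intro mult_mono) auto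
      then show ?thesis using True by (simp add: abs_mult M_def)
    next
      case False
      then have "\<phi> s = 0" using supp by force
      then show ?thesis using False by simp
    qed
  qed
  also have "\<dots> = M * (2 * e)" using e(1) by simp
  also have "\<dots> \<le> L / 2" using e(4) M by (simp add: field_simps)
  finally show False using L by simp
qed

text \<open>Off the break points \<open>f\<close> is continuous. If it were nonzero at
  \<open>t\<close>, it would keep its sign nearby, and a bump supported there would give a nonzero
  integral.\<close>

lemma pw_distr_zero_function:
  assumes S: "locally_finite_set S" and f: "smooth_between S f"
    and zero: "\<And>\<phi>. test_fun \<phi> \<Longrightarrow> (LINT s|lborel. f s * \<phi> s) = 0" and t: "t \<notin> S"
  shows "f t = 0"
proof (rule ccontr)
  assume ft: "f t \<noteq> 0"
  obtain d where d: "d > 0" "\<And>s. s \<in> S \<Longrightarrow> \<bar>s - t\<bar> < d \<Longrightarrow> s = t"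
    using locally_finite_set_isolated[OF S] by blast
  have "{t - d<..<t + d} \<inter> S = {}"
  proof -
    have False if "s \<in> {t - d<..<t + d}" "s \<in> S" for s using d(2)[OF that(2)] that t by (auto simp: abs_less_iff)
    then show ?thesis by blast
  qed
  then obtain g where g: "smooth_fun g" "\<And>s. s \<in> {t - d<..<t + d} \<Longrightarrow> f s = g s"
    using smooth_betweenE[OF f, of "t - d" "t + d"] d(1) by auto
  have gt: "g t = f t" using g(2)[of t] d(1) by simp
  have "continuous (at t) g" using smooth_fun_isCont[OF g(1)] .
  then obtain e0 where e0: "e0 > 0" "\<And>s. \<bar>s - t\<bar> < e0 \<Longrightarrow> \<bar>g s - g t\<bar> < \<bar>f t\<bar>"
    unfolding continuous_at_eps_delta using ft by (metis dist_real_def zero_less_abs_iff)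
  define e where "e = min d e0"
  have e: "e > 0" "e \<le> d" "e \<le> e0" using d e0 by (auto simp: e_def)
  obtain \<psi> where \<psi>: "smooth_fun \<psi>" "\<And>s. 0 \<le> \<psi> s" "\<And>s. \<bar>s - t\<bar> \<ge> e \<Longrightarrow> \<psi> s = 0"
      "\<And>s. \<bar>s - t\<bar> < e \<Longrightarrow> \<psi> s > 0" using exists_bump[OF e(1), of t] by blast
  have "\<psi> s = 0" if "s \<notin> {t - e..t + e}" for s
  proof -
    have "\<bar>s - t\<bar> \<ge> e" using that by auto
    then show ?thesis by (rule \<psi>(3))
  qed
  then have test: "test_fun \<psi>" unfolding test_fun_def using \<psi>(1) by blast
  have pos: "sgn (f t) * (f s * \<psi> s) > 0" if s: "\<bar>s - t\<bar> < e" for s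
  proof -
    have "s \<in> {t - d<..<t + d}" using s e(2) by (auto simp: abs_less_iff)
    then have "f s = g s" by (rule g(2))
    moreover have "\<bar>g s - f t\<bar> < \<bar>f t\<bar>" using e0(2)[of s] s e(3) gt by simp
    ultimately have "sgn (f t) * f s > 0" by (auto simp: sgn_if abs_if split: if_splits)
    then show ?thesis using \<psi>(4)[OF s] by (simp add: mult.assoc[symmetric])
  qed
  have nonneg: "sgn (f t) * (f s * \<psi> s) \<ge> 0" for s
    using pos[of s] \<psi>(3)[of s] by (cases "\<bar>s - t\<bar> < e") auto
  have int: "integrable lborel (\<lambda>s. sgn (f t) * (f s * \<psi> s))"
    using piecewise_smooth_integrable[OF _ test, of f] S f by (auto simp: piecewise_smooth_iff)
  have "(LINT s|lborel. sgn (f t) * (f s * \<psi> s)) = 0" using zero[OF test] by simp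
  then have "AE s in lborel. sgn (f t) * (f s * \<psi> s) = 0"
    using integral_nonneg_eq_0_iff_AE[OF int] nonneg by simp
  then have "AE s in lborel. s \<notin> {t - e<..<t + e}"
  proof eventually_elim
    case (elim s)
    show ?case
    proof
      assume "s \<in> {t - e<..<t + e}"
      then have "\<bar>s - t\<bar> < e" by (auto simp: abs_less_iff)
      then show False using pos[of s] elim by simp
    qed
  qed
  then have "emeasure lborel {t - e<..<t + e} = 0"
    by (subst (asm) AE_iff_measurable[where N = "{t - e<..<t + e}"]) auto
  then show False using e(1) by simp
qed

lemma represents_unique:
  assumes U: "represents f D U" and V: "represents g D' V" and UV: "\<And>\<phi>. test_fun \<phi> \<Longrightarrow> U \<phi> = V \<phi>"
  shows "D = D'" and "AE s in lborel. f s = g s"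
proof -
  \<comment> \<open>The difference of the two representations is written as a sum over two Boolean
    indices with coefficients 1 and -1, so that \<open>represents_sum\<close> applies.\<close>
  define F where "F = (\<lambda>i::bool. if i then f else g)"
  define G where "G = (\<lambda>i::bool. if i then D else D')"
  define W where "W = (\<lambda>i::bool. if i then U else V)"
  define c where "c = (\<lambda>i::bool. if i then 1 else - 1 :: real)"
  let ?f = "\<lambda>s. \<Sum>i\<in>UNIV. c i * F i s" and ?D = "\<lambda>t. \<Sum>i\<in>UNIV. Polynomial.smult (c i) (G i t)"
  have "represents ?f ?D (\<lambda>\<phi>. \<Sum>i\<in>UNIV. c i * W i \<phi>)"
    by (rule represents_sum) (use U V in \<open>auto simp: F_def G_def W_def\<close>)
  moreover have "(\<Sum>i\<in>UNIV. c i * W i \<phi>) = 0" if "test_fun \<phi>" for \<phi>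
    using UV[OF that] by (simp add: UNIV_bool c_def W_def)
  ultimately have r: "piecewise_smooth ?f" "locally_finite_set {t. ?D t \<noteq> 0}"
    "\<And>\<phi>. test_fun \<phi> \<Longrightarrow> pw_distr ?f ?D \<phi> = 0"
    unfolding represents_def by auto
  have D0: "?D t = 0" for t by (rule pw_distr_zero_impulse[where f = ?f and D = ?D], rule r(1), rule r(2), rule r(3))
  then show "D = D'" by (auto simp: UNIV_bool c_def G_def)
  obtain S where S: "locally_finite_set S" "smooth_between S ?f" using r(1) by (auto simp: piecewise_smooth_iff)
  have int0: "(LINT s|lborel. ?f s * \<phi> s) = 0" if "test_fun \<phi>" for \<phi>
    using r(3)[OF that] D0 by (simp add: pw_distr_def)
  have fg: "f s = g s" if "s \<notin> S" for s
    using pw_distr_zero_function[OF S int0 that] by (simp add: UNIV_bool c_def F_def)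
  have "countable S"
  proof -
    have "S \<subseteq> (\<Union>n::nat. S \<inter> {- real n..real n})"
    proof
      fix x assume x: "x \<in> S"
      obtain n :: nat where "\<bar>x\<bar> \<le> real n" using real_arch_simple by blast
      then have "x \<in> {- real n..real n}" by auto
      with x show "x \<in> (\<Union>n::nat. S \<inter> {- real n..real n})" by blast
    qed
    moreover have "countable (\<Union>n::nat. S \<inter> {- real n..real n})"
      using S(1) by (intro countable_UN) (auto simp: locally_finite_set_def countable_finite)
    ultimately show ?thesis by (rule countable_subset)
  qed
  then have "S \<in> null_sets lborel" by (rule countable_imp_null_set_lborel)
  then have "AE s in lborel. s \<notin> S" by (rule AE_not_in)
  then show "AE s in lborel. f s = g s" by eventually_elim (rule fg)
qed

section \<open>Impulses of solutions\<close>

lemma pw_rep_represents: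
  assumes "is_pw_distr U"
  shows "represents (fst (pw_rep U)) (snd (pw_rep U)) U"
proof -
  have "\<exists>p. case p of (f, D) \<Rightarrow> represents f D U" using assms by (auto simp: is_pw_distr_def)
  then have "case pw_rep U of (f, D) \<Rightarrow> represents f D U" unfolding pw_rep_def by (rule someI_ex)
  then show ?thesis by (simp add: case_prod_beta)
qed

lemma represents_is_pw_distr: "represents f D U \<Longrightarrow> is_pw_distr U"
  by (auto simp: is_pw_distr_def)

lemma impulse_part_eq:
  assumes "represents f D U" shows "impulse_part U t = D t"
  using represents_unique(1)[OF pw_rep_represents[OF represents_is_pw_distr[OF assms]] assms]
  by (simp add: impulse_part_def)

text \<open>\<open>restrict_distr\<close> works with the representation picked by
  \<open>pw_rep\<close>. By uniqueness its impulses are those of \<open>D\<close> and its function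
  part equals \<open>f\<close> almost everywhere, so any representation may be restricted instead; 0
  becomes a break point.\<close>

lemma represents_restrict:
  assumes U: "represents f D U"
  shows "represents (\<lambda>s. f s * indicator {0..} s) (\<lambda>t. if t \<in> {0..} then D t else 0) (restrict_distr {0..} U)"
    (is "represents ?f ?D _")
  unfolding represents_def
proof (intro conjI allI impI)
  have ind: "piecewise_smooth (\<lambda>s. g s * indicator {0..} s)" if g: "piecewise_smooth g" for g
  proof -
    obtain S where S: "locally_finite_set S" "smooth_between S g" using g by (auto simp: piecewise_smooth_iff)
    have "smooth_between (insert 0 S) (\<lambda>s. g s * indicator {0..} s)"
      by (rule smooth_between_indicator[OF smooth_between_mono[OF S(2)]]) auto
    moreover have "locally_finite_set (insert 0 S)"
      using locally_finite_set_Un[OF locally_finite_set_finite[of "{0}"] S(1)] by simp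
    ultimately show ?thesis by (auto simp: piecewise_smooth_iff)
  qed
  show f: "piecewise_smooth ?f" using U by (intro ind) (simp add: represents_def)
  have "locally_finite_set {t. D t \<noteq> 0}" using U by (simp add: represents_def)
  then show "locally_finite_set {t. ?D t \<noteq> 0}" by (rule locally_finite_set_subset) auto
  fix \<phi> assume \<phi>: "test_fun \<phi>"
  define g where "g = fst (pw_rep U)"
  have rep: "represents g (snd (pw_rep U)) U"
    unfolding g_def by (rule pw_rep_represents[OF represents_is_pw_distr[OF U]])
  have D: "snd (pw_rep U) = D" and ae: "AE s in lborel. g s = f s"
    using represents_unique[OF rep U] by auto
  have g: "piecewise_smooth (\<lambda>s. g s * indicator {0..} s)" using rep by (intro ind) (simp add: represents_def)
  have "(LINT s|lborel. g s * indicator {0..} s * \<phi> s) = (LINT s|lborel. ?f s * \<phi> s)"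
  proof (rule integral_cong_AE)
    show "(\<lambda>s. g s * indicator {0..} s * \<phi> s) \<in> borel_measurable lborel"
      using piecewise_smooth_integrable[OF g \<phi>] by (rule borel_measurable_integrable)
    show "(\<lambda>s. ?f s * \<phi> s) \<in> borel_measurable lborel"
      using piecewise_smooth_integrable[OF f \<phi>] by (rule borel_measurable_integrable)
    show "AE s in lborel. g s * indicator {0..} s * \<phi> s = ?f s * \<phi> s" using ae by eventually_elim simp
  qed
  then show "restrict_distr {0..} U \<phi> = pw_distr ?f ?D \<phi>"
    unfolding restrict_distr_def pw_distr_def D g_def by simp
qed

lemma distr_eq_on_impulse:
  assumes eq: "distr_eq_on k {0..} U V" and i: "i < k"
    and f: "represents f D (component U i)" and g: "represents g D' (component V i)" and t: "t \<ge> 0"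
  shows "D t = D' t"
proof -
  have "(\<lambda>t. if t \<in> {0..} then D t else 0) = (\<lambda>t. if t \<in> {0..} then D' t else 0)"
    by (rule represents_unique(1)[OF represents_restrict[OF f] represents_restrict[OF g]])
      (use eq i in \<open>auto simp: distr_eq_on_def\<close>)
  from fun_cong[OF this, of t] show ?thesis using t by simp
qed

text \<open>Functions are compared on s > 0 but impulses on t >= 0: the point 0 is invisible to the
  integral and yet may carry an impulse.\<close>

lemma restrict_distr_eqI:
  assumes f: "represents f D U" and g: "represents g D' V"
    and D: "\<And>t. t \<ge> 0 \<Longrightarrow> D t = D' t" and fg: "\<And>s. s > 0 \<Longrightarrow> f s = g s" and \<phi>: "test_fun \<phi>"
  shows "restrict_distr {0..} U \<phi> = restrict_distr {0..} V \<phi>"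
proof -
  note rf = represents_restrict[OF f] and rg = represents_restrict[OF g]
  have pf: "piecewise_smooth (\<lambda>s. f s * indicator {0..} s)" and pg: "piecewise_smooth (\<lambda>s. g s * indicator {0..} s)"
    using rf rg by (auto simp: represents_def)
  have "(LINT s|lborel. f s * indicator {0..} s * \<phi> s) = (LINT s|lborel. g s * indicator {0..} s * \<phi> s)"
  proof (rule integral_cong_AE)
    show "(\<lambda>s. f s * indicator {0..} s * \<phi> s) \<in> borel_measurable lborel"
      using piecewise_smooth_integrable[OF pf \<phi>] by (rule borel_measurable_integrable)
    show "(\<lambda>s. g s * indicator {0..} s * \<phi> s) \<in> borel_measurable lborel"
      using piecewise_smooth_integrable[OF pg \<phi>] by (rule borel_measurable_integrable)
    show "AE s in lborel. f s * indicator {0..} s * \<phi> s = g s * indicator {0..} s * \<phi> s"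
      using AE_lborel_singleton[of 0]
    proof eventually_elim
      case (elim s)
      show ?case using elim fg[of s] by (cases "s > 0") (auto simp: indicator_def)
    qed
  qed
  moreover have "(\<lambda>t. if t \<in> {0..} then D t else 0) = (\<lambda>t. if t \<in> {0..} then D' t else 0)"
    using D by auto
  ultimately show ?thesis using rf rg \<phi> by (simp add: represents_def pw_distr_def)
qed

lemma represents_mat_distr:
  assumes X: "X \<in> carrier_mat k n" and i: "i < k" and x: "\<And>\<phi>. x \<phi> \<in> carrier_vec n"
    and r: "\<And>j. j < n \<Longrightarrow> represents (f j) (D j) (component x j)"
  shows "represents (\<lambda>s. \<Sum>j<n. X $$ (i, j) * f j s) (\<lambda>t. \<Sum>j<n. Polynomial.smult (X $$ (i, j)) (D j t))
    (component (mat_distr X x) i)"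
proof -
  have "component (mat_distr X x) i = (\<lambda>\<phi>. \<Sum>j<n. X $$ (i, j) * component x j \<phi>)"
  proof
    fix \<phi>
    have "dim_vec (x \<phi>) = n" using x[of \<phi>] by simp
    then show "component (mat_distr X x) i \<phi> = (\<Sum>j<n. X $$ (i, j) * component x j \<phi>)"
      using X i by (simp add: component_def mat_distr_def scalar_prod_def atLeast0LessThan)
  qed
  then show ?thesis using represents_sum[of "{..<n}" f D "component x" "\<lambda>j. X $$ (i, j)"] r by simp
qed

text \<open>The coefficients of a fixed order form a vector on which the matrix acts directly. This
  turns equations between impulses into equations between vectors.\<close>

lemma coeff_sum_smult:
  fixes X :: "real mat" and a :: "real vec"
  assumes "X \<in> carrier_mat k n" "i < k" "\<And>j. j < n \<Longrightarrow> coeff (P j) q = a $ j" "a \<in> carrier_vec n"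
  shows "coeff (\<Sum>j<n. Polynomial.smult (X $$ (i, j)) (P j)) q = (X *\<^sub>v a) $ i"
  using assms by (simp add: coeff_sum scalar_prod_def atLeast0LessThan)

lemma component_distr_deriv:
  assumes "\<And>\<phi>. x \<phi> \<in> carrier_vec n" "j < n"
  shows "component (distr_deriv x) j = (\<lambda>\<phi>. - component x j (deriv \<phi>))"
proof
  fix \<phi>
  have "dim_vec (x (deriv \<phi>)) = n" using assms(1)[of "deriv \<phi>"] by simp
  then show "component (distr_deriv x) j \<phi> = - component x j (deriv \<phi>)"
    using assms(2) by (simp add: component_def distr_deriv_def)
qed

text \<open>From index k on, the coefficients form a chain that has reached zero beyond
  \<open>N\<close>, so \<open>a k\<close> is in the Wong limit. Its image under \<open>A\<close> is
  \<open>E b\<close> for k = 0 and \<open>E a_(k-1)\<close> otherwise, hence in the range of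
  \<open>E\<close>.\<close>

lemma impulse_coefficients_solution:
  fixes E A C K :: "real mat"
  assumes E: "E \<in> carrier_mat m n" and A: "A \<in> carrier_mat m n" and C: "C \<in> carrier_mat p n" and K: "K \<in> carrier_mat r n"
    and sub: "mat_preim A (mat_range E) \<inter> wong_W_lim E A (0\<^sub>m m l) C \<subseteq> mat_kernel K"
    and a: "\<And>k. a k \<in> carrier_vec n" and b: "b \<in> carrier_vec n" and E0: "E *\<^sub>v b = A *\<^sub>v a 0"
    and Ea: "\<And>k. E *\<^sub>v a k = A *\<^sub>v a (Suc k)" and Ca: "\<And>k. C *\<^sub>v a k = 0\<^sub>v p" and fin: "\<And>k. k > N \<Longrightarrow> a k = 0\<^sub>v n"
  shows "K *\<^sub>v a k = 0\<^sub>v r"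
proof -
  have "wong_chain E A C 1 (Suc N) (\<lambda>i. a (k + i))"
    unfolding wong_chain_def using E C a Ea Ca fin[of "k + Suc N"] by auto
  then have "a k \<in> wong_W E A (0\<^sub>m m l) C (Suc N)"
    using wong_W_iff_chain[OF E A C, of 1 "a k" l "Suc N"] by (metis add_0_right one_neq_zero)
  then have W: "a k \<in> wong_W_lim E A (0\<^sub>m m l) C" unfolding wong_W_lim_def by blast
  have "A *\<^sub>v a k \<in> mat_range E"
  proof (cases k)
    case 0
    then show ?thesis using E0[symmetric] b E by (auto simp: mat_range_def mat_im_def)
  next
    case (Suc k')
    then show ?thesis using Ea[of k', symmetric] a[of k'] E by (auto simp: mat_range_def mat_im_def)
  qed
  then have "a k \<in> mat_kernel K" using sub W a[of k] A by (auto simp: mat_preim_def)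
  then show ?thesis by (simp add: mat_kernel[OF K])
qed

section \<open>Partial impulse observability as a kernel inclusion\<close>

lemma partially_impulse_observable_if:
  fixes E A C K :: "real mat"
  assumes E: "E \<in> carrier_mat m n" and A: "A \<in> carrier_mat m n" and C: "C \<in> carrier_mat p n" and K: "K \<in> carrier_mat r n"
    and sub: "mat_preim A (mat_range E) \<inter> wong_W_lim E A (0\<^sub>m m l) C \<subseteq> mat_kernel K"
  shows "partially_impulse_observable E A C K"
proof -
  have "impulse_free_at r z t"
    if beh: "(x, y, z) \<in> distr_behaviour E A C K" and y: "\<And>t. t \<ge> 0 \<Longrightarrow> impulse_free_at p y t" and t: "t \<ge> 0"
    for x y z t
  proof -
    have x: "x \<in> pw_distr_vec n" and yd: "y \<in> pw_distr_vec p" and zd: "z \<in> pw_distr_vec r"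
      and eqE: "distr_eq_on m {0..} (mat_distr E (distr_deriv x)) (mat_distr A x)"
      and eqC: "distr_eq_on p {0..} y (mat_distr C x)" and eqK: "distr_eq_on r {0..} z (mat_distr K x)"
      using beh E C K by (auto simp: distr_behaviour_def)
    have xc: "x \<phi> \<in> carrier_vec n" for \<phi> using x by (simp add: pw_distr_vec_def)
    have dxc: "distr_deriv x \<phi> \<in> carrier_vec n" for \<phi> using xc by (simp add: distr_deriv_def)
    have "\<forall>j<n. \<exists>f D. represents f D (component x j)"
      using x by (auto simp: pw_distr_vec_def is_pw_distr_def)
    then obtain f D where fD: "\<And>j. j < n \<Longrightarrow> represents (f j) (D j) (component x j)" by metis
    \<comment> \<open>\<open>represents_deriv\<close> supplies the jump of component j at t as
      \<open>c j t\<close>. It is kept abstract, because membership in the range of \<open>E\<close>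
      asks only for some vector \<open>b\<close>.\<close>
    have "\<exists>g c. represents g (\<lambda>t. pCons (c t) (D j t)) (component (distr_deriv x) j)" if j: "j < n" for j
    proof -
      obtain S where "locally_finite_set S" "smooth_between S (f j)"
        using fD[OF j] by (auto simp: represents_def piecewise_smooth_iff)
      from represents_deriv[OF fD[OF j] this] show ?thesis
        unfolding component_distr_deriv[OF xc j] by (intro exI)
    qed
    then obtain g c where gc: "\<And>j. j < n \<Longrightarrow> represents (g j) (\<lambda>t. pCons (c j t) (D j t)) (component (distr_deriv x) j)"
      by metis
    define a where "a = (\<lambda>k. vec n (\<lambda>j. coeff (D j t) k))"
    define b where "b = vec n (\<lambda>j. c j t)"
    have ac: "a k \<in> carrier_vec n" and aj: "j < n \<Longrightarrow> coeff (D j t) k = a k $ j" for k j by (auto simp: a_def)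
    have bc: "b \<in> carrier_vec n" by (simp add: b_def)
    \<comment> \<open>The coefficient of order 0 will give \<open>E b = A a_0\<close>, that of order
      k + 1 will give \<open>E a_k = A a_(k+1)\<close>. The behaviour differentiates first and
      restricts afterwards, so at t = 0 the jump from the unconstrained past is included.\<close>
    have rowE: "(\<Sum>j<n. Polynomial.smult (E $$ (i, j)) (pCons (c j t) (D j t))) = (\<Sum>j<n. Polynomial.smult (A $$ (i, j)) (D j t))"
      if i: "i < m" for i
      by (rule distr_eq_on_impulse[OF eqE i represents_mat_distr[OF E i dxc gc] represents_mat_distr[OF A i xc fD] t])
    have "(E *\<^sub>v b) $ i = (A *\<^sub>v a 0) $ i" if i: "i < m" for i
      using arg_cong[OF rowE[OF i], of "\<lambda>P. coeff P 0"] coeff_sum_smult[OF A i aj ac, of 0]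
        coeff_sum_smult[OF E i _ bc, of "\<lambda>j. pCons (c j t) (D j t)" 0] by (simp add: b_def)
    then have E0: "E *\<^sub>v b = A *\<^sub>v a 0" using E A by (intro eq_vecI) auto
    have "(E *\<^sub>v a k) $ i = (A *\<^sub>v a (Suc k)) $ i" if i: "i < m" for i k
      using arg_cong[OF rowE[OF i], of "\<lambda>P. coeff P (Suc k)"] coeff_sum_smult[OF A i aj ac, of "Suc k"]
        coeff_sum_smult[OF E i _ ac[of k], of "\<lambda>j. pCons (c j t) (D j t)" "Suc k"] by (simp add: a_def)
    then have Ea: "E *\<^sub>v a k = A *\<^sub>v a (Suc k)" for k using E A by (intro eq_vecI) auto
    have "(C *\<^sub>v a k) $ i = 0" if i: "i < p" for i k
    proof -
      obtain f' D' where y': "represents f' D' (component y i)"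
        using yd i by (auto simp: pw_distr_vec_def is_pw_distr_def)
      have "D' t = 0" using y[OF t] i impulse_part_eq[OF y', of t] by (simp add: impulse_free_at_def)
      then have "(\<Sum>j<n. Polynomial.smult (C $$ (i, j)) (D j t)) = 0"
        using distr_eq_on_impulse[OF eqC i y' represents_mat_distr[OF C i xc fD] t] by simp
      then show ?thesis using coeff_sum_smult[OF C i aj ac, of k] by simp
    qed
    then have Ca: "C *\<^sub>v a k = 0\<^sub>v p" for k using C by (intro eq_vecI) auto
    define N where "N = (\<Sum>j<n. Polynomial.degree (D j t))"
    have "a k = 0\<^sub>v n" if "k > N" for k
    proof -
      have "Polynomial.degree (D j t) < k" if "j < n" for j
        using member_le_sum[of j "{..<n}" "\<lambda>j. Polynomial.degree (D j t)"] that \<open>k > N\<close> by (simp add: N_def)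
      then show ?thesis by (intro eq_vecI) (auto simp: a_def coeff_eq_0)
    qed
    then have Ka: "K *\<^sub>v a k = 0\<^sub>v r" for k
      using impulse_coefficients_solution[OF E A C K sub ac bc E0 Ea Ca] by blast
    show ?thesis unfolding impulse_free_at_def
    proof (intro allI impI)
      fix i assume i: "i < r"
      obtain f' D' where z': "represents f' D' (component z i)"
        using zd i by (auto simp: pw_distr_vec_def is_pw_distr_def)
      have "D' t = (\<Sum>j<n. Polynomial.smult (K $$ (i, j)) (D j t))"
        by (rule distr_eq_on_impulse[OF eqK i z' represents_mat_distr[OF K i xc fD] t])
      also have "\<dots> = 0"
        using coeff_sum_smult[OF K i aj ac] Ka i by (intro poly_eqI) simp
      finally show "impulse_part (component z i) t = 0" by (simp add: impulse_part_eq[OF z'])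
    qed
  qed
  then show ?thesis unfolding partially_impulse_observable_def using C K by auto
qed

text \<open>The chain \<open>v\<close> of a vector in the Wong limit is realized as the impulse
  \<open>\<Sum>i. v i \<delta>^(i)\<close> at time zero, triggered by the jump from \<open>- b\<close> to \<open>0\<close>.\<close>

lemma partially_impulse_observableD:
  fixes E A C K :: "real mat"
  assumes E: "E \<in> carrier_mat m n" and A: "A \<in> carrier_mat m n" and C: "C \<in> carrier_mat p n" and K: "K \<in> carrier_mat r n"
    and pio: "partially_impulse_observable E A C K"
  shows "mat_preim A (mat_range E) \<inter> wong_W_lim E A (0\<^sub>m m l) C \<subseteq> mat_kernel K"
proof
  fix a assume a: "a \<in> mat_preim A (mat_range E) \<inter> wong_W_lim E A (0\<^sub>m m l) C"
  then have ac: "a \<in> carrier_vec n" using A by (auto simp: mat_preim_def)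
  obtain b where b: "b \<in> carrier_vec n" "A *\<^sub>v a = E *\<^sub>v b"
    using a E by (auto simp: mat_preim_def mat_range_def mat_im_def)
  obtain k where "a \<in> wong_W E A (0\<^sub>m m l) C k" using a by (auto simp: wong_W_lim_def)
  then obtain v where v: "wong_chain E A C 1 k v" "v 0 = a" using wong_W_iff_chain[OF E A C, of 1 a l k] by auto
  \<comment> \<open>Extended by zero, the finite chain satisfies the link equations at every index,
    matching polynomial coefficients beyond the degree.\<close>
  define w where "w = (\<lambda>i. if i \<le> k then v i else 0\<^sub>v n)"
  have wc: "w i \<in> carrier_vec n" for i using v(1) E by (auto simp: w_def wong_chain_def)
  have wk: "w i = 0\<^sub>v n" if "i \<ge> k" for i using v(1) E that by (cases "i = k") (auto simp: w_def wong_chain_def)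
  have zero: "X *\<^sub>v 0\<^sub>v n = 0\<^sub>v q" if "X \<in> carrier_mat q n" for X :: "real mat" and q using that by auto
  have wE: "E *\<^sub>v w i = A *\<^sub>v w (Suc i)" for i
  proof (cases "i < k")
    case True
    then have "E *\<^sub>v v i = 1 \<cdot>\<^sub>v (A *\<^sub>v v (Suc i))" using v(1) unfolding wong_chain_def by blast
    then show ?thesis using True by (simp add: w_def)
  next
    case False
    then show ?thesis using wk[of i] wk[of "Suc i"] zero[OF E] zero[OF A] by simp
  qed
  have wC: "C *\<^sub>v w i = 0\<^sub>v p" for i
  proof (cases "i < k")
    case True
    then have "C *\<^sub>v v i = 0\<^sub>v (dim_row C)" using v(1) unfolding wong_chain_def by blast
    then show ?thesis using True C by (simp add: w_def)
  next
    case False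
    then show ?thesis using wk[of i] zero[OF C] by simp
  qed
  have w0: "w 0 = a" using v(2) by (simp add: w_def)
  define P where "P = (\<lambda>j. \<Sum>i<k. Polynomial.monom (w i $ j) i)"
  have P: "coeff (P j) i = w i $ j" if "j < n" for i j
    using that wk[of i] by (cases "i < k") (simp_all add: P_def coeff_sum)
  \<comment> \<open>Both \<open>f\<close> and its derivative vanish for s > 0, so the equation holds
    there trivially; no equation is imposed for s < 0, which leaves room for the value - b that
    makes the jump at 0 equal to \<open>b\<close>.\<close>
  define f where "f = (\<lambda>j (s::real). if s < 0 then - b $ j else 0 :: real)"
  define D where "D = (\<lambda>j t. if t = (0::real) then P j else 0)"
  define x where "x = (\<lambda>\<phi>. vec n (\<lambda>j. pw_distr (f j) (D j) \<phi>))"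
  have xc: "x \<phi> \<in> carrier_vec n" for \<phi> by (simp add: x_def)
  have dxc: "distr_deriv x \<phi> \<in> carrier_vec n" for \<phi> using xc by (simp add: distr_deriv_def)
  have S: "locally_finite_set {0}" by (simp add: locally_finite_set_finite)
  have fS: "smooth_between {0} (f j)" for j
    unfolding smooth_between_def
  proof (intro allI impI)
    fix c d :: real assume *: "c < d" "{c<..<d} \<inter> {0} = {}"
    then consider "d \<le> 0" | "c \<ge> 0" by fastforce
    then show "\<exists>g. smooth_fun g \<and> (\<forall>s\<in>{c<..<d}. f j s = g s)"
    proof cases
      case 1
      then show ?thesis by (intro exI[of _ "\<lambda>s. - b $ j"]) (auto simp: smooth_fun_const f_def)
    next
      case 2
      then show ?thesis by (intro exI[of _ "\<lambda>s. 0"]) (auto simp: smooth_fun_const f_def)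
    qed
  qed
  have fD: "represents (f j) (D j) (component x j)" if "j < n" for j
  proof -
    have "{t. D j t \<noteq> 0} \<subseteq> {0}" by (auto simp: D_def)
    then have "locally_finite_set {t. D j t \<noteq> 0}" using locally_finite_set_subset[OF S] by blast
    then show ?thesis using S fS[of j] that
      by (auto simp: represents_def piecewise_smooth_iff component_def x_def)
  qed
  have j0: "jump (f j) 0 = b $ j" for j
    using one_sided_limits(1)[of 0 1 "\<lambda>s. 0" "f j"] one_sided_limits(2)[of "-1" 0 "\<lambda>s. - b $ j" "f j"]
    by (simp add: smooth_fun_const f_def)
  define D' where "D' = (\<lambda>j t. pCons (if t = 0 then b $ j else 0) (D j t))"
  have dfD: "represents (deriv (f j)) (D' j) (component (distr_deriv x) j)" if "j < n" for j
  proof -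
    have "D' j = (\<lambda>t. pCons (if t \<in> {0} then jump (f j) t else 0) (D j t))" by (auto simp: D'_def j0)
    then show ?thesis using represents_deriv[OF fD[OF that] S fS] unfolding component_distr_deriv[OF xc that] by simp
  qed
  have df: "deriv (f j) s = 0" if "s > 0" for j s
  proof -
    have "(f j has_real_derivative 0) (at s)"
      by (rule has_field_derivative_transform_within_open[of "\<lambda>s. 0" 0 s "{0<..}"]) (use that in \<open>auto simp: f_def\<close>)
    then show ?thesis by (rule DERIV_imp_deriv)
  qed
  have "distr_eq_on m {0..} (mat_distr E (distr_deriv x)) (mat_distr A x)"
    unfolding distr_eq_on_def
  proof (intro allI impI)
    fix i \<phi> assume i: "i < m" and \<phi>: "test_fun \<phi>"
    show "restrict_distr {0..} (component (mat_distr E (distr_deriv x)) i) \<phi>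
        = restrict_distr {0..} (component (mat_distr A x) i) \<phi>"
    proof (rule restrict_distr_eqI[OF represents_mat_distr[OF E i dxc dfD] represents_mat_distr[OF A i xc fD] _ _ \<phi>])
      fix t :: real
      show "(\<Sum>j<n. Polynomial.smult (E $$ (i, j)) (D' j t)) = (\<Sum>j<n. Polynomial.smult (A $$ (i, j)) (D j t))"
      proof (cases "t = 0")
        case True
        \<comment> \<open>Order 0 carries the jump and amounts to \<open>E b = A a\<close>; order q'
          + 1 amounts to the link \<open>E w_q' = A w_(q'+1)\<close>.\<close>
        have "coeff (\<Sum>j<n. Polynomial.smult (E $$ (i, j)) (D' j 0)) q = coeff (\<Sum>j<n. Polynomial.smult (A $$ (i, j)) (P j)) q" for q
        proof (cases q)
          case 0
          have "coeff (\<Sum>j<n. Polynomial.smult (E $$ (i, j)) (D' j 0)) 0 = (E *\<^sub>v b) $ i"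
            by (rule coeff_sum_smult[OF E i _ b(1)]) (simp add: D'_def)
          then show ?thesis using 0 coeff_sum_smult[OF A i P wc, of 0] b(2) w0 by simp
        next
          case (Suc q')
          have "coeff (\<Sum>j<n. Polynomial.smult (E $$ (i, j)) (D' j 0)) (Suc q') = (E *\<^sub>v w q') $ i"
            by (rule coeff_sum_smult[OF E i _ wc]) (simp add: D'_def D_def P)
          then show ?thesis using Suc coeff_sum_smult[OF A i P wc, of "Suc q'"] wE[of q'] by simp
        qed
        then show ?thesis using True by (intro poly_eqI) (simp add: D_def)
      qed (simp add: D'_def D_def)
    next
      fix s :: real assume "s > 0"
      then show "(\<Sum>j<n. E $$ (i, j) * deriv (f j) s) = (\<Sum>j<n. A $$ (i, j) * f j s)"
        using df by (simp add: f_def)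
    qed
  qed
  moreover have in_vec: "mat_distr X x \<in> pw_distr_vec q" if X: "X \<in> carrier_mat q n" for X :: "real mat" and q
    using represents_is_pw_distr[OF represents_mat_distr[OF X _ xc fD]] X mult_mat_vec_carrier[OF X xc]
    by (auto simp: pw_distr_vec_def mat_distr_def)
  moreover have "x \<in> pw_distr_vec n"
    using xc represents_is_pw_distr[OF fD] by (auto simp: pw_distr_vec_def)
  moreover have "distr_eq_on q I U U" for q I U by (simp add: distr_eq_on_def)
  ultimately have "(x, mat_distr C x, mat_distr K x) \<in> distr_behaviour E A C K"
    using in_vec[OF C] in_vec[OF K] E C K by (simp add: distr_behaviour_def)
  moreover have "impulse_free_at (dim_row C) (mat_distr C x) t" for t
    unfolding impulse_free_at_def
  proof (intro allI impI)
    fix i assume "i < dim_row C"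
    then have i: "i < p" using C by simp
    have "(\<Sum>j<n. Polynomial.smult (C $$ (i, j)) (D j t)) = 0"
      using coeff_sum_smult[OF C i P wc] wC i by (cases "t = 0") (auto intro!: poly_eqI simp: D_def)
    then show "impulse_part (component (mat_distr C x) i) t = 0"
      using impulse_part_eq[OF represents_mat_distr[OF C i xc fD]] by simp
  qed
  ultimately have free: "impulse_free_at (dim_row K) (mat_distr K x) 0"
    using pio unfolding partially_impulse_observable_def by fastforce
  have "(K *\<^sub>v a) $ i = 0" if i: "i < r" for i
  proof -
    have "(\<Sum>j<n. Polynomial.smult (K $$ (i, j)) (D j 0)) = 0"
      using free i K impulse_part_eq[OF represents_mat_distr[OF K i xc fD], of 0]
      by (simp add: impulse_free_at_def)
    then have "(\<Sum>j<n. Polynomial.smult (K $$ (i, j)) (P j)) = 0" by (simp add: D_def)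
    then show ?thesis using coeff_sum_smult[OF K i P wc, of 0] w0 by simp
  qed
  then have "K *\<^sub>v a = 0\<^sub>v r" using K by (intro eq_vecI) auto
  then show "a \<in> mat_kernel K" using ac by (simp add: mat_kernel[OF K])
qed

section \<open>The equivalences\<close>

theorem theorem3p7:
  fixes E A B C D K :: "real mat" and m n l p r :: nat
  assumes "n \<ge> 1"
    and "E \<in> carrier_mat m n" and "A \<in> carrier_mat m n" and "B \<in> carrier_mat m l"
    and "C \<in> carrier_mat p n" and "D \<in> carrier_mat p l"
    and "K \<in> carrier_mat r n" and "r \<le> n"
  defines "Ebar \<equiv> E @\<^sub>r 0\<^sub>m p n"
    and "Abar \<equiv> A @\<^sub>r C"
    and "Escr \<equiv> E @\<^sub>c 0\<^sub>m m l"
    and "Ascr \<equiv> A @\<^sub>c B"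
    and "Acal1 \<equiv> 0\<^sub>m ((n - 1) * m) n @\<^sub>r A"
    and "Acal \<equiv> (0\<^sub>m ((n - 1) * m) n @\<^sub>r A) @\<^sub>c 0\<^sub>m (n * m) ((n - 1) * n)"
    and "Ccal \<equiv> C @\<^sub>c 0\<^sub>m p ((n - 1) * n)"
    and "Kcal \<equiv> K @\<^sub>c 0\<^sub>m r ((n - 1) * n)"
  defines "F \<equiv> block_bidiag n Escr Ascr"
    and "Fbar \<equiv> block_bidiag n Ebar Abar"
  defines "stmt_i \<equiv>
      mrank ((F @\<^sub>c Acal)
          @\<^sub>r (0\<^sub>m p (n * (n + l)) @\<^sub>c Ccal)
          @\<^sub>r (0\<^sub>m (n * (m + p)) (n * (n + l)) @\<^sub>c Fbar)
          @\<^sub>r (0\<^sub>m r (n * (n + l)) @\<^sub>c Kcal))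
    = mrank ((F @\<^sub>c Acal)
          @\<^sub>r (0\<^sub>m p (n * (n + l)) @\<^sub>c Ccal)
          @\<^sub>r (0\<^sub>m (n * (m + p)) (n * (n + l)) @\<^sub>c Fbar))"
    and "stmt_ii \<equiv>
      mat_preim Acal (mat_range F) \<inter> mat_kernel Ccal \<inter> mat_kernel Fbar \<subseteq> mat_kernel Kcal"
    and "stmt_iii \<equiv>
      mat_preim Acal1 (mat_range F) \<inter> wong_W_lim E A (0\<^sub>m m l) C \<subseteq> mat_kernel K"
    and "stmt_iv \<equiv>
      mat_preim A (mat_im E (wong_V E A B (0\<^sub>m p n) (n - 1))) \<inter> wong_W_lim E A (0\<^sub>m m l) C
        \<subseteq> mat_kernel K"
    and "stmt_v \<equiv> \<lambda>S T m1 n1.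
      partially_impulse_observable
        (block_at (S * E * T) 0 0 m1 n1) (block_at (S * A * T) 0 0 m1 n1)
        (block_at (C * T) 0 0 p n1) (block_at (K * T) 0 0 r n1)"
  shows "(stmt_i \<longleftrightarrow> stmt_ii) \<and> (stmt_ii \<longleftrightarrow> stmt_iii) \<and> (stmt_iii \<longleftrightarrow> stmt_iv) \<and>
    (\<forall>S T m1 m2 m3 n1 n2 n3.
       kalman_controllability_decomposition E A B S T (m1, m2, m3) (n1, n2, n3) \<longrightarrow>
         (stmt_iv \<longleftrightarrow> stmt_v S T m1 n1))"
proof -
  note E = assms(2) and A = assms(3) and B = assms(4) and C = assms(5) and K = assms(7)
  have nn: "n + (n - 1) * n = n * n" "(n - 1) * m + m = n * m" using \<open>n \<ge> 1\<close> by (cases n; simp)+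
  have Es: "Escr \<in> carrier_mat m (n + l)" and Eb: "Ebar \<in> carrier_mat (m + p) n"
    unfolding Escr_def Ebar_def using E by auto
  have F: "F \<in> carrier_mat (n * m) (n * (n + l))" and Fbar: "Fbar \<in> carrier_mat (n * (m + p)) (n * n)"
    unfolding F_def Fbar_def by (rule block_bidiag_carrier[OF Es], rule block_bidiag_carrier[OF Eb])
  have A1: "Acal1 \<in> carrier_mat (n * m) n"
    unfolding Acal1_def using carrier_append_rows[OF _ A, of "0\<^sub>m ((n - 1) * m) n" "(n - 1) * m"] nn by simp
  have Acal: "Acal = Acal1 @\<^sub>c 0\<^sub>m (n * m) ((n - 1) * n)" unfolding Acal_def Acal1_def ..
  have cols: "X @\<^sub>c 0\<^sub>m k ((n - 1) * n) \<in> carrier_mat k (n * n)" if "X \<in> carrier_mat k n" for X :: "real mat" and k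
    using append_cols_carrier[OF that, of "0\<^sub>m k ((n - 1) * n)" "(n - 1) * n"] nn by simp
  have "stmt_i \<longleftrightarrow> stmt_ii"
    unfolding stmt_i_def stmt_ii_def
    by (rule rank_eq_iff_preim_subset[OF F _ _ Fbar])
      (auto simp only: Acal Ccal_def Kcal_def intro!: cols A1 C K)
  moreover have "stmt_ii \<longleftrightarrow> stmt_iii"
    unfolding stmt_ii_def stmt_iii_def Acal Ccal_def Kcal_def Fbar_def Ebar_def Abar_def
    by (rule kernel_subset_iff_first_block[OF \<open>n \<ge> 1\<close> E A C K A1])
  \<comment> \<open>The two preimages coincide as sets, so (iii) and (iv) are the same
    inclusion.\<close>
  moreover have "stmt_iii \<longleftrightarrow> stmt_iv"
    unfolding stmt_iii_def stmt_iv_def Acal1_def F_def Escr_def Ascr_def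
    by (simp only: preim_range_block_bidiag[OF \<open>n \<ge> 1\<close> E A B, of p])
  moreover have "stmt_iv \<longleftrightarrow> stmt_v S T m1 n1"
    if kcd: "kalman_controllability_decomposition E A B S T (m1, m2, m3) (n1, n2, n3)"
    for S T m1 m2 m3 n1 n2 n3
  proof -
    have dims: "dim_row E = m" "dim_col E = n" "dim_col B = l" using E B by auto
    note k = kcd[unfolded kalman_controllability_decomposition_def dims Let_def split]
    have S: "S \<in> carrier_mat m m" "invertible_mat S" and T: "T \<in> carrier_mat n n" "invertible_mat T"
      and m: "m = m1 + m2 + m3" and n: "n = n1 + n2 + n3"
      using k by auto
    let ?E = "S * E * T" and ?A = "S * A * T" and ?B = "S * B" and ?C = "C * T" and ?K = "K * T"
    note c = equiv_carrier(1)[OF E A B C K S T E] equiv_carrier(1)[OF E A B C K S T A]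
      equiv_carrier(2-4)[OF E A B C K S T]
    \<comment> \<open>The zero input of the first subsystem is given width 0; both the reduction to
      blocks and the observability criterion hold for every width.\<close>
    have "stmt_iv \<longleftrightarrow> mat_preim (block_at ?A 0 0 m1 n1) (mat_range (block_at ?E 0 0 m1 n1))
        \<inter> wong_W_lim (block_at ?E 0 0 m1 n1) (block_at ?A 0 0 m1 n1) (0\<^sub>m m1 0) (block_at ?C 0 0 p n1)
      \<subseteq> mat_kernel (block_at ?K 0 0 r n1)"
      unfolding stmt_iv_def observability_subset_equiv[OF E A B C K S T]
      by (rule observability_subset_block[OF m n c]) (use k in blast)+
    also have "\<dots> \<longleftrightarrow> stmt_v S T m1 n1"
      unfolding stmt_v_def
      by (rule iffI, rule partially_impulse_observable_if[OF block_at_carrier block_at_carrier block_at_carrier block_at_carrier],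
          assumption, rule partially_impulse_observableD[OF block_at_carrier block_at_carrier block_at_carrier block_at_carrier])
    finally show ?thesis .
  qed
  ultimately show ?thesis by blast
qed

end
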